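(* Let $H$ be a Krull monoid whose class group $G$ is an elementary $2$-group, say $G\cong C_2^r$ with $r\in\mathbb N$, and suppose that every class contains a prime divisor. Then: 1. If $r=1$, then $\mathsf t(H)=2$ and $\mathsf t(G)=0$. 2. If $r=3$, then $\mathsf t(G)=4$, and if one nontrivial class contains at least two distinct prime divisors, then $\mathsf t(H)=5$. 3. If $r\ge 2$ is even, then $\mathsf t(H)=\mathsf t(G)=1+\frac{r^2}{2}$. If $r\ge 5$ is odd, then $\mathsf t(H)=\mathsf t(G)\ge 2+\frac{r(r-1)}{2}$.
   Context: $\mathbb N=\{1,2,\dots\}$, $\mathbb N_0=\mathbb N\cup\{0\}$. A monoid is a commutative cancellative semigroup with identity. For a monoid $H$: $H^\times$ is its group of units, $H_{\rm red}=\{aH^\times: a\in H\}$, $\mathcal A(H)$ its set of atoms (irreducible elements), $\mathsf q(H)$ its quotient group. $\mathcal F(P)$ is the free abelian monoid with basis $P$; for $a=\prod_{p\in P}p^{\mathsf v_p(a)}\in\mathcal F(P)$ put $|a|=\sum_p\mathsf v_p(a)$. Factorizations and tame degree: $\mathsf Z(H)=\mathcal F(\mathcal A(H_{\rm red}))$, $\pi:\mathsf Z(H)\to H_{\rm red}$ is the homomorphism with $\pi(u)=u$ on atoms, $\mathsf Z(a)=\pi^{-1}(aH^\times)$ for $a\in H$. For $z,z'\in\mathsf Z(H)$, $\mathsf d(z,z')=\max\{|z\gcd(z,z')^{-1}|,|z'\gcd(z,z')^{-1}|\}$. For $a\in H$ and $x\in\mathsf Z(H)$, $\mathsf t(a,x)\in\mathbb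 N_0\cup\{\infty\}$ is the smallest $N$ such that: if $\mathsf Z(a)\cap x\mathsf Z(H)\neq\emptyset$ and $z\in\mathsf Z(a)$, then there is $z'\in\mathsf Z(a)\cap x\mathsf Z(H)$ with $\mathsf d(z,z')\le N$. $\mathsf t(H,u)=\sup_{a\in H}\mathsf t(a,u)$ for $u\in\mathcal A(H_{\rm red})$, and $\mathsf t(H)=\sup\{\mathsf t(H,u):u\in\mathcal A(H_{\rm red})\}$ is the tame degree of $H$. Krull monoids: a monoid homomorphism $\varphi:H\to D$ is a divisor homomorphism if $\varphi(a)\mid\varphi(b)$ implies $a\mid b$. It is a divisor theory if $D=\mathcal F(P)$ for a set $P$, $\varphi$ is a divisor homomorphism, and each $p\in P$ equals $\gcd(\varphi(X))$ for some finite nonempty $X\subset H$. $H$ is a Krull monoid if it has a divisor theory $\varphi:H\to\mathcal F(P)$; this is essentially unique, and $G=\mathsf q(\mathcal F(P))/\mathsf q(\varphi(H))$ (written additively) is the class group of $H$. Elements of $P$ are the prime divisors; a class $g\in G$ contains the prime divisor $p$ if $[p]=g$. Zero-sum sequences: for an additive abelian group $G$, $\mathcal B(G)=\{g_1\cdots g_\ell\in\mathcal F(G): g_1+\dots+g_\ell=0\}$ is the monoid of zero-sum sequences over $G$, and $\mathsf t(G)=\mathsf t(\mathcal B(G))$. $C_2^r$ is the direct sum of $r$ copies of the group of order $2$. *)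

theory Defs
  imports "HOL-Algebra.Divisibility" "HOL-Algebra.FiniteProduct" "HOL-Algebra.Elementary_Groups" "HOL-Algebra.Product_Groups"
    "HOL-Library.Multiset" "HOL-Library.Extended_Nat"
begin

text \<open>
  A monoid is a structure satisfying the library locale \<^locale>\<open>comm_monoid_cancel\<close>. All structures,
  including abelian groups, are written multiplicatively.
\<close>

text \<open>In \<open>free_monoid P\<close> the length $|a|$ is \<^term>\<open>size a\<close>, and $\gcd(a, b)$ is \<open>a \<inter># b\<close>.\<close>

definition free_monoid :: "'p set \<Rightarrow> 'p multiset monoid"
  where "free_monoid P = \<lparr>carrier = {a. set_mset a \<subseteq> P}, monoid.mult = (+), one = {#}\<rparr>"

text \<open>
  The homomorphism from a free abelian monoid to \<open>M\<close> that extends the identity on the basis. For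
  factorizations it is $\pi$; for sequences over a group it is the sum of the sequence.
\<close>

definition mset_prod :: "('a, 'b) monoid_scheme \<Rightarrow> 'a multiset \<Rightarrow> 'a"
  where "mset_prod M S = (\<Otimes>\<^bsub>M\<^esub>x\<in>set_mset S. x [^]\<^bsub>M\<^esub> count S x)"

definition reduced_monoid :: "('a, 'b) monoid_scheme \<Rightarrow> 'a set monoid"
  where "reduced_monoid H =
    \<lparr>carrier = {a <#\<^bsub>H\<^esub> Units H | a. a \<in> carrier H},
     monoid.mult = (<#>\<^bsub>H\<^esub>),
     one = Units H\<rparr>"

definition monoid_atoms :: "('a, 'b) monoid_scheme \<Rightarrow> 'a set"
  where "monoid_atoms H = {u \<in> carrier H. irreducible H u}"

definition factorization_monoid :: "('a, 'b) monoid_scheme \<Rightarrow> 'a set multiset monoid"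
  where "factorization_monoid H = free_monoid (monoid_atoms (reduced_monoid H))"

definition factorizations :: "('a, 'b) monoid_scheme \<Rightarrow> 'a \<Rightarrow> 'a set multiset set"
  where "factorizations H a =
    {z \<in> carrier (factorization_monoid H). mset_prod (reduced_monoid H) z = a <#\<^bsub>H\<^esub> Units H}"

definition fact_dist :: "'u multiset \<Rightarrow> 'u multiset \<Rightarrow> nat"
  where "fact_dist z z' = max (size (z - (z \<inter># z'))) (size (z' - (z \<inter># z')))"

text \<open>The set $\mathsf Z(a) \cap x \mathsf Z(H)$.\<close>

definition factorizations_through ::
    "('a, 'b) monoid_scheme \<Rightarrow> 'a \<Rightarrow> 'a set multiset \<Rightarrow> 'a set multiset set"
  where "factorizations_through H a x =
    factorizations H a \<inter>
      (x <#\<^bsub>factorization_monoid H\<^esub> carrier (factorization_monoid H))"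

definition local_tame :: "('a, 'b) monoid_scheme \<Rightarrow> 'a \<Rightarrow> 'a set multiset \<Rightarrow> enat"
  where "local_tame H a x =
    (LEAST N. factorizations_through H a x \<noteq> {} \<longrightarrow>
       (\<forall>z \<in> factorizations H a. \<exists>z' \<in> factorizations_through H a x. enat (fact_dist z z') \<le> N))"

definition tame_degree_at :: "('a, 'b) monoid_scheme \<Rightarrow> 'a set \<Rightarrow> enat"
  where "tame_degree_at H u = (SUP a\<in>carrier H. local_tame H a {#u#})"

definition tame_degree :: "('a, 'b) monoid_scheme \<Rightarrow> enat"
  where "tame_degree H = (SUP u\<in>monoid_atoms (reduced_monoid H). tame_degree_at H u)"

definition frac_rel :: "('a, 'b) monoid_scheme \<Rightarrow> (('a \<times> 'a) \<times> ('a \<times> 'a)) set"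
  where "frac_rel M =
    {((a, b), (c, d)) | a b c d. {a, b, c, d} \<subseteq> carrier M \<and> a \<otimes>\<^bsub>M\<^esub> d = c \<otimes>\<^bsub>M\<^esub> b}"

text \<open>The formal fraction $a b^{-1}$.\<close>

definition fraction :: "('a, 'b) monoid_scheme \<Rightarrow> 'a \<Rightarrow> 'a \<Rightarrow> ('a \<times> 'a) set"
  where "fraction M a b = frac_rel M `` {(a, b)}"

definition quotient_group :: "('a, 'b) monoid_scheme \<Rightarrow> ('a \<times> 'a) set monoid"
  where "quotient_group M =
    \<lparr>carrier = {fraction M a b | a b. a \<in> carrier M \<and> b \<in> carrier M},
     monoid.mult = (\<lambda>x y. \<Union>(a, b)\<in>x. \<Union>(c, d)\<in>y. fraction M (a \<otimes>\<^bsub>M\<^esub> c) (b \<otimes>\<^bsub>M\<^esub> d)),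
     one = fraction M \<one>\<^bsub>M\<^esub> \<one>\<^bsub>M\<^esub>\<rparr>"

text \<open>The quotient group of a submonoid \<open>S\<close> of \<open>M\<close>, as a subgroup of the quotient group of \<open>M\<close>.\<close>

definition quotient_subgroup :: "('a, 'b) monoid_scheme \<Rightarrow> 'a set \<Rightarrow> ('a \<times> 'a) set set"
  where "quotient_subgroup M S = {fraction M a b | a b. a \<in> S \<and> b \<in> S}"

definition divisor_homomorphism ::
    "('a, 'b) monoid_scheme \<Rightarrow> ('c, 'd) monoid_scheme \<Rightarrow> ('a \<Rightarrow> 'c) \<Rightarrow> bool"
  where "divisor_homomorphism H D \<phi> \<longleftrightarrow>
    \<phi> \<in> hom H D \<and> \<phi> \<one>\<^bsub>H\<^esub> = \<one>\<^bsub>D\<^esub> \<and>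
    (\<forall>a\<in>carrier H. \<forall>b\<in>carrier H. \<phi> a divides\<^bsub>D\<^esub> \<phi> b \<longrightarrow> a divides\<^bsub>H\<^esub> b)"

text \<open>
  The greatest common divisor of a set is its greatest lower bound for divisibility; it is
  unique in \<open>free_monoid P\<close>, whose only unit is \<open>{#}\<close>. A monoid \<open>H\<close> is a Krull monoid if it has a
  divisor theory.
\<close>

definition divisor_theory :: "('a, 'b) monoid_scheme \<Rightarrow> 'p set \<Rightarrow> ('a \<Rightarrow> 'p multiset) \<Rightarrow> bool"
  where "divisor_theory H P \<phi> \<longleftrightarrow>
    divisor_homomorphism H (free_monoid P) \<phi> \<and>
    (\<forall>p\<in>P. \<exists>A. finite A \<and> A \<noteq> {} \<and> A \<subseteq> carrier H \<and>
       is_glb (division_rel (free_monoid P)) {#p#} (\<phi> ` A))"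

definition class_group ::
    "('a, 'b) monoid_scheme \<Rightarrow> 'p set \<Rightarrow> ('a \<Rightarrow> 'p multiset) \<Rightarrow> ('p multiset \<times> 'p multiset) set set monoid"
  where "class_group H P \<phi> =
    quotient_group (free_monoid P) Mod quotient_subgroup (free_monoid P) (\<phi> ` carrier H)"

definition prime_class ::
    "('a, 'b) monoid_scheme \<Rightarrow> 'p set \<Rightarrow> ('a \<Rightarrow> 'p multiset) \<Rightarrow> 'p \<Rightarrow> ('p multiset \<times> 'p multiset) set set"
  where "prime_class H P \<phi> p =
    quotient_subgroup (free_monoid P) (\<phi> ` carrier H)
      #>\<^bsub>quotient_group (free_monoid P)\<^esub> fraction (free_monoid P) {#p#} {#}"

definition zero_sum_monoid :: "('g, 'b) monoid_scheme \<Rightarrow> 'g multiset monoid"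
  where "zero_sum_monoid G =
    (free_monoid (carrier G))\<lparr>carrier := {S \<in> carrier (free_monoid (carrier G)). mset_prod G S = \<one>\<^bsub>G\<^esub>}\<rparr>"

definition elementary_2_group :: "nat \<Rightarrow> (nat \<Rightarrow> int) monoid"
  where "elementary_2_group r = sum_group {..<r} (\<lambda>_. integer_mod_group 2)"

end

theory Submission
  imports Defs "HOL-Library.Function_Algebras" "HOL-Library.Z2"
begin

text \<open>
  Factorizations in a Krull monoid are factorizations of zero-sum sequences over its class group,
  except that several primes may share a class. So \<open>H\<close> is replaced by the monoid of those
  sequences of primes whose classes sum to zero, and \<open>tame_degree H \<le> N\<close> becomes the elementary
  condition \<open>tame_bound\<close> (\<open>krull_model\<close>, \<open>zero_sum_monoid_model\<close>, \<open>tame_degree_le_iff\<close>). In an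
  elementary 2-group two equal terms have sum zero. Hence an atom is the zero element, a square, or
  an independent set together with its sum; its length is at most \<open>r + 1\<close>.

  Upper bounds. Let \<open>z\<close> be a factorization of a multiple of the atom \<open>u\<close>. A minimal part of \<open>z\<close> that
  covers \<open>u\<close> has \<open>n \<le> |u| \<le> r + 1\<close> atoms. Dividing its product by \<open>u\<close> leaves a product of \<open>n\<close>
  independent sets of classes (\<open>covering_indep\<close>), so the distance from \<open>z\<close> to a factorization
  containing \<open>u\<close> is at most the maximum of \<open>n\<close> and \<open>1 + l\<close>, where \<open>l\<close> is the length of a shortest
  factorization of this cofactor. Trivially \<open>l \<le> r n / 2\<close>, which suffices if \<open>n\<close> is small. The key
  to the remaining cases is \<open>odd_family_factorization\<close>: for odd \<open>n \<ge> r\<close> one has \<open>l \<le> r (n - 1) / 2\<close>.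
  For even \<open>r\<close> this covers \<open>n = r + 1\<close> and yields \<open>1 + r\<^sup>2 / 2\<close>.

  The key fact rests on a parity argument. In coordinates with respect to a basis, the members of
  \<open>n\<close> independent sets can be assigned to coordinates, each set using every coordinate at most
  once; if the total sum is zero and \<open>n\<close> is odd, a column that is used by all the sets must contain
  a further entry 1 (\<open>odd_family_weight\<close>). Thus a factorization all of whose atoms \<open>V\<close> have Hamming
  weight at most \<open>2 |V| - 2\<close> is short. Such a basis is extracted from a factorization of minimal
  length with as many atoms other than squares as possible: the squared elements form an independent
  set \<open>Q\<close>, and exchange arguments (\<open>absorption\<close>) show that the other atoms are circuits
  of \<open>Q\<close>. If \<open>Q\<close> spans only a hyperplane, the atoms leaving the hyperplane form a matching
  of points of maximal total Hamming distance, and one needs a point between the two ends of every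
  edge (\<open>two_triples_good\<close>).

  For odd \<open>r\<close> and \<open>n = r + 1\<close> there are two cases. If the classes of \<open>u\<close> are already covered by
  fewer atoms, then one atom can be split off from the cofactor and the key fact for \<open>n = r\<close>
  applies. If not, the same distance is attained over the class group (\<open>tame_bound_transfer\<close>).
  Thus both tame degrees agree as soon as the one of the group is at least \<open>2 + r (r - 1) / 2\<close>.

  Lower bounds. Take a basis \<open>h\<close> and vectors \<open>g\<^sub>0, \<dots>, g\<^sub>r\<close> with sum zero, any \<open>r\<close> of
  which are independent. Each \<open>g\<^sub>i\<close> is the sum of a subset of the basis and forms an atom with it, and
  the \<open>g\<^sub>i\<close> form an atom \<open>u\<close>. After division by \<open>u\<close> only squares of basis elements remain, as
  many as half the number of ones in the coordinate matrix of the \<open>g\<^sub>i\<close> (\<open>matrix_lower_bound\<close>).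
  The column sums have to be even, and the matrices chosen have as many ones as possible; ranks one
  and two, and the group of rank three, have ad hoc examples.
\<close>

section \<open>Elementary 2-groups, independence and coordinates\<close>

text \<open>
  Linear independence over the field with two elements: a linear combination is a subset sum.
  Accordingly the subset sums form the span, and coordinates are subsets of the basis.
\<close>

definition indep :: "'v::ab_group_add set \<Rightarrow> bool"
  where "indep X \<longleftrightarrow> finite X \<and> (\<forall>Y\<subseteq>X. \<Sum>Y = 0 \<longrightarrow> Y = {})"

definition subset_sums :: "'v::ab_group_add set \<Rightarrow> 'v set"
  where "subset_sums X = Sum ` Pow X"

definition coords :: "'v::ab_group_add set \<Rightarrow> 'v \<Rightarrow> 'v set"
  where "coords Q x = (THE C. C \<subseteq> Q \<and> \<Sum>C = x)"

locale elementary_2_space =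
  fixes G :: "'v::ab_group_add set" and r :: nat
  assumes double: "\<And>x::'v. x + x = 0"
    and zero_in: "0 \<in> G"
    and add_in: "\<And>x y. x \<in> G \<Longrightarrow> y \<in> G \<Longrightarrow> x + y \<in> G"
    and card_G: "card G = 2 ^ r"
begin

lemma finite_G: "finite G"
  using card_G by (metis card.infinite power_not_zero zero_neq_numeral)

lemma add_eq_0_iff: "x + y = 0 \<longleftrightarrow> x = (y::'v)"
  by (metis add_right_cancel double)

lemma add_double [simp]: "x + (x + y) = (y::'v)" "x + y + y = (x::'v)"
  by (simp_all only: add.assoc double add_0_right) (simp only: double add_0_left flip: add.assoc)

lemma sum_sym_diff:
  assumes "finite A" "finite B"
  shows "\<Sum>(sym_diff A B) = \<Sum>A + (\<Sum>B::'v)"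
proof -
  have A: "\<Sum>A = \<Sum>(A - B) + \<Sum>(A \<inter> B)"
    by (metis Diff_Diff_Int Diff_subset assms(1) sum.subset_diff add.commute)
  have B: "\<Sum>B = \<Sum>(B - A) + \<Sum>(A \<inter> B)"
    by (metis Diff_Diff_Int Diff_subset Int_commute assms(2) sum.subset_diff add.commute)
  have "\<Sum>(sym_diff A B) = \<Sum>(A - B) + \<Sum>(B - A)"
    using assms by (intro sum.union_disjoint) auto
  moreover have "\<Sum>A + \<Sum>B = \<Sum>(A - B) + \<Sum>(B - A) + (\<Sum>(A \<inter> B) + \<Sum>(A \<inter> B))"
    unfolding A B by (simp only: ac_simps)
  ultimately show ?thesis
    by (simp only: double add_0_right)
qed

lemma indep_finite: "indep X \<Longrightarrow> finite X"
  by (simp add: indep_def)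

lemma indep_subset: "indep X \<Longrightarrow> Y \<subseteq> X \<Longrightarrow> indep Y"
  unfolding indep_def by (meson finite_subset subset_trans)

lemma indep_zero:
  assumes "indep X" shows "0 \<notin> (X::'v set)"
proof
  assume "0 \<in> X"
  then have "{0} = ({}::'v set)"
    using assms unfolding indep_def by (metis empty_subsetI insert_subset sum.empty sum.insert
      finite.emptyI add_0_right insert_not_empty empty_iff)
  then show False by simp
qed

lemma indep_sum_inj:
  assumes "indep X" "Y \<subseteq> X" "Z \<subseteq> X" "\<Sum>Y = (\<Sum>Z::'v)"
  shows "Y = Z"
proof -
  have fin: "finite Y" "finite Z"
    using assms by (meson indep_finite finite_subset)+
  have "\<Sum>(sym_diff Y Z) = 0"
    using sum_sym_diff[OF fin] assms(4) by (simp add: double)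
  then have "sym_diff Y Z = {}"
    using assms unfolding indep_def by (meson Diff_subset Un_subset_iff order_trans)
  then show ?thesis by auto
qed

lemma coords_unique:
  assumes "indep Q" "C \<subseteq> Q" "\<Sum>C = (x::'v)"
  shows "coords Q x = C"
  unfolding coords_def
proof (rule the_equality)
  show "C \<subseteq> Q \<and> \<Sum>C = x" using assms by simp
  show "D = C" if "D \<subseteq> Q \<and> \<Sum>D = x" for D
    by (rule indep_sum_inj[OF assms(1)]) (use that assms in auto)
qed

lemma coords_props:
  assumes "indep Q" "(x::'v) \<in> subset_sums Q"
  shows "coords Q x \<subseteq> Q" "\<Sum>(coords Q x) = x"
proof -
  obtain C where C: "C \<subseteq> Q" "\<Sum>C = x"
    using assms(2) by (auto simp: subset_sums_def)
  then show "coords Q x \<subseteq> Q" "\<Sum>(coords Q x) = x"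
    using coords_unique[OF assms(1) C] by auto
qed

lemma coords_finite:
  assumes "indep Q" "(x::'v) \<in> subset_sums Q"
  shows "finite (coords Q x)"
  using coords_props(1)[OF assms] indep_finite[OF assms(1)] finite_subset by blast

lemma coords_member: "indep Q \<Longrightarrow> (x::'v) \<in> Q \<Longrightarrow> coords Q x = {x}"
  by (rule coords_unique) auto

lemma subset_sums_superset: "X \<subseteq> subset_sums (X::'v set)"
proof
  fix x assume "x \<in> X"
  then show "x \<in> subset_sums X"
    unfolding subset_sums_def by (intro image_eqI[of _ _ "{x}"]) auto
qed

lemma subset_sums_zero: "0 \<in> subset_sums X"
  unfolding subset_sums_def by (intro image_eqI[of _ _ "{}"]) auto

lemma subset_sums_add:
  assumes "finite X" "(x::'v) \<in> subset_sums X" "y \<in> subset_sums X"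
  shows "x + y \<in> subset_sums X"
proof -
  obtain A B where AB: "A \<subseteq> X" "B \<subseteq> X" "x = \<Sum>A" "y = \<Sum>B"
    using assms by (auto simp: subset_sums_def)
  moreover from this have "finite A" "finite B"
    using assms(1) finite_subset by auto
  ultimately have "x + y = \<Sum>(sym_diff A B)"
    by (simp only: sum_sym_diff)
  moreover have "sym_diff A B \<subseteq> X" using AB by auto
  ultimately show ?thesis
    unfolding subset_sums_def by blast
qed

lemma subset_sums_sum:
  assumes "finite X" "\<And>y. y \<in> Y \<Longrightarrow> (y::'v) \<in> subset_sums X"
  shows "\<Sum>Y \<in> subset_sums X"
  using assms(2)
  by (induction Y rule: infinite_finite_induct) (auto simp: subset_sums_zero subset_sums_add assms(1))

lemma subset_sums_sum_mset:
  assumes "finite X" "\<And>y. y \<in># Y \<Longrightarrow> (y::'v) \<in> subset_sums X"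
  shows "\<Sum>\<^sub># Y \<in> subset_sums X"
  using assms(2)
  by (induction Y) (auto simp: subset_sums_zero subset_sums_add assms(1))

lemma coords_add:
  assumes Q: "indep Q" and x: "(x::'v) \<in> subset_sums Q" and y: "y \<in> subset_sums Q"
  shows "coords Q (x + y) = sym_diff (coords Q x) (coords Q y)"
proof (rule coords_unique[OF Q])
  show "sym_diff (coords Q x) (coords Q y) \<subseteq> Q"
    using coords_props[OF Q x] coords_props[OF Q y] by auto
  show "\<Sum>(sym_diff (coords Q x) (coords Q y)) = x + y"
    using sum_sym_diff[OF coords_finite[OF Q x] coords_finite[OF Q y]]
      coords_props[OF Q x] coords_props[OF Q y] by simp
qed

lemma sum_in_G: "(\<And>y. y \<in> Y \<Longrightarrow> y \<in> G) \<Longrightarrow> \<Sum>Y \<in> G"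
  by (induction Y rule: infinite_finite_induct) (auto simp: zero_in add_in)

lemma subset_sums_in_G: "X \<subseteq> G \<Longrightarrow> subset_sums X \<subseteq> G"
  unfolding subset_sums_def using sum_in_G by blast

text \<open>
  Distinct subsets of an independent set have distinct sums, so that statements about dimensions
  become statements about powers of 2.
\<close>

lemma card_subset_sums: "indep (X::'v set) \<Longrightarrow> card (subset_sums X) = 2 ^ card X"
  unfolding subset_sums_def
  by (subst card_image) (auto simp: inj_on_def card_Pow indep_finite dest: indep_sum_inj)

lemma indep_card_le:
  assumes "indep X" "X \<subseteq> G"
  shows "card X \<le> r"
proof -
  have "2 ^ card X \<le> (2::nat) ^ r"
    using card_subset_sums[OF assms(1)] card_mono[OF finite_G subset_sums_in_G[OF assms(2)]] card_G
    by simp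
  then show ?thesis by simp
qed

lemma subset_sums_eq_G:
  assumes "indep X" "X \<subseteq> G" "card X = r"
  shows "subset_sums X = G"
  using card_subset_eq[OF finite_G subset_sums_in_G[OF assms(2)]]
    card_subset_sums[OF assms(1)] card_G assms(3) by simp

lemma indep_insert:
  assumes X: "indep X" and x: "(x::'v) \<notin> subset_sums X"
  shows "indep (insert x X)"
  unfolding indep_def
proof (intro conjI allI impI)
  show "finite (insert x X)" using X by (simp add: indep_def)
  fix Y assume Y: "Y \<subseteq> insert x X" "\<Sum>Y = 0"
  show "Y = {}"
  proof (cases "x \<in> Y")
    case True
    then have "x + \<Sum>(Y - {x}) = 0"
      using Y X by (metis finite_insert finite_subset indep_finite sum.remove)
    then have "x = \<Sum>(Y - {x})" by (simp add: add_eq_0_iff)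
    moreover have "Y - {x} \<subseteq> X" using Y by auto
    ultimately have "x \<in> subset_sums X" by (auto simp: subset_sums_def)
    then show ?thesis using x by simp
  next
    case False
    then show ?thesis using X Y unfolding indep_def by blast
  qed
qed

text \<open>A subspace spanned by \<open>r - 1\<close> independent vectors has index 2, so its complement is one coset.\<close>

lemma hyperplane_coset:
  assumes Q: "indep Q" "Q \<subseteq> G" "Suc (card Q) = r"
    and x: "x \<in> G" "x \<notin> subset_sums Q" and y: "y \<in> G" "y \<notin> subset_sums Q"
  shows "x + y \<in> subset_sums Q"
proof (rule ccontr)
  assume xy: "x + y \<notin> subset_sums Q"
  have ind: "indep (insert x Q)" by (rule indep_insert[OF Q(1) x(2)])
  have xQ: "x \<notin> Q" using x subset_sums_superset by blast
  have "y \<notin> subset_sums (insert x Q)"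
  proof
    assume "y \<in> subset_sums (insert x Q)"
    then obtain C where C: "C \<subseteq> insert x Q" "y = \<Sum>C"
      by (auto simp: subset_sums_def)
    show False
    proof (cases "x \<in> C")
      case True
      then have "y = x + \<Sum>(C - {x})"
        using C Q by (metis finite_insert finite_subset indep_finite sum.remove)
      then have "x + y = \<Sum>(C - {x})" by simp
      moreover have "C - {x} \<subseteq> Q" using C by auto
      ultimately show False using xy by (auto simp: subset_sums_def)
    next
      case False
      then show False using C y by (auto simp: subset_sums_def)
    qed
  qed
  then have "indep (insert y (insert x Q))" by (rule indep_insert[OF ind])
  moreover have "card (insert y (insert x Q)) = Suc r"
    using Q xQ \<open>y \<notin> subset_sums (insert x Q)\<close> subset_sums_superset[of "insert x Q"]
    by (subst card_insert_disjoint) (auto simp: indep_finite card_insert_disjoint)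
  moreover have "insert y (insert x Q) \<subseteq> G" using Q x y by auto
  ultimately show False using indep_card_le by force
qed

text \<open>
  The exchange property of bases, iterated: an independent set can be moved into a basis \<open>Q\<close>
  one vector at a time, each vector being replaced by one of its own coordinates.
\<close>

lemma coordinate_injection:
  assumes Q: "indep Q" and A: "indep A" "A \<subseteq> subset_sums (Q::'v set)"
  shows "\<exists>f. inj_on f A \<and> (\<forall>x\<in>A. f x \<in> coords Q x)"
  using A
proof (induction "card (A - Q)" arbitrary: A)
  case 0
  then have "A \<subseteq> Q" using indep_finite[of A] by auto
  then show ?case
    using coords_member[OF Q] by (intro exI[of _ id]) auto
next
  case (Suc n)
  then have "A - Q \<noteq> {}" by (metis card.empty nat.distinct(1))
  then obtain x where x: "x \<in> A" "x \<notin> Q" by blast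
  have xs: "x \<in> subset_sums Q" using x Suc.prems by auto
  have fin: "finite A" using Suc.prems indep_finite[of A] by auto
  have Ax: "indep (A - {x})" using Suc.prems indep_subset by blast
  have "x \<notin> subset_sums (A - {x})"
  proof
    assume "x \<in> subset_sums (A - {x})"
    then obtain C where C: "C \<subseteq> A - {x}" "x = \<Sum>C" by (auto simp: subset_sums_def)
    have "C = {x}"
      by (rule indep_sum_inj[OF Suc.prems(1)]) (use C x in auto)
    then show False using C by auto
  qed
  moreover have "x \<in> subset_sums (A - {x})" if "coords Q x \<subseteq> subset_sums (A - {x})"
  proof -
    have "\<Sum>(coords Q x) \<in> subset_sums (A - {x})"
      by (rule subset_sums_sum) (use fin that in auto)
    then show ?thesis by (simp only: coords_props(2)[OF Q xs])
  qed
  ultimately obtain h where h: "h \<in> coords Q x" "h \<notin> subset_sums (A - {x})"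
    by (meson subsetI)
  have hQ: "h \<in> Q" using h(1) coords_props(1)[OF Q xs] by (meson subsetD)
  have hA: "h \<notin> A - {x}" using h(2) subset_sums_superset by (meson subsetD)
  have ind: "indep (insert h (A - {x}))" by (rule indep_insert[OF Ax h(2)])
  have "insert h (A - {x}) - Q = (A - Q) - {x}" using hQ x by auto
  then have "n = card (insert h (A - {x}) - Q)" using Suc.hyps(2) x fin by simp
  moreover have "insert h (A - {x}) \<subseteq> subset_sums Q"
    using Suc.prems hQ subset_sums_superset by blast
  ultimately obtain f where f: "inj_on f (insert h (A - {x}))"
    "\<forall>y\<in>insert h (A - {x}). f y \<in> coords Q y"
    using Suc.hyps(1)[OF _ ind] by blast
  have fh: "f h = h" using f hQ coords_member[OF Q] by auto
  let ?g = "f(x := h)"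
  have "inj_on ?g A"
  proof (rule inj_onI)
    fix y z assume yz: "y \<in> A" "z \<in> A" "?g y = ?g z"
    show "y = z"
      using f(1) yz hA fh unfolding inj_on_def
      by (metis Diff_iff fun_upd_apply insertCI singletonD)
  qed
  moreover have "\<forall>y\<in>A. ?g y \<in> coords Q y" using f h by auto
  ultimately show ?case by blast
qed

end

section \<open>Zero-sum sequences and their factorizations\<close>

definition zero_sum :: "('p \<Rightarrow> 'v::ab_group_add) \<Rightarrow> 'p multiset \<Rightarrow> bool"
  where "zero_sum c b \<longleftrightarrow> (\<Sum>x\<in>#b. c x) = 0"

definition min_zero_sum :: "('p \<Rightarrow> 'v::ab_group_add) \<Rightarrow> 'p multiset \<Rightarrow> bool"
  where "min_zero_sum c u \<longleftrightarrow>
    u \<noteq> {#} \<and> zero_sum c u \<and> (\<forall>w. w \<subseteq># u \<longrightarrow> zero_sum c w \<longrightarrow> w = {#} \<or> w = u)"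

definition zs_factorizations :: "('p \<Rightarrow> 'v::ab_group_add) \<Rightarrow> 'p multiset \<Rightarrow> 'p multiset multiset set"
  where "zs_factorizations c b = {z. (\<forall>u\<in>#z. min_zero_sum c u) \<and> \<Sum>\<^sub># z = b}"

lemma zero_sum_id: "zero_sum (\<lambda>x. x) b \<longleftrightarrow> \<Sum>\<^sub># b = 0"
  by (simp add: zero_sum_def)

lemma zero_sum_empty [simp]: "zero_sum c {#}"
  by (simp add: zero_sum_def)

lemma zero_sum_image: "zero_sum c b \<longleftrightarrow> zero_sum (\<lambda>x. x) (image_mset c b)"
  by (simp add: zero_sum_def)

lemma zero_sum_plus: "zero_sum c a \<Longrightarrow> zero_sum c (a + b) \<longleftrightarrow> zero_sum c b"
  by (simp add: zero_sum_def)

lemma zero_sum_Union: "(\<And>u. u \<in># z \<Longrightarrow> zero_sum c u) \<Longrightarrow> zero_sum c (\<Sum>\<^sub># z)"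
  by (induction z) (simp_all add: zero_sum_plus)

text \<open>
  Whether a sequence of primes is an atom depends only on the sequence of its classes, and every
  factorization of the class sequence lifts. This is the transfer homomorphism from a Krull monoid
  to the zero-sum sequences over its class group.
\<close>

lemma min_zero_sum_image: "min_zero_sum c u \<longleftrightarrow> min_zero_sum (\<lambda>x. x) (image_mset c u)"
proof
  assume u: "min_zero_sum c u"
  show "min_zero_sum (\<lambda>x. x) (image_mset c u)"
    unfolding min_zero_sum_def
  proof (intro conjI allI impI)
    show "image_mset c u \<noteq> {#}" "zero_sum (\<lambda>x. x) (image_mset c u)"
      using u by (simp_all add: min_zero_sum_def zero_sum_def)
    fix w assume w: "w \<subseteq># image_mset c u" "zero_sum (\<lambda>x. x) w"
    obtain w' v where wv: "u = w' + v" "w = image_mset c w'"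
      using image_mset_eq_plusD[of c u w "image_mset c u - w"] w(1) by auto
    then have "w' = {#} \<or> w' = u"
      using u w(2) zero_sum_image[of c w'] mset_subset_eq_add_left[of w' v]
      unfolding min_zero_sum_def by metis
    then show "w = {#} \<or> w = image_mset c u" using wv by auto
  qed
next
  assume u: "min_zero_sum (\<lambda>x. x) (image_mset c u)"
  show "min_zero_sum c u"
    unfolding min_zero_sum_def
  proof (intro conjI allI impI)
    show "u \<noteq> {#}" "zero_sum c u"
      using u by (auto simp: min_zero_sum_def zero_sum_def)
    fix w assume w: "w \<subseteq># u" "zero_sum c w"
    then have "image_mset c w = {#} \<or> image_mset c w = image_mset c u"
      using u image_mset_subseteq_mono[OF w(1), of c] zero_sum_image[of c w]
      unfolding min_zero_sum_def by blast
    then have "w = {#} \<or> size w = size u"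
      by (metis image_mset_is_empty_iff size_image_mset)
    then show "w = {#} \<or> w = u"
      using w(1) by (metis mset_subset_size subset_mset.le_neq_trans less_irrefl)
  qed
qed

lemma factorizations_plus:
  "z \<in> zs_factorizations c a \<Longrightarrow> z' \<in> zs_factorizations c b \<Longrightarrow> z + z' \<in> zs_factorizations c (a + b)"
  by (auto simp: zs_factorizations_def)

lemma factorizations_single: "min_zero_sum c u \<Longrightarrow> {#u#} \<in> zs_factorizations c u"
  by (auto simp: zs_factorizations_def)

lemma factorization_exists:
  "zero_sum c b \<Longrightarrow> \<exists>z. z \<in> zs_factorizations c b"
proof (induction "size b" arbitrary: b rule: less_induct)
  case less
  show ?case
  proof (cases "b = {#}")
    case True
    then show ?thesis by (intro exI[of _ "{#}"]) (simp add: zs_factorizations_def)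
  next
    case False
    let ?S = "{w. w \<subseteq># b \<and> w \<noteq> {#} \<and> zero_sum c w}"
    have "b \<in> ?S" using False less.prems by simp
    then obtain w where w: "w \<in> ?S" "\<And>v. v \<in> ?S \<Longrightarrow> size w \<le> size v"
      using ex_has_least_nat[of "\<lambda>w. w \<in> ?S" b size] by blast
    have "min_zero_sum c w"
      unfolding min_zero_sum_def
    proof (intro conjI allI impI)
      show "w \<noteq> {#}" "zero_sum c w" using w by auto
      fix v assume v: "v \<subseteq># w" "zero_sum c v"
      show "v = {#} \<or> v = w"
      proof (cases "v = {#}")
        case False
        then have "size w \<le> size v"
          using v w by (intro w(2)) (auto intro: subset_mset.order_trans)
        then show ?thesis
          using v(1) by (metis mset_subset_size subset_mset.le_neq_trans linorder_not_less)
      qed simp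
    qed
    moreover have "b = w + (b - w)" using w by simp
    moreover from this have "zero_sum c (b - w)"
      using zero_sum_plus[of c w "b - w"] w less.prems by simp
    moreover have "size (b - w) < size b"
      using w by (metis (mono_tags, lifting) mem_Collect_eq size_Diff_submset diff_less
          nonempty_has_size size_mset_mono less_le_trans)
    ultimately show ?thesis
      using less.hyps factorizations_plus[OF factorizations_single] by metis
  qed
qed

lemma factorization_lift:
  assumes "w \<in> zs_factorizations (\<lambda>x. x) (image_mset c b)"
  shows "\<exists>w'\<in>zs_factorizations c b. image_mset (image_mset c) w' = w"
  using assms
proof (induction w arbitrary: b)
  case empty
  then show ?case by (intro bexI[of _ "{#}"]) (auto simp: zs_factorizations_def)
next
  case (add V w)
  then have V: "min_zero_sum (\<lambda>x. x) V" and im: "image_mset c b = V + \<Sum>\<^sub># w"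
    and w: "\<forall>u\<in>#w. min_zero_sum (\<lambda>x. x) u"
    by (auto simp: zs_factorizations_def)
  obtain b1 b2 where b: "b = b1 + b2" "V = image_mset c b1" "\<Sum>\<^sub># w = image_mset c b2"
    using image_mset_eq_plusD[OF im] by blast
  obtain w' where w': "w' \<in> zs_factorizations c b2" "image_mset (image_mset c) w' = w"
    using add.IH[of b2] w b(3) by (auto simp: zs_factorizations_def)
  have "min_zero_sum c b1" using V b(2) min_zero_sum_image by metis
  then have "{#b1#} + w' \<in> zs_factorizations c b"
    using factorizations_plus[OF factorizations_single w'(1)] b(1) by simp
  then show ?case using w'(2) b(2) by (intro bexI[of _ "{#b1#} + w'"]) auto
qed

lemma factorization_image:
  "w \<in> zs_factorizations c b \<Longrightarrow>
    image_mset (image_mset c) w \<in> zs_factorizations (\<lambda>x. x) (image_mset c b)"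
proof -
  have "\<Sum>\<^sub># (image_mset (image_mset c) w) = image_mset c (\<Sum>\<^sub># w)"
    by (induction w) auto
  then show "w \<in> zs_factorizations c b \<Longrightarrow> ?thesis"
    unfolding zs_factorizations_def using min_zero_sum_image[of c] by auto
qed

text \<open>The refinement property of free monoids: a two-term splitting of a sum splits every summand.\<close>

lemma sum_mset_split:
  fixes z :: "'p multiset multiset"
  assumes "\<Sum>\<^sub># z = a + b"
  shows "\<exists>w. image_mset (\<lambda>q. fst q + snd q) w = z \<and>
    (\<Sum>q\<in>#w. fst q) = a \<and> (\<Sum>q\<in>#w. snd q) = b"
  using assms
proof (induction z arbitrary: a b)
  case empty
  then show ?case by (intro exI[of _ "{#}"]) auto
next
  case (add V z)
  have sum: "V + \<Sum>\<^sub># z = a + b" using add.prems by simp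
  have cnt: "count V x + count (\<Sum>\<^sub># z) x = count a x + count b x" for x
    using arg_cong[OF sum, of "\<lambda>m. count m x"] by simp
  define d where "d = V \<inter># a"
  have "\<Sum>\<^sub># z = (a - d) + (b - (V - d))"
  proof (rule multiset_eqI)
    fix x
    show "count (\<Sum>\<^sub># z) x = count (a - d + (b - (V - d))) x"
      using cnt[of x] by (simp add: d_def min_def)
  qed
  then obtain w where w: "image_mset (\<lambda>q. fst q + snd q) w = z"
    "(\<Sum>q\<in>#w. fst q) = a - d" "(\<Sum>q\<in>#w. snd q) = b - (V - d)"
    using add.IH by blast
  have le: "V - d \<subseteq># b" "d \<subseteq># a" "d \<subseteq># V"
  proof -
    have "count V x - count a x \<le> count b x" for x
      using cnt[of x] by linarith
    then show "V - d \<subseteq># b" "d \<subseteq># a" "d \<subseteq># V"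
      by (simp_all add: d_def subseteq_mset_def)
  qed
  then show ?case
    using w by (intro exI[of _ "add_mset (d, V - d) w"]) auto
qed

lemma size_sum_mset: "size (\<Sum>\<^sub># z) = (\<Sum>u\<in>#z. size (u :: 'p multiset))"
  by (induction z) auto

lemma mset_set_set_mset_eqI:
  assumes "\<And>x. count b x \<le> 1"
  shows "b = mset_set (set_mset b)"
proof (rule multiset_eqI)
  fix x
  show "count b x = count (mset_set (set_mset b)) x"
    using assms[of x] by (cases "x \<in># b") (simp_all add: count_mset_set' not_in_iff le_antisym Suc_leI)
qed

lemma mset_set_sub:
  assumes "b \<subseteq># mset_set X" "finite X"
  shows "\<exists>Y\<subseteq>X. b = mset_set Y"
proof (intro exI conjI)
  show "set_mset b \<subseteq> X" using set_mset_mono[OF assms(1)] assms(2) by simp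
  have "count b x \<le> 1" for x
    using mset_subset_eq_count[OF assms(1), of x] by (cases "x \<in> X") (auto simp: assms(2))
  then show "b = mset_set (set_mset b)" by (rule mset_set_set_mset_eqI)
qed

lemma factorization_member_sub:
  assumes "z \<in> zs_factorizations c b" "u \<in># z"
  shows "u \<subseteq># b"
proof -
  obtain z' where "z = add_mset u z'" using multi_member_split[OF assms(2)] by blast
  then show ?thesis using assms(1) by (auto simp: zs_factorizations_def)
qed

lemma sum_mset_mset_set: "\<Sum>\<^sub># (mset_set X) = \<Sum>X"
  by (simp add: sum_unfold_sum_mset)

lemma sum_mset_swap:
  fixes g :: "'b \<Rightarrow> 'a \<Rightarrow> 'c::comm_monoid_add"
  shows "(\<Sum>h\<in>Q. \<Sum>x\<in>#M. g h x) = (\<Sum>x\<in>#M. \<Sum>h\<in>Q. g h x)"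
  by (induction M) (simp_all add: sum.distrib)

context elementary_2_space
begin

lemma zero_sum_pair: "zero_sum c {#x, y#} \<longleftrightarrow> c x = (c y::'v)"
  by (simp add: zero_sum_def add_eq_0_iff)

text \<open>In characteristic 2 a repeated term already is a zero-sum subsequence.\<close>

lemma zero_sum_free_indep:
  assumes "\<And>w. w \<subseteq># b \<Longrightarrow> zero_sum (\<lambda>x. x) w \<Longrightarrow> w = {#}"
  shows "b = mset_set (set_mset b)" "indep (set_mset (b::'v multiset))"
proof -
  have "count b x \<le> 1" for x
  proof (rule ccontr)
    assume "\<not> count b x \<le> 1"
    then have "{#x, x#} \<subseteq># b" by (simp add: subseteq_mset_def)
    moreover have "zero_sum (\<lambda>x. x) {#x, x#}" by (simp add: zero_sum_pair)
    ultimately show False using assms[of "{#x, x#}"] by simp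
  qed
  then show b: "b = mset_set (set_mset b)" by (rule mset_set_set_mset_eqI)
  show "indep (set_mset b)"
    unfolding indep_def
  proof (intro conjI allI impI)
    fix Y assume Y: "Y \<subseteq> set_mset b" "\<Sum>Y = 0"
    then have "mset_set Y \<subseteq># b"
      by (metis b finite_set_mset subset_imp_msubset_mset_set)
    moreover have "zero_sum (\<lambda>x. x) (mset_set Y)" using Y(2) by (simp add: zero_sum_id sum_mset_mset_set)
    ultimately have "mset_set Y = {#}" using assms by blast
    then show "Y = {}"
      using Y(1) finite_subset finite_set_mset mset_set_empty_iff by metis
  qed simp
qed

lemma proper_sub_indep:
  assumes "min_zero_sum (\<lambda>x. x) u" "b \<subset># (u::'v multiset)"
  shows "b = mset_set (set_mset b)" "indep (set_mset b)"
proof -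
  have "w = {#}" if "w \<subseteq># b" "zero_sum (\<lambda>x. x) w" for w
    using assms that unfolding min_zero_sum_def
    by (metis subset_mset.dual_order.strict_trans1 subset_mset.less_imp_le subset_mset.nless_le)
  then show "b = mset_set (set_mset b)" "indep (set_mset b)"
    using zero_sum_free_indep[of b] by auto
qed

text \<open>
  The basic supply of atoms: an independent set together with its sum. If the sum is itself
  the only member of the set, the atom is a square.
\<close>

lemma min_zero_sum_insert:
  assumes C: "indep C" "C \<noteq> {}" "\<Sum>C = (x::'v)"
  shows "min_zero_sum (\<lambda>x. x) (add_mset x (mset_set C))"
  unfolding min_zero_sum_def
proof (intro conjI allI impI)
  have fin: "finite C" using C indep_finite by auto
  show "add_mset x (mset_set C) \<noteq> {#}" by simp
  show "zero_sum (\<lambda>x. x) (add_mset x (mset_set C))"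
    using C(3) by (simp add: zero_sum_id double sum_mset_mset_set)
  fix w assume w: "w \<subseteq># add_mset x (mset_set C)" "zero_sum (\<lambda>x. x) w"
  show "w = {#} \<or> w = add_mset x (mset_set C)"
  proof (cases "w \<subseteq># mset_set C")
    case True
    then obtain Y where "Y \<subseteq> C" "w = mset_set Y" using mset_set_sub fin by blast
    moreover from this have "\<Sum>Y = 0" using w(2) by (simp add: zero_sum_id sum_mset_mset_set)
    ultimately have "Y = {}" using C(1) by (simp add: indep_def)
    then show ?thesis using \<open>w = mset_set Y\<close> by simp
  next
    case False
    then have xw: "x \<in># w"
      using w(1) by (metis diff_single_trivial subset_eq_diff_conv add_mset_add_single)
    then have "w - {#x#} \<subseteq># mset_set C"
      using w(1) by (metis add_mset_add_single subset_eq_diff_conv)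
    then obtain Y where Y: "Y \<subseteq> C" "w - {#x#} = mset_set Y" using mset_set_sub fin by blast
    then have wY: "w = add_mset x (mset_set Y)" using xw by (metis insert_DiffM)
    then have "x = \<Sum>Y"
      using w(2) by (simp add: zero_sum_id add_eq_0_iff sum_mset_mset_set)
    then have "Y = C" using indep_sum_inj[OF C(1) Y(1)] C(3) by auto
    then show ?thesis using wY by simp
  qed
qed

lemma min_zero_sum_two: "(x::'v) \<noteq> 0 \<Longrightarrow> min_zero_sum (\<lambda>x. x) {#x, x#}"
  using min_zero_sum_insert[of "{x}" x] by (auto simp: indep_def subset_singleton_iff)

lemma min_zero_sum_size:
  assumes u: "min_zero_sum (\<lambda>x. x) (u::'v multiset)" and "0 \<notin># u"
  shows "size u = 2 \<and> (\<exists>x. u = {#x, x#}) \<or> size u \<ge> 3"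
proof -
  have "u \<noteq> {#}" "\<Sum>\<^sub># u = 0" using u by (auto simp: min_zero_sum_def zero_sum_id)
  then obtain x v where xv: "u = add_mset x v" using multiset_cases by blast
  then have "v \<noteq> {#}" using \<open>\<Sum>\<^sub># u = 0\<close> assms(2) by auto
  then obtain y w where yw: "v = add_mset y w" using multiset_cases by blast
  show ?thesis
  proof (cases "w = {#}")
    case True
    then show ?thesis
      using xv yw \<open>\<Sum>\<^sub># u = 0\<close> by (auto simp: add_eq_0_iff)
  next
    case False
    then have "size w \<ge> 1" by (simp add: Suc_leI nonempty_has_size)
    then show ?thesis using xv yw by simp
  qed
qed

lemma min_zero_sum_zero:
  assumes u: "min_zero_sum c u" and x: "x \<in># u" "c x = (0::'v)"
  shows "u = {#x#}"
proof -
  have "{#x#} \<subseteq># u" "zero_sum c {#x#}" using x by (simp_all add: zero_sum_def)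
  then show ?thesis using u unfolding min_zero_sum_def by fastforce
qed

lemma min_zero_sum_distinct:
  assumes "min_zero_sum (\<lambda>x. x) (u::'v multiset)" "size u \<ge> 3"
  shows "u = mset_set (set_mset u)"
proof -
  have "count u x \<le> 1" for x
  proof (rule ccontr)
    assume "\<not> count u x \<le> 1"
    then have "{#x, x#} \<subseteq># u" by (simp add: subseteq_mset_def)
    moreover have "zero_sum (\<lambda>x. x) {#x, x#}" by (simp add: zero_sum_pair)
    ultimately have "{#x, x#} = u" using assms(1) unfolding min_zero_sum_def by fastforce
    then show False using assms(2) by auto
  qed
  then show ?thesis by (rule mset_set_set_mset_eqI)
qed

lemma min_zero_sum_size_le:
  assumes u: "min_zero_sum (\<lambda>x. x) u" "set_mset u \<subseteq> G"
  shows "size u \<le> Suc r"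
proof -
  have "u \<noteq> {#}" using u(1) by (auto simp: min_zero_sum_def)
  then obtain x v where xv: "u = add_mset x v" using multiset_cases by blast
  then have "v \<subset># u" by simp
  note v = proper_sub_indep[OF u(1) this]
  have "size v = card (set_mset v)" using v(1) by (metis size_mset_set)
  also have "\<dots> \<le> r" using v(2) u(2) xv by (intro indep_card_le) auto
  finally show ?thesis using xv by simp
qed

lemma factorization_no_zero:
  assumes "z \<in> zs_factorizations (\<lambda>x. x) b" "0 \<notin># b" "(u::'v multiset) \<in># z"
  shows "0 \<notin># u" "size u \<ge> 2"
proof -
  have "u \<subseteq># b" by (rule factorization_member_sub[OF assms(1,3)])
  then show "0 \<notin># u" using assms(2) mset_subset_eqD[of u b 0] by blast
  then show "size u \<ge> 2"
    using assms min_zero_sum_size[of u] by (auto simp: zs_factorizations_def)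
qed

lemma factorization_size_le:
  assumes "z \<in> zs_factorizations (\<lambda>x. x) b" "(0::'v) \<notin># b"
  shows "2 * size z \<le> size b"
proof -
  have "2 * size z = (\<Sum>u\<in>#z. 2)" by simp
  also have "\<dots> \<le> (\<Sum>u\<in>#z. size u)"
    using factorization_no_zero[OF assms] by (intro sum_mset_mono) auto
  also have "\<dots> = size b" using assms(1) by (simp add: zs_factorizations_def flip: size_sum_mset)
  finally show ?thesis .
qed

section \<open>Coordinate weights of odd families of independent sets\<close>

lemma coords_parity:
  assumes Q: "indep Q" and B: "\<And>x. x \<in># B \<Longrightarrow> (x::'v) \<in> subset_sums Q"
  shows "odd (\<Sum>x\<in>#B. of_bool (h \<in> coords Q x) :: nat) \<longleftrightarrow> h \<in> coords Q (\<Sum>\<^sub># B)"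
  using B
proof (induction B)
  case empty
  then show ?case using coords_unique[OF Q, of "{}" 0] by simp
next
  case (add x B)
  have "\<Sum>\<^sub># B \<in> subset_sums Q"
    using subset_sums_sum_mset[of Q B] indep_finite[OF Q] add.prems by auto
  then have "coords Q (x + \<Sum>\<^sub># B) = sym_diff (coords Q x) (coords Q (\<Sum>\<^sub># B))"
    using coords_add[OF Q] add.prems by auto
  then show ?case using add by auto
qed

lemma card_coords_sum_le:
  assumes Q: "indep Q" and B: "\<And>x. x \<in># B \<Longrightarrow> (x::'v) \<in> subset_sums Q"
  shows "card (coords Q (\<Sum>\<^sub># B)) \<le> (\<Sum>x\<in>#B. card (coords Q x))"
  using B
proof (induction B)
  case empty
  then show ?case using coords_unique[OF Q, of "{}" 0] by simp
next
  case (add x B)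
  have B: "\<Sum>\<^sub># B \<in> subset_sums Q"
    using subset_sums_sum_mset[of Q B] indep_finite[OF Q] add.prems by auto
  then have "coords Q (x + \<Sum>\<^sub># B) = sym_diff (coords Q x) (coords Q (\<Sum>\<^sub># B))"
    using coords_add[OF Q] add.prems by auto
  also have "card \<dots> \<le> card (coords Q x \<union> coords Q (\<Sum>\<^sub># B))"
    using coords_finite[OF Q] add.prems B by (intro card_mono) auto
  also have "\<dots> \<le> card (coords Q x) + card (coords Q (\<Sum>\<^sub># B))" by (rule card_Un_le)
  finally show ?case using add by simp
qed

text \<open>
  Consider the matrix whose rows are the members of \<open>B\<close> in coordinates with respect to \<open>Q\<close>.
  By the exchange property each of the independent sets marks at most one of its members in every
  column, with an entry 1 there, and marks each member once. A column carrying the full number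
  \<open>size A\<close> of marks has an odd number of marked entries 1, so it needs a further entry 1 unless the
  column sum is odd. Summing over the columns gives the inequality.

  Its use is the following. If every atom \<open>V\<close> of a factorization of a zero-sum sequence \<open>B\<close> has
  weight at most \<open>2 |V| - 2\<close>, then the number of atoms is at most \<open>|Q| (|A| - 1) / 2\<close>.
\<close>

lemma odd_family_weight:
  fixes A :: "'v set multiset"
  assumes Q: "indep Q" and n: "odd (size A)"
    and A: "\<And>X. X \<in># A \<Longrightarrow> indep X" "\<And>X. X \<in># A \<Longrightarrow> X \<subseteq> subset_sums Q"
    and B: "B = (\<Sum>X\<in>#A. mset_set X)"
  shows "2 * size B \<le> (\<Sum>x\<in>#B. card (coords Q x)) + card Q * (size A - 1)
    + card (coords Q (\<Sum>\<^sub># B))"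
proof -
  have finQ: "finite Q" using Q indep_finite by auto
  have "\<forall>X\<in>set_mset A. \<exists>f. inj_on f X \<and> (\<forall>x\<in>X. f x \<in> coords Q x)"
    using coordinate_injection[OF Q] A by blast
  then obtain f where f: "\<And>X. X \<in># A \<Longrightarrow> inj_on (f X) X"
    "\<And>X x. X \<in># A \<Longrightarrow> x \<in> X \<Longrightarrow> f X x \<in> coords Q x" by metis
  define w :: "'v \<Rightarrow> nat" where "w h = (\<Sum>X\<in>#A. of_bool (h \<in> f X ` X))" for h
  define D :: "'v \<Rightarrow> nat" where "D h = (\<Sum>x\<in>#B. of_bool (h \<in> coords Q x))" for h
  have finA: "finite X" if "X \<in># A" for X using A(1)[OF that] indep_finite by auto
  have memB: "x \<in> subset_sums Q" if "x \<in># B" for x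
    using that A finA unfolding B by auto
  have sumB: "(\<Sum>x\<in>#B. g x) = (\<Sum>X\<in>#A. \<Sum>x\<in>X. g x)" for g :: "'v \<Rightarrow> nat"
    unfolding B by (induction A) (simp_all add: sum_unfold_sum_mset)
  have "(\<Sum>h\<in>Q. w h) = (\<Sum>X\<in>#A. \<Sum>h\<in>Q. of_bool (h \<in> f X ` X))"
    unfolding w_def by (rule sum_mset_swap)
  also have "\<dots> = (\<Sum>X\<in>#A. card X)"
  proof (rule arg_cong[of _ _ sum_mset], rule image_mset_cong)
    fix X assume X: "X \<in># A"
    have "f X ` X \<subseteq> Q"
      using f(2)[OF X] A(2)[OF X] coords_props(1)[OF Q] by blast
    then have "Q \<inter> f X ` X = f X ` X" by auto
    then show "(\<Sum>h\<in>Q. of_bool (h \<in> f X ` X)) = card X"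
      using finQ f(1)[OF X] by (simp add: card_image Int_def flip: sum.inter_filter)
  qed
  also have "\<dots> = size B" using sumB[of "\<lambda>_. 1"] by simp
  finally have sum_w: "(\<Sum>h\<in>Q. w h) = size B" .
  have sum_coords: "(\<Sum>h\<in>Q. of_bool (h \<in> coords Q x)) = card (coords Q x)"
    if "x \<in> subset_sums Q" for x
  proof -
    have "Q \<inter> coords Q x = coords Q x" using coords_props(1)[OF Q that] by auto
    then show ?thesis using finQ by (simp add: Int_def flip: sum.inter_filter)
  qed
  have "(\<Sum>h\<in>Q. D h) = (\<Sum>x\<in>#B. \<Sum>h\<in>Q. of_bool (h \<in> coords Q x))"
    unfolding D_def by (rule sum_mset_swap)
  also have "\<dots> = (\<Sum>x\<in>#B. card (coords Q x))"
    using sum_coords memB by (intro arg_cong[of _ _ sum_mset] image_mset_cong) auto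
  finally have sum_D: "(\<Sum>h\<in>Q. D h) = (\<Sum>x\<in>#B. card (coords Q x))" .
  have column: "2 * w h \<le> D h + (size A - 1) + of_bool (h \<in> coords Q (\<Sum>\<^sub># B))" for h
  proof -
    have "w h \<le> (\<Sum>X\<in>#A. 1)" unfolding w_def by (intro sum_mset_mono) auto
    then have wn: "w h \<le> size A" by simp
    have "w h \<le> (\<Sum>X\<in>#A. \<Sum>x\<in>X. of_bool (h \<in> coords Q x))"
      unfolding w_def
    proof (intro sum_mset_mono)
      fix X assume X: "X \<in># A"
      show "of_bool (h \<in> f X ` X) \<le> (\<Sum>x\<in>X. of_bool (h \<in> coords Q x) :: nat)"
      proof (cases "h \<in> f X ` X")
        case True
        then obtain x where "x \<in> X" "h \<in> coords Q x" using f(2)[OF X] by auto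
        then show ?thesis
          using finA[OF X] member_le_sum[of x X "\<lambda>x. of_bool (h \<in> coords Q x) :: nat"] by simp
      qed simp
    qed
    then have wD: "w h \<le> D h" unfolding D_def sumB .
    have "odd (D h) \<longleftrightarrow> h \<in> coords Q (\<Sum>\<^sub># B)"
      unfolding D_def by (rule coords_parity[OF Q memB])
    then show ?thesis
    proof (cases "w h = size A \<and> D h = size A")
      case True
      then show ?thesis using n \<open>odd (D h) \<longleftrightarrow> _\<close> by simp
    next
      case False
      then show ?thesis using wn wD by (cases "w h = size A") auto
    qed
  qed
  have "2 * size B = (\<Sum>h\<in>Q. 2 * w h)" by (simp only: sum_w[symmetric] sum_distrib_left)
  also have "\<dots> \<le> (\<Sum>h\<in>Q. D h + (size A - 1) + of_bool (h \<in> coords Q (\<Sum>\<^sub># B)))"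
    by (rule sum_mono) (rule column)
  also have "\<dots> = (\<Sum>x\<in>#B. card (coords Q x)) + card Q * (size A - 1)
      + (\<Sum>h\<in>Q. of_bool (h \<in> coords Q (\<Sum>\<^sub># B)))"
    by (simp add: sum.distrib sum_D)
  also have "(\<Sum>h\<in>Q. of_bool (h \<in> coords Q (\<Sum>\<^sub># B))) = card (coords Q (\<Sum>\<^sub># B))"
    using subset_sums_sum_mset[OF finQ memB] by (intro sum_coords) auto
  finally show ?thesis .
qed

end

section \<open>Extremal factorizations\<close>

definition long_count :: "'p multiset multiset \<Rightarrow> nat"
  where "long_count z = size (filter_mset (\<lambda>V. 3 \<le> size V) z)"

definition squares :: "'p set \<Rightarrow> 'p multiset multiset"
  where "squares C = image_mset (\<lambda>x. {#x, x#}) (mset_set C)"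

lemma sum_squares: "\<Sum>\<^sub># (squares C) = mset_set C + mset_set C"
proof -
  have "(\<Sum>x\<in>#M. {#x, x#}) = M + M" for M :: "'p multiset"
    by (induction M) auto
  then show ?thesis by (simp add: squares_def)
qed

lemma square_eq_iff: "{#x, x#} = {#y, y#} \<longleftrightarrow> x = y"
  by (metis set_mset_add_mset_insert set_mset_empty insert_absorb2 singleton_insert_inj_eq)

lemma size_squares: "size (squares C) = card C"
  by (simp add: squares_def)

lemma sum_mset_member_sub: "x \<in># M \<Longrightarrow> (f x :: 'p multiset) \<subseteq># (\<Sum>x\<in>#M. f x)"
  by (induction M) (auto intro: subset_mset.order_trans)

lemma sum_mset_ge_size:
  assumes "\<And>x. x \<in># M \<Longrightarrow> f x \<ge> (1::nat)"
  shows "size M \<le> (\<Sum>x\<in>#M. f x)"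
  using assms by (induction M) fastforce+

lemma sum_mset_eq_size:
  assumes "\<And>x. x \<in># M \<Longrightarrow> f x \<ge> (1::nat)" "(\<Sum>x\<in>#M. f x) = size M" "x \<in># M"
  shows "f x = 1"
proof -
  obtain M' where M: "M = add_mset x M'" using multi_member_split[OF assms(3)] by blast
  have "size M' \<le> (\<Sum>x\<in>#M'. f x)" using assms(1) M by (intro sum_mset_ge_size) auto
  then show ?thesis using assms(1)[of x] assms(2) M by simp
qed

lemma mset_set_sym_diff:
  assumes "finite X" "finite Y"
  shows "mset_set X + mset_set Y = mset_set (sym_diff X Y) + mset_set (X \<inter> Y) + mset_set (X \<inter> Y)"
  using assms by (intro multiset_eqI) (auto simp: count_mset_set')

text \<open>
  A factorization of minimal length and, among those, with the largest number of atoms that are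
  not squares. The conditions are stated for subproducts, to which they pass. Minimality
  makes the set \<open>Q\<close> of squared elements independent; the second condition decides ties in
  exchanges that preserve the length.
\<close>

locale extremal_factorization = elementary_2_space G r
  for G :: "'v::ab_group_add set" and r :: nat +
  fixes z :: "'v multiset multiset"
  assumes atoms: "\<And>V. V \<in># z \<Longrightarrow> min_zero_sum (\<lambda>x. x) V"
    and in_G: "\<And>V. V \<in># z \<Longrightarrow> set_mset V \<subseteq> G"
    and no_zero: "\<And>V. V \<in># z \<Longrightarrow> 0 \<notin># V"
    and extremal: "\<And>y w. y \<subseteq># z \<Longrightarrow> w \<in> zs_factorizations (\<lambda>x. x) (\<Sum>\<^sub># y) \<Longrightarrow>
      size y \<le> size w \<and> (size w = size y \<longrightarrow> long_count w \<le> long_count y)"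
begin

definition Q :: "'v set" where "Q = {x. {#x, x#} \<in># z}"

definition K :: "'v set" where "K = subset_sums Q"

lemma shorter:
  assumes "y \<subseteq># z" "\<And>u. u \<in># w \<Longrightarrow> min_zero_sum (\<lambda>x. x) u" "\<Sum>\<^sub># w = \<Sum>\<^sub># y"
  shows "size y \<le> size w"
  using extremal[OF assms(1), of w] assms(2,3) by (simp add: zs_factorizations_def)

lemma Q_sub_G: "Q \<subseteq> G"
  using in_G unfolding Q_def by fastforce

lemma finite_Q: "finite Q"
  using Q_sub_G finite_G finite_subset by blast

lemma zero_notin_Q: "0 \<notin> Q"
  using no_zero unfolding Q_def by fastforce

lemma squares_sub:
  assumes C: "C \<subseteq> Q" and L: "L \<subseteq># z" "\<And>V. V \<in># L \<Longrightarrow> size V \<ge> 3"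
  shows "L + squares C \<subseteq># z"
proof -
  have "squares C = mset_set ((\<lambda>x. {#x, x#}) ` C)"
    unfolding squares_def by (intro image_mset_mset_set) (auto simp: inj_on_def square_eq_iff)
  also have "\<dots> \<subseteq># mset_set (set_mset (filter_mset (\<lambda>V. \<not> 3 \<le> size V) z))"
    using C by (intro subset_imp_msubset_mset_set) (auto simp: Q_def)
  also have "\<dots> \<subseteq># filter_mset (\<lambda>V. \<not> 3 \<le> size V) z"
    by (rule mset_set_set_mset_msubset)
  finally have "squares C \<subseteq># filter_mset (\<lambda>V. \<not> 3 \<le> size V) z" .
  moreover have "filter_mset (\<lambda>V. 3 \<le> size V) L = L"
    using L(2) by (simp add: filter_mset_eq_conv)
  then have "L \<subseteq># filter_mset (\<lambda>V. 3 \<le> size V) z"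
    using multiset_filter_mono[OF L(1)] by metis
  ultimately have "L + squares C \<subseteq>#
      filter_mset (\<lambda>V. 3 \<le> size V) z + filter_mset (\<lambda>V. \<not> 3 \<le> size V) z"
    by (intro subset_mset.add_mono)
  then show ?thesis by (simp flip: multiset_partition)
qed

text \<open>
  If squares of the members of a zero-sum set \<open>T\<close> occur in a factorization, then \<open>T \<cdot> T\<close> is a
  shorter way of writing their product.
\<close>

lemma indep_Q: "indep Q"
  unfolding indep_def
proof (intro conjI allI impI)
  show "finite Q" by (rule finite_Q)
  fix T assume T: "T \<subseteq> Q" "\<Sum>T = 0"
  then have fin: "finite T" using finite_Q finite_subset by auto
  have "zero_sum (\<lambda>x. x) (mset_set T)" using T by (simp add: zero_sum_id sum_mset_mset_set)
  then obtain f where f: "f \<in> zs_factorizations (\<lambda>x. x) (mset_set T)"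
    using factorization_exists by blast
  have size3: "3 \<le> size u" if u: "u \<in># f" for u
  proof -
    have sub: "u \<subseteq># mset_set T" by (rule factorization_member_sub[OF f u])
    have "0 \<notin># u" using mset_subset_eqD[OF sub, of 0] T zero_notin_Q fin by auto
    moreover have "u \<noteq> {#x, x#}" for x
      using mset_subset_eq_count[OF sub, of x] by (auto simp: count_mset_set' split: if_splits)
    ultimately show ?thesis
      using min_zero_sum_size[of u] f u by (auto simp: zs_factorizations_def)
  qed
  have "3 * size f = (\<Sum>u\<in>#f. 3)" by simp
  also have "\<dots> \<le> (\<Sum>u\<in>#f. size u)" using size3 by (intro sum_mset_mono) auto
  also have "\<dots> = card T" using f by (simp add: zs_factorizations_def flip: size_sum_mset)
  finally have le: "3 * size f \<le> card T" .
  have "size (squares T) \<le> size (f + f)"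
  proof (rule shorter)
    show "squares T \<subseteq># z" using squares_sub[of T "{#}"] T by simp
    show "\<Sum>\<^sub># (f + f) = \<Sum>\<^sub># (squares T)" using f by (simp add: sum_squares zs_factorizations_def)
    show "min_zero_sum (\<lambda>x. x) u" if "u \<in># f + f" for u
      using f that by (auto simp: zs_factorizations_def)
  qed
  then have "card T = 0" using le by (simp add: size_squares)
  then show "T = {}" using fin by simp
qed

text \<open>
  The absorption principle. Trading \<open>V\<close> together with the squares over \<open>C\<close> for \<open>X C\<close> and a
  factorization of \<open>(V / X) C\<close> does not lengthen the factorization, because every atom of the
  latter uses up an element of \<open>C\<close>. Extremality forces all these atoms to be squares.
\<close>

lemma absorption:
  assumes V: "V \<in># z" "3 \<le> size V" and X: "X \<subset># V" "X \<noteq> {#}"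
    and C: "C \<subseteq> Q" and XC: "min_zero_sum (\<lambda>x. x) (X + mset_set C)" "3 \<le> size (X + mset_set C)"
  shows "V = X + mset_set C"
proof -
  define V' where "V' = V - X"
  have VX: "V = X + V'" using X by (simp add: V'_def subset_mset.less_imp_le)
  have V'V: "V' \<subset># V" using X(2) VX by (simp add: subset_mset.less_le)
  have finC: "finite C" using C finite_Q finite_subset by auto
  have atomV: "min_zero_sum (\<lambda>x. x) V" using atoms V by blast
  let ?y = "{#V#} + squares C"
  have y: "?y \<subseteq># z" using V C by (intro squares_sub) auto
  have "zero_sum (\<lambda>x. x) ((X + mset_set C) + (V' + mset_set C))"
  proof -
    have "\<Sum>\<^sub># ((X + mset_set C) + (V' + mset_set C)) = \<Sum>\<^sub># V + (\<Sum>C + \<Sum>C)"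
      unfolding VX by (simp add: sum_mset_mset_set ac_simps)
    then show ?thesis using atomV by (simp add: zero_sum_id min_zero_sum_def double)
  qed
  then have "zero_sum (\<lambda>x. x) (V' + mset_set C)"
    using zero_sum_plus[of _ "X + mset_set C"] XC(1) by (auto simp: min_zero_sum_def)
  then obtain w where w: "w \<in> zs_factorizations (\<lambda>x. x) (V' + mset_set C)"
    using factorization_exists by blast
  obtain p where p: "image_mset (\<lambda>q. fst q + snd q) p = w"
    "(\<Sum>q\<in>#p. fst q) = V'" "(\<Sum>q\<in>#p. snd q) = mset_set C"
    using sum_mset_split[of w V' "mset_set C"] w by (auto simp: zs_factorizations_def)
  have size_p: "size p = size w" using p(1) by (metis size_image_mset)
  have e1: "1 \<le> size (snd q)" if q: "q \<in># p" for q
  proof (rule ccontr)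
    assume "\<not> 1 \<le> size (snd q)"
    then have e: "snd q = {#}" by (simp add: not_le)
    have "fst q \<in># w" using q e p(1) by force
    then have d: "min_zero_sum (\<lambda>x. x) (fst q)" using w by (auto simp: zs_factorizations_def)
    have "fst q \<subseteq># V'"
      using sum_mset_member_sub[OF q, of fst] p(2) by simp
    then show False
      using d atomV V'V unfolding min_zero_sum_def
      by (metis subset_mset.le_less_trans subset_mset.less_imp_le subset_mset.nless_le)
  qed
  have sum_e: "(\<Sum>q\<in>#p. size (snd q)) = card C"
  proof -
    have "(\<Sum>q\<in>#p. size (snd q)) = size (\<Sum>q\<in>#p. snd q)" by (induction p) auto
    then show ?thesis using p(3) by simp
  qed
  have w_le: "size w \<le> card C"
    using sum_mset_ge_size[of p "\<lambda>q. size (snd q)"] e1 sum_e size_p by simp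
  let ?new = "add_mset (X + mset_set C) w"
  have "?new \<in> zs_factorizations (\<lambda>x. x) (\<Sum>\<^sub># ?y)"
    using w XC(1) by (auto simp: zs_factorizations_def sum_squares VX)
  note ext = extremal[OF y this]
  then have w_eq: "size w = card C" using w_le by (simp add: size_squares)
  have "long_count ?y = 1"
    using V(2) by (simp add: long_count_def squares_def filter_mset_image_mset)
  moreover have "long_count ?new = Suc (long_count w)"
    using XC(2) by (simp add: long_count_def)
  ultimately have "long_count w = 0" using ext w_eq by (simp add: size_squares)
  then have none: "filter_mset (\<lambda>V. 3 \<le> size V) w = {#}"
    by (simp only: long_count_def size_eq_0_iff_empty)
  have short: "size u < 3" if "u \<in># w" for u
  proof (rule ccontr)
    assume "\<not> size u < 3"
    then have "u \<in># filter_mset (\<lambda>V. 3 \<le> size V) w" using that by simp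
    then show False unfolding none by simp
  qed
  have diag: "fst q = snd q" if q: "q \<in># p" for q
  proof -
    have e: "size (snd q) = 1"
      using sum_mset_eq_size[of p "\<lambda>q. size (snd q)" q] e1 sum_e size_p w_eq q by simp
    have u: "fst q + snd q \<in># w" using q p(1) by force
    have "0 \<notin># V' + mset_set C"
      using no_zero[OF V(1)] zero_notin_Q C VX finC by auto
    then have "0 \<notin># fst q + snd q"
      using factorization_no_zero[OF w _ u] by simp
    moreover have "min_zero_sum (\<lambda>x. x) (fst q + snd q)"
      using w u by (simp add: zs_factorizations_def)
    ultimately obtain x where x: "fst q + snd q = {#x, x#}"
      using min_zero_sum_size short[OF u] by fastforce
    obtain c where c: "snd q = {#c#}" using e size_1_singleton_mset by auto
    then have "c \<in># {#x, x#}" using x by (metis union_iff union_single_eq_member add_mset_add_single)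
    then have "c = x" by auto
    then show ?thesis using x c by simp
  qed
  have "V' = (\<Sum>q\<in>#p. snd q)"
    unfolding p(2)[symmetric] using diag
    by (intro arg_cong[of _ _ sum_mset] image_mset_cong) auto
  then show ?thesis using p(3) VX by simp
qed

lemma long_distinct:
  assumes "V \<in># z" "3 \<le> size V"
  shows "V = mset_set (set_mset V)"
  using min_zero_sum_distinct atoms assms by blast

lemma K_coords:
  assumes "x \<in> K"
  shows "coords Q x \<subseteq> Q" "\<Sum>(coords Q x) = x" "finite (coords Q x)"
  using coords_props[OF indep_Q] coords_finite[OF indep_Q] assms by (auto simp: K_def)

lemma Q_sub_K: "Q \<subseteq> K"
  unfolding K_def by (rule subset_sums_superset)

text \<open>Atoms with a term in \<open>K - Q\<close> are circuits of the basis \<open>Q\<close>.\<close>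

lemma long_inside:
  assumes V: "V \<in># z" "3 \<le> size V" and x: "x \<in># V" "x \<in> K" "x \<notin> Q"
  shows "V = add_mset x (mset_set (coords Q x))"
proof -
  note C = K_coords[OF x(2)]
  have "x \<noteq> 0" using no_zero V x by blast
  then have ne: "coords Q x \<noteq> {}" using C(2) by auto
  have "card (coords Q x) \<noteq> 1"
    using C x(3) by (auto simp: card_1_singleton_iff)
  moreover have "card (coords Q x) \<noteq> 0" using ne C(3) by simp
  ultimately have "3 \<le> size ({#x#} + mset_set (coords Q x))" by simp
  moreover have "min_zero_sum (\<lambda>x. x) ({#x#} + mset_set (coords Q x))"
    using min_zero_sum_insert[OF indep_subset[OF indep_Q C(1)] ne C(2)] by simp
  moreover have "{#x#} \<subset># V" using x V(2) by (auto simp: subset_mset.less_le)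
  ultimately show ?thesis using absorption[OF V _ _ C(1), of "{#x#}"] by simp
qed

lemma long_not_sub_Q:
  assumes V: "V \<in># z" "3 \<le> size V"
  shows "\<exists>x\<in>#V. x \<notin> Q"
proof (rule ccontr)
  assume "\<not> ?thesis"
  then have "set_mset V \<subseteq> Q" by auto
  moreover have "\<Sum>(set_mset V) = 0"
    using atoms[OF V(1)] long_distinct[OF V]
    by (metis min_zero_sum_def sum_mset_mset_set zero_sum_id)
  ultimately have "set_mset V = {}" using indep_Q unfolding indep_def by blast
  then show False using V(2) by simp
qed

lemma square_shape:
  assumes "V \<in># z" "\<not> 3 \<le> size V"
  shows "\<exists>x\<in>Q. V = {#x, x#}"
  using min_zero_sum_size[OF atoms[OF assms(1)] no_zero[OF assms(1)]] assms
  by (auto simp: Q_def)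

text \<open>
  If \<open>x\<close> and \<open>y\<close> lie in the same coset of \<open>K\<close>, but not in \<open>K\<close>, then this is the only atom that
  consists of \<open>x\<close>, \<open>y\<close> and elements of \<open>Q\<close>. Its length is 2 plus the Hamming distance of \<open>x\<close> and \<open>y\<close>.
\<close>

definition bridge :: "'v \<Rightarrow> 'v \<Rightarrow> 'v multiset"
  where "bridge x y = {#x, y#} + mset_set (coords Q (x + y))"

lemma bridge_commute: "bridge x y = bridge y x"
  by (simp add: bridge_def add.commute add_mset_commute)

lemma outside_indep:
  assumes y: "y \<notin> K" and C: "C \<subseteq> Q"
  shows "indep (insert y C)" "y \<notin> C"
proof -
  have "subset_sums C \<subseteq> K" using C unfolding K_def subset_sums_def by blast
  then have "y \<notin> subset_sums C" using y by auto
  then show "indep (insert y C)" by (rule indep_insert[OF indep_subset[OF indep_Q C]])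
  show "y \<notin> C" using y C Q_sub_K by auto
qed

lemma bridge_atom:
  assumes y: "y \<notin> K" and xy: "x + y \<in> K"
  shows "min_zero_sum (\<lambda>x. x) (bridge x y)"
proof -
  note C = K_coords[OF xy]
  note ind = outside_indep[OF y C(1)]
  have "\<Sum>(insert y (coords Q (x + y))) = y + (x + y)"
    using C ind(2) by simp
  also have "\<dots> = x" by (metis add.commute add_double(1))
  finally have "min_zero_sum (\<lambda>x. x) (add_mset x (mset_set (insert y (coords Q (x + y)))))"
    using ind(1) by (intro min_zero_sum_insert) auto
  then show ?thesis using ind(2) C(3) by (simp add: bridge_def)
qed

lemma long_outside:
  assumes V: "V \<in># z" "3 \<le> size V" and x: "x \<in># V" and y: "y \<in># V" "y \<notin> K"
    and xy: "x \<noteq> y" "x + y \<in> K"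
  shows "V = bridge x y" "coords Q (x + y) \<noteq> {}"
proof -
  note C = K_coords[OF xy(2)]
  show ne: "coords Q (x + y) \<noteq> {}"
    using C(2) xy(1) by (auto simp: add_eq_0_iff)
  then have "card (coords Q (x + y)) \<noteq> 0" using C(3) by simp
  then have "3 \<le> size ({#x, y#} + mset_set (coords Q (x + y)))" by simp
  moreover have "{#x, y#} \<subseteq># V"
  proof -
    have "{#x, y#} = mset_set {x, y}" using xy(1) by simp
    also have "\<dots> \<subseteq># mset_set (set_mset V)"
      using x y by (intro subset_imp_msubset_mset_set) auto
    finally show ?thesis using long_distinct[OF V] by simp
  qed
  then have "{#x, y#} \<subset># V" using V(2) by (auto simp: subset_mset.less_le)
  moreover have "min_zero_sum (\<lambda>x. x) ({#x, y#} + mset_set (coords Q (x + y)))"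
    using bridge_atom[OF y(2) xy(2)] by (simp add: bridge_def)
  ultimately show "V = bridge x y"
    unfolding bridge_def by (intro absorption[OF V _ _ C(1)]) auto
qed

text \<open>
  A basis in which all atoms are light bounds the number of atoms, since the total weight is
  bounded from below by the weight inequality for odd families.
\<close>

lemma length_bound_if_light:
  assumes B: "\<Sum>\<^sub># z = (\<Sum>X\<in>#A. mset_set X)" and A: "odd (size A)" "\<And>X. X \<in># A \<Longrightarrow> indep X"
      "\<And>X. X \<in># A \<Longrightarrow> X \<subseteq> G"
    and Q': "indep Q'" "Q' \<subseteq> G" "card Q' = r"
    and wt: "\<And>V. V \<in># z \<Longrightarrow> 2 + (\<Sum>x\<in>#V. card (coords Q' x)) \<le> 2 * size V"
  shows "2 * size z \<le> r * (size A - 1)"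
proof -
  have "zero_sum (\<lambda>x. x) (\<Sum>\<^sub># z)" using atoms zero_sum_Union by (auto simp: min_zero_sum_def)
  then have "coords Q' (\<Sum>\<^sub># (\<Sum>\<^sub># z)) = {}"
    using coords_unique[OF Q'(1), of "{}" 0] by (simp add: zero_sum_id)
  then have le: "2 * size (\<Sum>\<^sub># z) \<le> (\<Sum>x\<in>#\<Sum>\<^sub># z. card (coords Q' x)) + r * (size A - 1)"
    using odd_family_weight[OF Q'(1) A(1,2) _ B] A(3) subset_sums_eq_G[OF Q'] Q'(3) by simp
  have "2 * size z + (\<Sum>x\<in>#\<Sum>\<^sub># z. card (coords Q' x))
      = (\<Sum>V\<in>#z. 2 + (\<Sum>x\<in>#V. card (coords Q' x)))"
    by (induction z) auto
  also have "\<dots> \<le> (\<Sum>V\<in>#z. 2 * size V)" by (intro sum_mset_mono wt)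
  also have "\<dots> = 2 * size (\<Sum>\<^sub># z)" by (induction z) auto
  finally show ?thesis using le by simp
qed

lemma count_squares: "2 * count z {#x, x#} \<le> count (\<Sum>\<^sub># z) x"
proof -
  have "2 * count w {#x, x#} \<le> count (\<Sum>\<^sub># w) x" for w :: "'v multiset multiset"
    by (induction w) auto
  then show ?thesis .
qed

lemma size_short: "size (filter_mset (\<lambda>V. \<not> 3 \<le> size V) z) = (\<Sum>x\<in>Q. count z {#x, x#})"
proof -
  let ?f = "\<lambda>x::'v. {#x, x#}"
  have set: "set_mset (filter_mset (\<lambda>V. \<not> 3 \<le> size V) z) = ?f ` Q"
    using square_shape by (force simp: Q_def)
  have "size (filter_mset (\<lambda>V. \<not> 3 \<le> size V) z)
      = (\<Sum>V\<in>?f ` Q. count (filter_mset (\<lambda>V. \<not> 3 \<le> size V) z) V)"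
    unfolding set[symmetric] by (rule size_multiset_overloaded_eq)
  also have "\<dots> = (\<Sum>x\<in>Q. count z (?f x))"
    by (subst sum.reindex) (auto simp: inj_on_def square_eq_iff)
  finally show ?thesis .
qed

end

section \<open>The case of a hyperplane of squares\<close>

text \<open>
  If \<open>Q\<close> spans only a hyperplane \<open>K\<close>, a basis needs one more element \<open>a\<close> outside \<open>K\<close>. The atoms that
  leave \<open>K\<close> pair up the points of the other coset, and minimality of the length says that this
  matching has maximal total Hamming distance. The aim is a point \<open>a\<close> that lies
  between the two points of every pair.
\<close>

locale extremal_hyperplane = extremal_factorization +
  assumes card_Q: "Suc (card Q) = r"
begin

lemma outside_add: "x \<in> G - K \<Longrightarrow> y \<in> G - K \<Longrightarrow> x + y \<in> K"
  unfolding K_def using hyperplane_coset[OF indep_Q Q_sub_G card_Q] by simp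

lemma size_bridge: "size (bridge x y) = 2 + card (coords Q (x + y))"
  by (simp add: bridge_def)

lemma bridge_inj:
  assumes "bridge x y = bridge x' y'" "x \<in> G - K" "y \<in> G - K" "x' \<in> G - K" "y' \<in> G - K"
  shows "{#x, y#} = {#x', y'#}"
proof -
  have "filter_mset (\<lambda>v. v \<notin> K) (bridge u v) = {#u, v#}" if "u \<in> G - K" "v \<in> G - K" for u v
  proof -
    have "coords Q (u + v) \<subseteq> K" using K_coords(1)[OF outside_add[OF that]] Q_sub_K by simp
    then have none: "{w \<in> coords Q (u + v). w \<notin> K} = {}" by auto
    have "filter_mset (\<lambda>v. v \<notin> K) (mset_set (coords Q (u + v))) = {#}"
      unfolding filter_mset_mset_set[OF K_coords(3)[OF outside_add[OF that]]] none by simp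
    then show ?thesis using that by (simp add: bridge_def)
  qed
  then show ?thesis using assms by metis
qed

lemma long_cases:
  assumes V: "V \<in># z" "3 \<le> size V"
  obtains (inside) x where "x \<in> K" "x \<notin> Q" "V = add_mset x (mset_set (coords Q x))"
  | (outside) x y where "x \<in> G - K" "y \<in> G - K" "x \<noteq> y" "V = bridge x y" "coords Q (x + y) \<noteq> {}"
proof (cases "\<exists>x\<in>#V. x \<notin> K")
  case True
  then obtain x where x: "x \<in># V" "x \<notin> K" by blast
  obtain v where v: "V = add_mset x v" using multi_member_split[OF x(1)] by blast
  have "\<Sum>\<^sub># V = 0" using atoms[OF V(1)] by (simp add: min_zero_sum_def zero_sum_id)
  then have "x = \<Sum>\<^sub># v" using v by (simp add: add_eq_0_iff)
  then obtain y where y: "y \<in># v" "y \<notin> K"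
    using subset_sums_sum_mset[OF finite_Q, of v] x(2) unfolding K_def by blast
  have "x \<noteq> y"
  proof
    assume "x = y"
    then have "2 \<le> count V x" using v y by (simp add: Suc_le_eq)
    moreover have "count V x \<le> 1"
      using long_distinct[OF V] by (metis count_mset_set' le_refl zero_le_one)
    ultimately show False by simp
  qed
  have inG: "x \<in> G - K" "y \<in> G - K" using in_G[OF V(1)] x y v by auto
  show ?thesis
    using outside[OF inG \<open>x \<noteq> y\<close>] long_outside[OF V x(1) _ y(2) \<open>x \<noteq> y\<close>] outside_add[OF inG] v y
    by simp
next
  case False
  then obtain x where "x \<in># V" "x \<notin> Q" "x \<in> K" using long_not_sub_Q[OF V] by auto
  then show ?thesis using inside long_inside[OF V] by blast
qed

text \<open>
  In the basis \<open>insert a Q\<close> the atom \<open>bridge x y\<close> has weight at most \<open>2 |bridge x y| - 2\<close> exactly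
  if \<open>overlap a x y\<close> is empty, that is, if \<open>a\<close> lies between \<open>x\<close> and \<open>y\<close> in the Hamming metric
  given by \<open>Q\<close>.
\<close>

definition overlap :: "'a \<Rightarrow> 'a \<Rightarrow> 'a \<Rightarrow> 'a set"
  where "overlap a x y = coords Q (x + a) \<inter> coords Q (y + a)"

lemma overlap_commute: "overlap a x y = overlap a y x"
  by (auto simp: overlap_def)

lemma coords_self: "coords Q (x + x) = {}"
  using coords_unique[OF indep_Q, of "{}" 0] by (simp add: double)

lemma overlap_self [simp]: "overlap a a y = {}" "overlap a x a = {}"
  by (simp_all add: overlap_def coords_self)

lemma coords_between:
  assumes "a \<in> G - K" "x \<in> G - K" "y \<in> G - K"
  shows "coords Q (x + y) = sym_diff (coords Q (x + a)) (coords Q (y + a))"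
proof -
  have "x + y = (x + a) + (y + a)" by (metis add.assoc add.commute add_double(2))
  then show ?thesis
    using coords_add[OF indep_Q] outside_add assms unfolding K_def by metis
qed

lemma mset_coords_between:
  assumes "a \<in> G - K" "x \<in> G - K" "y \<in> G - K"
  shows "mset_set (coords Q (x + a)) + mset_set (coords Q (y + a))
    = mset_set (coords Q (x + y)) + mset_set (overlap a x y) + mset_set (overlap a x y)"
  unfolding overlap_def coords_between[OF assms]
  using K_coords(3) outside_add assms by (intro mset_set_sym_diff) auto

lemma coords_shift:
  assumes "a \<in> G - K" "a' \<in> G - K" "x \<in> G - K" "h \<in> Q" "a + a' = h"
  shows "coords Q (x + a') = sym_diff (coords Q (x + a)) {h}"
proof -
  have "x + a' = (x + a) + h" using assms(5) by (metis add.assoc add_double(1))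
  moreover have "h \<in> K" using assms(4) Q_sub_K by blast
  then have "coords Q ((x + a) + h) = sym_diff (coords Q (x + a)) {h}"
    using coords_add[OF indep_Q, of "x + a" h] outside_add[OF assms(3,1)] coords_member[OF indep_Q assms(4)]
    unfolding K_def by simp
  ultimately show ?thesis by (simp only:)
qed

lemma weight_of_good:
  assumes a: "a \<in> G - K" and V: "V \<in># z"
    and good: "\<And>x y. x \<in> G - K \<Longrightarrow> y \<in> G - K \<Longrightarrow> V = bridge x y \<Longrightarrow> overlap a x y = {}"
  shows "2 + (\<Sum>x\<in>#V. card (coords (insert a Q) x)) \<le> 2 * size V"
proof -
  have ind: "indep (insert a Q)" using outside_indep[of a Q] a by auto
  have inK: "coords (insert a Q) x = coords Q x" if "x \<in> K" for x
    using coords_unique[OF ind, of "coords Q x"] K_coords[OF that] by auto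
  have outK: "card (coords (insert a Q) x) = Suc (card (coords Q (x + a)))" if x: "x \<in> G - K" for x
  proof -
    note C = K_coords[OF outside_add[OF x a]]
    have na: "a \<notin> coords Q (x + a)" using C(1) a Q_sub_K by auto
    have "coords (insert a Q) x = insert a (coords Q (x + a))"
    proof (rule coords_unique[OF ind])
      show "\<Sum>(insert a (coords Q (x + a))) = x"
        using C na by (simp add: add.commute)
    qed (use C in auto)
    then show ?thesis using na C(3) by simp
  qed
  have single: "card (coords (insert a Q) x) = 1" if "x \<in> Q" for x
    using that coords_member[OF ind] by simp
  have sumQ: "(\<Sum>x\<in>#mset_set C. card (coords (insert a Q) x)) = card C" if "C \<subseteq> Q" for C
    using that single by (simp add: subset_iff flip: sum_unfold_sum_mset)
  show ?thesis
  proof (cases "3 \<le> size V")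
    case False
    then show ?thesis using square_shape[OF V] single by auto
  next
    case True
    from V True show ?thesis
    proof (cases rule: long_cases)
      case (inside x)
      then show ?thesis using sumQ K_coords[of x] inK by simp
    next
      case (outside x y)
      have xy: "x + y \<in> K" using outside outside_add by blast
      have "card (coords Q (x + a)) + card (coords Q (y + a)) = card (coords Q (x + y))"
        using arg_cong[OF mset_coords_between[OF a outside(1,2)], of size] good outside by simp
      then show ?thesis
        using outside outK sumQ[OF K_coords(1)[OF xy]] by (simp add: bridge_def)
    qed
  qed
qed

text \<open>
  Exchanging partners between the triple \<open>a a' h\<close> and another bridge: every common coordinate
  except possibly \<open>h\<close> would save an atom.
\<close>

lemma switch:
  assumes sub: "{#bridge a a', bridge x y#} \<subseteq># z"
    and long: "3 \<le> size (bridge x y)"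
    and out: "a \<in> G - K" "a' \<in> G - K" "x \<in> G - K" "y \<in> G - K"
    and h: "h \<in> Q" "a + a' = h"
  shows "overlap a x y = {} \<or> overlap a x y = {h}"
proof -
  have ch: "coords Q (a + a') = {h}" using coords_member[OF indep_Q] h by simp
  have step: "overlap a x y = {} \<or> overlap a x y = {h}"
    if sub: "{#bridge a a', bridge x y#} \<subseteq># z"
      and long: "3 \<le> size (bridge x y)"
      and xy: "x \<in> G - K" "y \<in> G - K" and cond: "h \<notin> coords Q (y + a) \<or> h \<in> overlap a x y" for x y
  proof -
    let ?T = "overlap a x y"
    have T: "?T \<subseteq> Q" unfolding overlap_def using K_coords(1) outside_add xy out by blast
    have finT: "finite ?T" using T finite_Q finite_subset by auto
    have fin: "finite (coords Q (y + a))" using K_coords(3) outside_add xy out by blast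
    let ?y = "{#bridge a a', bridge x y#} + squares ?T"
    have y: "?y \<subseteq># z"
      using sub long ch by (intro squares_sub[OF T]) (auto simp: size_bridge)
    have sum_y: "\<Sum>\<^sub># ?y = {#a, a', x, y, h#} + (mset_set (coords Q (x + a)) + mset_set (coords Q (y + a)))"
      unfolding mset_coords_between[OF out(1) xy]
      by (simp add: sum_squares bridge_def ch add_mset_commute)
    have c: "coords Q (a' + y) = sym_diff (coords Q (y + a)) {h}"
      using coords_shift[OF out(1,2) xy(2) h] by (simp add: add.commute)
    have atom1: "min_zero_sum (\<lambda>x. x) (bridge a x)" "min_zero_sum (\<lambda>x. x) (bridge a' y)"
      using bridge_atom outside_add out xy by blast+
    show ?thesis
    proof (cases "h \<in> overlap a x y")
      case False
      then have hy: "h \<notin> coords Q (y + a)" using cond by simp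
      have eq: "\<Sum>\<^sub># {#bridge a x, bridge a' y#} = \<Sum>\<^sub># ?y"
        unfolding sum_y using hy fin c by (simp add: bridge_def add.commute[of a x] add_mset_commute Un_commute)
      have "size ?y \<le> size {#bridge a x, bridge a' y#}"
        by (rule shorter[OF y _ eq]) (use atom1 in auto)
      then have "card ?T = 0" by (simp add: size_squares)
      then show ?thesis using finT by simp
    next
      case True
      then have hy: "h \<in> coords Q (y + a)" by (simp add: overlap_def)
      have c': "mset_set (coords Q (y + a)) = add_mset h (mset_set (coords Q (a' + y)))"
      proof -
        have "coords Q (y + a) = insert h (coords Q (a' + y))" "h \<notin> coords Q (a' + y)"
          using c hy by auto
        then show ?thesis using fin by (metis finite_insert mset_set.insert)
      qed
      have eq: "\<Sum>\<^sub># {#bridge a x, bridge a' y, {#h, h#}#} = \<Sum>\<^sub># ?y"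
        unfolding sum_y c' by (simp add: bridge_def add.commute[of a x] add_mset_commute)
      have "h \<noteq> 0" using h zero_notin_Q by auto
      then have "size ?y \<le> size {#bridge a x, bridge a' y, {#h, h#}#}"
        by (intro shorter[OF y _ eq]) (use atom1 min_zero_sum_two in auto)
      then have "card ?T \<le> 1" by (simp add: size_squares)
      then show ?thesis using True finT by (metis card_le_Suc0_iff_eq One_nat_def empty_iff
            insertI1 is_singletonI' is_singleton_def singletonD)
    qed
  qed
  show ?thesis
  proof (cases "h \<notin> coords Q (y + a) \<or> h \<in> overlap a x y")
    case True
    then show ?thesis by (rule step[OF sub long out(3,4)])
  next
    case False
    then have "h \<notin> coords Q (x + a)" by (simp add: overlap_def)
    then show ?thesis
      using step[of y x] sub long out by (simp add: bridge_commute[of y x] overlap_commute[of a y x])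
  qed
qed

definition bad :: "'a \<Rightarrow> 'a multiset \<Rightarrow> bool"
  where "bad a V \<longleftrightarrow> (\<exists>x\<in>G - K. \<exists>y\<in>G - K. V = bridge x y \<and> overlap a x y \<noteq> {})"

lemma not_bad_self: "a \<in> G - K \<Longrightarrow> b \<in> G - K \<Longrightarrow> \<not> bad a (bridge a b)"
  unfolding bad_def
proof (intro notI, elim bexE conjE)
  fix x y assume *: "a \<in> G - K" "b \<in> G - K" "x \<in> G - K" "y \<in> G - K"
    "bridge a b = bridge x y" "overlap a x y \<noteq> {}"
  have "{#a, b#} = {#x, y#}" by (rule bridge_inj) (use * in auto)
  then have "x = a \<or> y = a" by (auto simp: add_eq_conv_ex)
  then show False using *(6) by auto
qed

lemma bad_switch:
  assumes "bad a V" "{#bridge a a', V#} \<subseteq># z" "3 \<le> size V"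
    "a \<in> G - K" "a' \<in> G - K" "h \<in> Q" "a + a' = h"
  obtains x y where "x \<in> G - K" "y \<in> G - K" "V = bridge x y" "overlap a x y = {h}"
  using assms switch unfolding bad_def by metis

text \<open>
  By the exchange inequality \<open>a\<close> or \<open>a'\<close> lies between \<open>x\<close> and \<open>y\<close>, and these two are adjacent.
\<close>

lemma triples_share:
  assumes sub: "{#bridge a a', bridge x y#} \<subseteq># z"
    and out: "a \<in> G - K" "a' \<in> G - K" "x \<in> G - K" "y \<in> G - K"
    and h: "h \<in> Q" "a + a' = h" and g: "g \<in> Q" "x + y = g"
  shows "a = x \<or> a = y \<or> a' = x \<or> a' = y"
proof -
  have cg: "coords Q (x + y) = {g}" using coords_member[OF indep_Q] g by simp
  have meet: "b = x \<or> b = y" if b: "b \<in> G - K" and e: "overlap b x y = {}" for b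
  proof -
    have *: "X = {} \<or> Y = {}" if "X \<inter> Y = {}" "{g} = sym_diff X Y" for X Y :: "'a set"
    proof (cases "g \<in> X")
      case True
      then have "y \<notin> Y" for y using that by (metis Diff_iff IntI UnI2 empty_iff singletonD)
      then show ?thesis by blast
    next
      case False
      then have "y \<notin> X" for y using that by (metis Diff_iff IntI UnI1 empty_iff singletonD)
      then show ?thesis by blast
    qed
    have "coords Q (x + b) = {} \<or> coords Q (y + b) = {}"
      by (rule *) (use e coords_between[OF b out(3,4)] cg in \<open>simp_all add: overlap_def\<close>)
    then have "x + b = 0 \<or> y + b = 0"
      using K_coords(2)[OF outside_add[OF out(3) b]] K_coords(2)[OF outside_add[OF out(4) b]] by auto
    then show ?thesis by (auto simp: add_eq_0_iff)
  qed
  have "overlap a x y = {} \<or> overlap a x y = {h}"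
    using switch[OF sub _ out h] cg by (simp add: size_bridge)
  moreover have "overlap a' x y = {}" if "overlap a x y = {h}"
    using that coords_shift[OF out(1,2) out(3) h] coords_shift[OF out(1,2) out(4) h]
    by (auto simp: overlap_def)
  ultimately show ?thesis using meet out by blast
qed

lemma bad_long:
  assumes V: "V \<in># z" and bad: "bad a V"
  shows "3 \<le> size V"
proof -
  obtain x y where xy: "x \<in> G - K" "y \<in> G - K" "V = bridge x y" "overlap a x y \<noteq> {}"
    using bad unfolding bad_def by blast
  have "size V \<noteq> 2"
  proof
    assume "size V = 2"
    then obtain q where "q \<in> Q" "V = {#q, q#}" using square_shape[OF V] by auto
    moreover have "x \<in># V" using xy(3) by (simp add: bridge_def)
    ultimately have "x \<in> Q" by simp
    then show False using xy(1) Q_sub_K by auto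
  qed
  then show ?thesis using xy(3) by (simp add: size_bridge)
qed

lemma pair_sub_mset:
  assumes "v \<in># m" shows "{#s, v#} \<subseteq># {#s, t#} + m" "{#t, v#} \<subseteq># {#s, t#} + m"
proof -
  obtain m' where "m = add_mset v m'" using multi_member_split[OF assms] by blast
  then show "{#s, v#} \<subseteq># {#s, t#} + m" "{#t, v#} \<subseteq># {#s, t#} + m"
    by (simp_all add: subseteq_mset_def)
qed

text \<open>
  Two different triples \<open>a a' h\<close> and \<open>a b g\<close>: for every further atom the overlap at \<open>a\<close> can only be
  \<open>{h}\<close> by the first triple and only \<open>{g}\<close> by the second one.
\<close>

lemma distinct_triples_good:
  assumes z: "{#bridge a a', bridge a b#} + z0 = z" and ne: "bridge a a' \<noteq> bridge a b"
    and out: "a \<in> G - K" "a' \<in> G - K" "b \<in> G - K"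
    and h: "h \<in> Q" "a + a' = h" and g: "g \<in> Q" "a + b = g"
    and V: "V \<in># z"
  shows "\<not> bad a V"
proof
  assume bad: "bad a V"
  have "V \<in># {#bridge a a', bridge a b#} + z0" using V by (simp only: z)
  then have V0: "V \<in># z0"
    using bad not_bad_self[OF out(1,2)] not_bad_self[OF out(1,3)] by auto
  have size: "3 \<le> size V" by (rule bad_long[OF V bad])
  have sub: "{#bridge a a', V#} \<subseteq># z" "{#bridge a b, V#} \<subseteq># z"
    using pair_sub_mset[OF V0, where s = "bridge a a'" and t = "bridge a b"]
    by (simp_all only: z)
  obtain x y where xy: "x \<in> G - K" "y \<in> G - K" "V = bridge x y" "overlap a x y = {h}"
    using bad_switch[OF bad sub(1) size out(1,2) h] by blast
  have "overlap a x y = {} \<or> overlap a x y = {g}"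
    using switch[of a b x y g] sub(2) size xy out g by simp
  then have "h = g" using xy(4) by auto
  then have "a' = b" using h g by (metis add_left_cancel)
  then show False using ne by simp
qed

text \<open>
  If the triple \<open>a a' h\<close> occurs twice, one of \<open>a\<close> and \<open>a'\<close> suits all atoms. Otherwise a bridge \<open>V\<close>
  not around \<open>a\<close> and a bridge \<open>W\<close> not around \<open>a'\<close> could be matched with the two copies of
  \<open>a\<close> and \<open>a'\<close>: these four atoms together with the square of \<open>h\<close> would become four atoms.
\<close>

lemma equal_triples_good:
  assumes z: "{#bridge a a', bridge a a'#} + z0 = z"
    and out: "a \<in> G - K" "a' \<in> G - K" and h: "h \<in> Q" "a + a' = h"
  shows "(\<forall>V\<in>#z. \<not> bad a V) \<or> (\<forall>V\<in>#z. \<not> bad a' V)"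
proof (rule ccontr)
  assume "\<not> ?thesis"
  then obtain V W where VW: "V \<in># z" "bad a V" "W \<in># z" "bad a' W" by blast
  have h': "a' + a = h" using h by (simp add: add.commute)
  have long: "3 \<le> size V" "3 \<le> size W" using bad_long VW by blast+
  have nb: "\<not> bad a (bridge a a')" "\<not> bad a' (bridge a a')"
    using not_bad_self[OF out] not_bad_self[OF out(2,1)] bridge_commute[of a a'] by simp_all
  have "V \<in># {#bridge a a', bridge a a'#} + z0" "W \<in># {#bridge a a', bridge a a'#} + z0"
    using VW by (simp_all only: z)
  then have V0: "V \<in># z0" and W0: "W \<in># z0" using VW nb by auto
  have sub: "{#bridge a a', V#} \<subseteq># z" "{#bridge a' a, W#} \<subseteq># z"
    using pair_sub_mset(1)[OF V0, of "bridge a a'" "bridge a a'"]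
      pair_sub_mset(1)[OF W0, of "bridge a a'" "bridge a a'"]
    by (simp_all only: z bridge_commute[of a' a])
  obtain x y where xy: "x \<in> G - K" "y \<in> G - K" "V = bridge x y" "overlap a x y = {h}"
    using bad_switch[OF VW(2) sub(1) long(1) out h] by blast
  obtain c d where cd: "c \<in> G - K" "d \<in> G - K" "W = bridge c d" "overlap a' c d = {h}"
    using bad_switch[OF VW(4) sub(2) long(2) out(2,1) h(1) h'] by blast
  have "V \<noteq> W"
  proof
    assume "V = W"
    then have "bridge x y = bridge c d" using xy(3) cd(3) by (simp only:)
    then have "{#x, y#} = {#c, d#}" by (rule bridge_inj) (fact xy cd)+
    then have "x = c \<and> y = d \<or> x = d \<and> y = c" by (auto simp: add_eq_conv_ex)
    then have "overlap a' x y = {h}" using cd(4) overlap_commute by auto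
    then have "h \<in> coords Q (x + a')" by (auto simp: overlap_def)
    moreover have "h \<in> coords Q (x + a)" using xy(4) by (auto simp: overlap_def)
    ultimately show False using coords_shift[OF out xy(1) h] by auto
  qed
  then have "{#V, W#} \<subseteq># z0"
    using V0 W0 by (auto simp: insert_subset_eq_iff in_diff_count)
  then have "{#bridge a a', bridge a a'#} + {#V, W#} \<subseteq># {#bridge a a', bridge a a'#} + z0"
    by (rule subset_mset.add_left_mono)
  then have sub4: "{#bridge a a', bridge a a'#} + {#V, W#} \<subseteq># z" by (simp only: z)
  have ch: "coords Q (a + a') = {h}" using coords_member[OF indep_Q] h by simp
  let ?y = "({#bridge a a', bridge a a'#} + {#V, W#}) + squares {h}"
  let ?w = "{#bridge a x, bridge a y, bridge a' c, bridge a' d#}"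
  have y: "?y \<subseteq># z"
    using sub4 long ch h by (intro squares_sub) (auto simp: size_bridge)
  have eq: "\<Sum>\<^sub># ?w = \<Sum>\<^sub># ?y"
  proof -
    have "\<Sum>\<^sub># ?w = {#a, x, a, y, a', c, a', d#}
        + (mset_set (coords Q (x + a)) + mset_set (coords Q (y + a)))
        + (mset_set (coords Q (c + a')) + mset_set (coords Q (d + a')))"
      by (simp add: bridge_def add.commute)
    also have "\<dots> = {#a, x, a, y, a', c, a', d#}
        + (mset_set (coords Q (x + y)) + {#h, h#}) + (mset_set (coords Q (c + d)) + {#h, h#})"
      unfolding mset_coords_between[OF out(1) xy(1,2)] mset_coords_between[OF out(2) cd(1,2)] xy(4) cd(4)
      by simp
    also have "\<dots> = \<Sum>\<^sub># ?y"
      unfolding xy(3) cd(3) by (simp add: sum_squares bridge_def ch add_mset_commute)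
    finally show ?thesis .
  qed
  have "size ?y \<le> size ?w"
    by (rule shorter[OF y _ eq]) (use bridge_atom outside_add out xy(1,2) cd(1,2) in auto)
  then show False by (simp add: size_squares)
qed

lemma two_triples_good:
  assumes "{#bridge a a', bridge x y#} \<subseteq># z"
    and "a \<in> G - K" "a' \<in> G - K" "x \<in> G - K" "y \<in> G - K"
    and "a + a' \<in> Q" "x + y \<in> Q"
  shows "\<exists>b\<in>G - K. \<forall>V\<in>#z. \<not> bad b V"
proof -
  obtain z0 where z: "{#bridge a a', bridge x y#} + z0 = z"
    using assms(1) by (metis subset_mset.add_diff_inverse)
  show ?thesis
  proof (cases "bridge a a' = bridge x y")
    case True
    then have "{#bridge a a', bridge a a'#} + z0 = z" using z by simp
    from equal_triples_good[OF this assms(2,3,6) refl] show ?thesis using assms(2,3) by blast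
  next
    case False
    have *: "\<exists>b\<in>G - K. \<forall>V\<in>#z. \<not> bad b V"
      if "{#bridge b u, bridge b v#} + z0 = z" "bridge b u \<noteq> bridge b v"
        "b \<in> G - K" "u \<in> G - K" "v \<in> G - K" "b + u \<in> Q" "b + v \<in> Q" for b u v
      using distinct_triples_good[OF that(1-5) that(6) refl that(7) refl] that(3) by blast
    have "a = x \<or> a = y \<or> a' = x \<or> a' = y"
      using triples_share[OF assms(1-6) refl assms(7) refl] .
    then show ?thesis
      using *[of a a' y] *[of a a' x] *[of a' a y] *[of a' a x] z False assms
      by (metis add.commute bridge_commute)
  qed
qed

end

section \<open>Short factorizations of products of an odd number of independent sets\<close>

lemma size_filter_sum: "size (filter_mset P M) = (\<Sum>V\<in>#M. if P V then 1 else 0)"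
  by (induction M) auto

lemma filter_sum_mset: "filter_mset P (\<Sum>V\<in>#M. f V) = (\<Sum>V\<in>#M. filter_mset P (f V))"
  by (induction M) auto

lemma sum_sum_mset:
  fixes f :: "'p \<Rightarrow> 'b::comm_monoid_add"
  shows "(\<Sum>x\<in>#(\<Sum>V\<in>#M. g V). f x) = (\<Sum>V\<in>#M. \<Sum>x\<in>#g V. f x)"
  by (induction M) auto

lemma two_members:
  assumes "2 \<le> size M"
  obtains s t where "{#s, t#} \<subseteq># M"
proof -
  obtain s M' where s: "M = add_mset s M'" using assms by (cases M) auto
  then obtain t M'' where "M' = add_mset t M''" using assms by (cases M') auto
  then show ?thesis using that[of s t] s by simp
qed

lemma (in elementary_2_space) product_size_le:
  assumes A: "\<And>X. X \<in># A \<Longrightarrow> indep X" "\<And>X. X \<in># A \<Longrightarrow> X \<subseteq> G"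
  shows "size (\<Sum>X\<in>#A. mset_set X) \<le> r * size A"
proof -
  have "size (\<Sum>X\<in>#A. mset_set X) = (\<Sum>X\<in>#A. card X)" by (induction A) auto
  also have "\<dots> \<le> (\<Sum>X\<in>#A. r)" using A by (intro sum_mset_mono indep_card_le) auto
  finally show ?thesis by (simp add: mult.commute)
qed

context extremal_hyperplane
begin

definition crossing :: "'a multiset \<Rightarrow> bool"
  where "crossing V \<longleftrightarrow> (\<exists>x\<in>#V. x \<notin> K)"

lemma crossing_cases:
  assumes V: "V \<in># z"
  obtains (square) x where "x \<in> Q" "V = {#x, x#}" "\<not> crossing V"
  | (inside) x where "x \<in> K" "V = add_mset x (mset_set (coords Q x))" "\<not> crossing V"
  | (outside) x y where "x \<in> G - K" "y \<in> G - K" "V = bridge x y" "coords Q (x + y) \<noteq> {}" "crossing V"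
proof (cases "3 \<le> size V")
  case False
  then obtain x where "x \<in> Q" "V = {#x, x#}" using square_shape[OF V] by blast
  moreover from this have "\<not> crossing V" using Q_sub_K by (auto simp: crossing_def)
  ultimately show ?thesis using square by blast
next
  case True
  from V True show ?thesis
  proof (cases rule: long_cases)
    case (inside x)
    moreover from this have "\<not> crossing V"
      using K_coords[of x] Q_sub_K by (auto simp: crossing_def)
    ultimately show ?thesis using that(2) by blast
  next
    case (outside x y)
    moreover from this have "crossing V" by (auto simp: crossing_def bridge_def)
    ultimately show ?thesis using that(3) by blast
  qed
qed

lemma coords_Q_member: "x \<in> Q \<Longrightarrow> card (coords Q x) = 1"
  using coords_member[OF indep_Q] by simp

lemma weight_sub_Q:
  assumes "C \<subseteq> Q" shows "(\<Sum>x\<in>#mset_set C. card (coords Q x)) = card C"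
  using assms coords_Q_member by (simp add: subset_iff flip: sum_unfold_sum_mset)

lemma crossing_weight:
  assumes V: "V \<in># z" and VK: "VK = filter_mset (\<lambda>x. x \<in> K) V"
  shows "2 + (\<Sum>x\<in>#VK. card (coords Q x)) + card (coords Q (\<Sum>\<^sub># VK))
    \<le> 2 * size VK + 2 * (if crossing V then 1 else 0)"
proof -
  have zero: "coords Q 0 = {}" using coords_self[of 0] by simp
  have sumV: "\<Sum>\<^sub># V = 0" using atoms[OF V] by (simp add: min_zero_sum_def zero_sum_id)
  from V show ?thesis
  proof (cases rule: crossing_cases)
    case (square x)
    then have "VK = V" using Q_sub_K by (auto simp: VK)
    then show ?thesis using square sumV zero coords_Q_member by simp
  next
    case (inside x)
    then have "VK = V" by (simp add: VK filter_mset_eq_conv crossing_def)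
    then show ?thesis
      using inside sumV zero weight_sub_Q[OF K_coords(1)[OF inside(1)]] by simp
  next
    case (outside x y)
    note C = K_coords[OF outside_add[OF outside(1,2)]]
    have all: "{v \<in> coords Q (x + y). v \<in> K} = coords Q (x + y)" using C(1) Q_sub_K by auto
    have "filter_mset (\<lambda>x. x \<in> K) (mset_set (coords Q (x + y))) = mset_set (coords Q (x + y))"
      unfolding filter_mset_mset_set[OF C(3)] all ..
    then have "VK = mset_set (coords Q (x + y))"
      using outside by (simp add: VK bridge_def)
    then show ?thesis using outside(5) C(2) weight_sub_Q[OF C(1)] by (simp add: sum_mset_mset_set)
  qed
qed

text \<open>
  The weight inequality on the hyperplane forces so many atoms to cross it that at least two
  of them are triples; exchanging their endpoints yields a basis of small weight.
\<close>

lemma hyperplane_bound: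
  assumes B: "\<Sum>\<^sub># z = (\<Sum>X\<in>#A. mset_set X)" and A: "odd (size A)" "\<And>X. X \<in># A \<Longrightarrow> indep X"
      "\<And>X. X \<in># A \<Longrightarrow> X \<subseteq> G" and r: "r \<le> size A"
  shows "2 * size z \<le> r * (size A - 1)"
proof (rule ccontr)
  assume "\<not> ?thesis"
  moreover have "even (r * (size A - 1))" using A(1) by simp
  ultimately have many: "r * (size A - 1) + 2 \<le> 2 * size z" by presburger
  define inK where "inK V = filter_mset (\<lambda>x. x \<in> K) V" for V
  define zB where "zB = size (filter_mset crossing z)"
  define zT where "zT = size (filter_mset (\<lambda>V. crossing V \<and> size V = 3) z)"
  have finX: "finite X" if "X \<in># A" for X using A(2)[OF that] indep_finite by auto
  let ?BK = "inK (\<Sum>\<^sub># z)"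
  have BK: "?BK = (\<Sum>X\<in>#image_mset (\<lambda>X. X \<inter> K) A. mset_set X)"
  proof -
    have "filter_mset (\<lambda>x. x \<in> K) (mset_set X) = mset_set (X \<inter> K)" if "X \<in># A" for X
      using finX[OF that] by (simp add: Int_def)
    then show ?thesis unfolding B inK_def filter_sum_mset image_mset.compositionality comp_def
      by (intro arg_cong[of _ _ sum_mset] image_mset_cong) auto
  qed
  have BKz: "?BK = (\<Sum>V\<in>#z. inK V)"
    using filter_sum_mset[of _ "\<lambda>V. V" z] by (simp add: inK_def)
  have fam: "2 * size ?BK \<le> (\<Sum>x\<in>#?BK. card (coords Q x)) + card Q * (size A - 1)
      + card (coords Q (\<Sum>\<^sub># ?BK))"
    using odd_family_weight[OF indep_Q, of "image_mset (\<lambda>X. X \<inter> K) A" ?BK] A(1) BK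
    by (auto simp: K_def[symmetric] intro: indep_subset[OF A(2)])
  have "card (coords Q (\<Sum>\<^sub># ?BK)) \<le> (\<Sum>V\<in>#z. card (coords Q (\<Sum>\<^sub># (inK V))))"
  proof -
    have "\<Sum>\<^sub># (image_mset (\<lambda>V. \<Sum>\<^sub># (inK V)) z) = \<Sum>\<^sub># ?BK"
      unfolding BKz by (induction z) auto
    moreover have "\<Sum>\<^sub># (inK V) \<in> subset_sums Q" for V
      using subset_sums_sum_mset[OF finite_Q, of "inK V"] by (auto simp: inK_def K_def)
    ultimately show ?thesis
      using card_coords_sum_le[OF indep_Q, of "image_mset (\<lambda>V. \<Sum>\<^sub># (inK V)) z"]
      by (auto simp: image_mset.compositionality comp_def)
  qed
  moreover have "2 * size z + (\<Sum>x\<in>#?BK. card (coords Q x)) + (\<Sum>V\<in>#z. card (coords Q (\<Sum>\<^sub># (inK V))))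
      \<le> 2 * size ?BK + 2 * zB"
  proof -
    have "2 * size z + (\<Sum>x\<in>#?BK. card (coords Q x)) + (\<Sum>V\<in>#z. card (coords Q (\<Sum>\<^sub># (inK V))))
        = (\<Sum>V\<in>#z. 2 + (\<Sum>x\<in>#inK V. card (coords Q x)) + card (coords Q (\<Sum>\<^sub># (inK V))))"
      unfolding BKz sum_sum_mset sum_mset.distrib by simp
    also have "\<dots> \<le> (\<Sum>V\<in>#z. 2 * size (inK V) + 2 * (if crossing V then 1 else 0))"
      by (intro sum_mset_mono crossing_weight) (simp_all add: inK_def)
    also have "\<dots> = 2 * (\<Sum>V\<in>#z. size (inK V)) + 2 * zB"
      unfolding zB_def size_filter_sum by (simp only: sum_mset.distrib sum_mset_distrib_left)
    also have "(\<Sum>V\<in>#z. size (inK V)) = size ?BK"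
      unfolding BKz by (induction z) auto
    finally show ?thesis .
  qed
  ultimately have "2 * size z \<le> card Q * (size A - 1) + 2 * zB" using fam by linarith
  moreover have "r * (size A - 1) = card Q * (size A - 1) + (size A - 1)"
    by (simp flip: card_Q)
  ultimately have zB: "size A + 1 \<le> 2 * zB" using many A(1) by (cases "size A") auto
  have "size (\<Sum>\<^sub># z) \<le> r * size A" unfolding B by (rule product_size_le[OF A(2,3)])
  moreover have "2 * size z + 2 * zB \<le> size (\<Sum>\<^sub># z) + zT"
  proof -
    have "2 * size z + 2 * zB = (\<Sum>V\<in>#z. 2 + 2 * (if crossing V then 1 else 0))"
      unfolding zB_def size_filter_sum sum_mset.distrib by (simp add: sum_mset_distrib_left)
    also have "\<dots> \<le> (\<Sum>V\<in>#z. size V + (if crossing V \<and> size V = 3 then 1 else 0))"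
    proof (rule sum_mset_mono)
      fix V assume V: "V \<in># z"
      from V show "2 + 2 * (if crossing V then 1 else 0)
          \<le> size V + (if crossing V \<and> size V = 3 then 1 else 0)"
      proof (cases rule: crossing_cases)
        case (inside x)
        then show ?thesis using min_zero_sum_size[OF atoms[OF V] no_zero[OF V]] by auto
      next
        case (outside x y)
        then have "card (coords Q (x + y)) \<noteq> 0"
          using K_coords(3)[OF outside_add[OF outside(1,2)]] by simp
        then show ?thesis using outside(3,5) by (auto simp: size_bridge)
      qed auto
    qed
    also have "\<dots> = size (\<Sum>\<^sub># z) + zT"
      unfolding zT_def size_filter_sum size_sum_mset by (simp add: sum_mset.distrib)
    finally show ?thesis .
  qed
  moreover have "r * size A = r * (size A - 1) + r" using A(1) by (cases "size A") auto
  ultimately have "2 \<le> zT" using zB many r by linarith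
  then obtain s t where st: "{#s, t#} \<subseteq># filter_mset (\<lambda>V. crossing V \<and> size V = 3) z"
    using two_members unfolding zT_def by blast
  have shape: "\<exists>x y. x \<in> G - K \<and> y \<in> G - K \<and> V = bridge x y \<and> x + y \<in> Q"
    if "V \<in># filter_mset (\<lambda>V. crossing V \<and> size V = 3) z" for V
  proof -
    have V: "V \<in># z" "crossing V" "size V = 3" using that by auto
    from V(1) show ?thesis
    proof (cases rule: crossing_cases)
      case (outside x y)
      note C = K_coords[OF outside_add[OF outside(1,2)]]
      have "card (coords Q (x + y)) = 1" using outside(3) V(3) by (simp add: size_bridge)
      then obtain h where "coords Q (x + y) = {h}" by (auto simp: card_1_singleton_iff)
      then have "x + y \<in> Q" using C by auto
      then show ?thesis using outside by blast
    qed (use V in auto)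
  qed
  have mem: "s \<in># filter_mset (\<lambda>V. crossing V \<and> size V = 3) z"
    "t \<in># filter_mset (\<lambda>V. crossing V \<and> size V = 3) z"
    using mset_subset_eqD[OF st] by auto
  obtain a a' where s: "a \<in> G - K" "a' \<in> G - K" "s = bridge a a'" "a + a' \<in> Q"
    using shape[OF mem(1)] by blast
  obtain x y where t: "x \<in> G - K" "y \<in> G - K" "t = bridge x y" "x + y \<in> Q"
    using shape[OF mem(2)] by blast
  have "{#bridge a a', bridge x y#} \<subseteq># z"
    using st s(3) t(3) multiset_filter_subset subset_mset.order_trans by blast
  from two_triples_good[OF this s(1,2) t(1,2) s(4) t(4)]
  obtain b where b: "b \<in> G - K" "\<And>V. V \<in># z \<Longrightarrow> \<not> bad b V" by blast
  have "2 * size z \<le> r * (size A - 1)"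
  proof (rule length_bound_if_light[OF B A])
    show "indep (insert b Q)" using outside_indep[of b Q] b by auto
    show "insert b Q \<subseteq> G" using b Q_sub_G by auto
    have "b \<notin> Q" using b Q_sub_K by auto
    then show "card (insert b Q) = r" using card_Q finite_Q by simp
    show "2 + (\<Sum>x\<in>#V. card (coords (insert b Q) x)) \<le> 2 * size V" if "V \<in># z" for V
      by (rule weight_of_good[OF b(1) that]) (use b(2)[OF that] in \<open>auto simp: bad_def\<close>)
  qed
  then show False using many by linarith
qed

end

context extremal_factorization
begin

text \<open>
  A factorization that is too long contains few long atoms, so that \<open>Q\<close> spans everything or a
  hyperplane. If it spans everything, every long atom is a circuit of \<open>Q\<close>, hence light.
\<close>

lemma extremal_bound:
  assumes B: "\<Sum>\<^sub># z = (\<Sum>X\<in>#A. mset_set X)" and A: "odd (size A)" "\<And>X. X \<in># A \<Longrightarrow> indep X"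
      "\<And>X. X \<in># A \<Longrightarrow> X \<subseteq> G" and r: "r \<le> size A"
  shows "2 * size z \<le> r * (size A - 1)"
proof (rule ccontr)
  assume neg: "\<not> ?thesis"
  moreover have "even (r * (size A - 1))" using A(1) by simp
  ultimately have many: "r * (size A - 1) + 2 \<le> 2 * size z" by presburger
  define s where "s = size (filter_mset (\<lambda>V. \<not> 3 \<le> size V) z)"
  define l where "l = size (filter_mset (\<lambda>V. 3 \<le> size V) z)"
  have sl: "size z = s + l"
    unfolding s_def l_def by (metis multiset_partition size_union add.commute)
  have "2 * count z {#x, x#} \<le> size A - 1" for x
  proof -
    have "2 * count z {#x, x#} \<le> count (\<Sum>X\<in>#A. mset_set X) x"
      using count_squares[of x] unfolding B .
    also have "\<dots> \<le> size A" by (induction A) (auto simp: count_mset_set')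
    finally show ?thesis using A(1) by presburger
  qed
  then have "(\<Sum>x\<in>Q. 2 * count z {#x, x#}) \<le> (\<Sum>x\<in>Q. size A - 1)" by (intro sum_mono)
  then have s: "2 * s \<le> card Q * (size A - 1)"
    unfolding s_def size_short by (simp add: sum_distrib_left)
  have "size (\<Sum>\<^sub># z) \<le> r * size A" unfolding B by (rule product_size_le[OF A(2,3)])
  moreover have "2 * size z + l \<le> size (\<Sum>\<^sub># z)"
  proof -
    have "2 * size z + l = (\<Sum>V\<in>#z. 2 + (if 3 \<le> size V then 1 else 0))"
      unfolding l_def size_filter_sum sum_mset.distrib by simp
    also have "\<dots> \<le> (\<Sum>V\<in>#z. size V)"
    proof (rule sum_mset_mono)
      fix V assume V: "V \<in># z"
      show "2 + (if 3 \<le> size V then 1 else 0) \<le> size V"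
        using min_zero_sum_size[OF atoms[OF V] no_zero[OF V]] by auto
    qed
    finally show ?thesis by (simp add: size_sum_mset)
  qed
  moreover have "r * size A = r * (size A - 1) + r" using A(1) by (cases "size A") auto
  ultimately have l: "l + 2 \<le> r" using many by linarith
  have "card Q \<le> r" by (rule indep_card_le[OF indep_Q Q_sub_G])
  then consider "card Q = r" | "Suc (card Q) = r" | "card Q + 2 \<le> r" by linarith
  then show False
  proof cases
    case 1
    have KG: "K = G" unfolding K_def by (rule subset_sums_eq_G[OF indep_Q Q_sub_G 1])
    have single: "card (coords Q x) = 1" if "x \<in> Q" for x
      using coords_member[OF indep_Q that] by simp
    have "2 * size z \<le> r * (size A - 1)"
    proof (rule length_bound_if_light[OF B A indep_Q Q_sub_G 1])
      fix V assume V: "V \<in># z"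
      show "2 + (\<Sum>x\<in>#V. card (coords Q x)) \<le> 2 * size V"
      proof (cases "3 \<le> size V")
        case True
        obtain x where x: "x \<in># V" "x \<notin> Q" using long_not_sub_Q[OF V True] by blast
        then have xK: "x \<in> K" using in_G[OF V] KG by auto
        have "(\<Sum>y\<in>#mset_set (coords Q x). card (coords Q y)) = card (coords Q x)"
          using K_coords(1)[OF xK] single by (simp add: subset_iff flip: sum_unfold_sum_mset)
        moreover note long_inside[OF V True x(1) xK x(2)]
        then have "size V = Suc (card (coords Q x))" "(\<Sum>y\<in>#V. card (coords Q y))
            = card (coords Q x) + (\<Sum>y\<in>#mset_set (coords Q x). card (coords Q y))"
          by (metis size_add_mset size_mset_set, metis image_mset_add_mset sum_mset.insert)
        ultimately show ?thesis by simp
      next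
        case False
        then show ?thesis using square_shape[OF V] single by auto
      qed
    qed
    then show False using neg by simp
  next
    case 2
    then interpret extremal_hyperplane G r z by unfold_locales
    show False using hyperplane_bound[OF B A r] neg by simp
  next
    case 3
    then have "(card Q + 2) * (size A - 1) \<le> r * (size A - 1)" by (rule mult_le_mono1)
    then have "card Q * (size A - 1) + 2 * (size A - 1) \<le> r * (size A - 1)"
      by (simp add: add_mult_distrib)
    moreover have "size A \<noteq> 0" using A(1) by (metis even_zero)
    ultimately show False using s sl many l r by linarith
  qed
qed

end

context elementary_2_space
begin

lemma extremal_exists:
  assumes B: "zero_sum (\<lambda>x. x) B" "set_mset B \<subseteq> G" "0 \<notin># B"
  shows "\<exists>z\<in>zs_factorizations (\<lambda>x. x) B. extremal_factorization G r z"
proof -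
  let ?F = "zs_factorizations (\<lambda>x. x) B"
  obtain z0 where "z0 \<in> ?F" using factorization_exists[OF B(1)] by blast
  then obtain z1 where z1: "z1 \<in> ?F" "\<And>w. w \<in> ?F \<Longrightarrow> size z1 \<le> size w"
    using ex_has_least_nat[of "\<lambda>z. z \<in> ?F" z0 size] by blast
  let ?P = "\<lambda>z. z \<in> ?F \<and> size z = size z1"
  have "long_count z < Suc (size z1)" if "?P z" for z
    using that size_filter_mset_lesseq[of _ z] by (simp add: long_count_def less_Suc_eq_le)
  then obtain z where z: "?P z" "\<And>w. ?P w \<Longrightarrow> long_count w \<le> long_count z"
    using ex_has_greatest_nat[of ?P z1 long_count "Suc (size z1)"] z1(1) by blast
  have "extremal_factorization G r z"
  proof
    fix V assume V: "V \<in># z"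
    show "min_zero_sum (\<lambda>x. x) V" using z(1) V by (simp add: zs_factorizations_def)
    have "V \<subseteq># B" using factorization_member_sub V z(1) by blast
    then show "set_mset V \<subseteq> G" "0 \<notin># V" using B set_mset_mono by blast+
  next
    fix y w assume y: "y \<subseteq># z" and w: "w \<in> zs_factorizations (\<lambda>x. x) (\<Sum>\<^sub># y)"
    obtain v where v: "z = y + v" using y by (metis subset_mset.add_diff_inverse)
    have wv: "w + v \<in> ?F" using w z(1) v by (auto simp: zs_factorizations_def)
    then have "size z \<le> size (w + v)" using z1(2)[OF wv] z(1) by simp
    moreover have "long_count w \<le> long_count y" if "size w = size y"
      using z(2)[of "w + v"] wv z(1) that v by (simp add: long_count_def)
    ultimately show "size y \<le> size w \<and> (size w = size y \<longrightarrow> long_count w \<le> long_count y)"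
      using v by simp
  qed
  then show ?thesis using z(1) by blast
qed

text \<open>
  As atoms have length at least 2, the bound \<open>r * size A\<close> is immediate. For an odd number of sets
  one of them can be saved, by the weight inequality applied to an extremal factorization.
\<close>

theorem odd_family_factorization:
  assumes A: "odd (size A)" "r \<le> size A" "\<And>X. X \<in># A \<Longrightarrow> indep X" "\<And>X. X \<in># A \<Longrightarrow> X \<subseteq> G"
    and B: "B = (\<Sum>X\<in>#A. mset_set X)" "zero_sum (\<lambda>x. x) B"
  shows "\<exists>w\<in>zs_factorizations (\<lambda>x. x) B. 2 * size w \<le> r * (size A - 1)"
proof -
  have mem: "\<exists>X\<in>#A. x \<in> X" if "x \<in># B" for x
  proof -
    have "x \<in># \<Sum>\<^sub># (image_mset mset_set A)" using that B(1) by simp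
    then obtain M where "M \<in># image_mset mset_set A" "x \<in># M" by (meson in_Union_mset_iff)
    then obtain X where X: "X \<in># A" "x \<in># mset_set X" by auto
    then show ?thesis using indep_finite[OF A(3)[OF X(1)]] by auto
  qed
  have "set_mset B \<subseteq> G" using mem A(4) by blast
  moreover have "0 \<notin># B" using mem A(3) indep_zero by metis
  ultimately obtain z where z: "z \<in> zs_factorizations (\<lambda>x. x) B" "extremal_factorization G r z"
    using extremal_exists[OF B(2)] by blast
  interpret extremal_factorization G r z by (rule z(2))
  have "\<Sum>\<^sub># z = (\<Sum>X\<in>#A. mset_set X)" using z(1) B(1) by (simp add: zs_factorizations_def)
  from extremal_bound[OF this A(1,3,4,2)] show ?thesis using z(1) by blast
qed

end

section \<open>Upper bounds for the tame degree\<close>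

text \<open>
  The condition that the tame degree is at most \<open>N\<close>, for the monoid of those sequences over \<open>P\<close>
  whose classes sum to zero.
\<close>

definition tame_bound :: "('p \<Rightarrow> 'v::ab_group_add) \<Rightarrow> 'p set \<Rightarrow> nat \<Rightarrow> bool"
  where "tame_bound c P N \<longleftrightarrow> (\<forall>b u. \<forall>z\<in>zs_factorizations c b. set_mset b \<subseteq> P \<longrightarrow>
    (\<exists>z'\<in>zs_factorizations c b. u \<in># z') \<longrightarrow>
    (\<exists>z'\<in>zs_factorizations c b. u \<in># z' \<and> fact_dist z z' \<le> N))"

lemma fact_dist_self [simp]: "fact_dist z z = 0"
  by (simp add: fact_dist_def)

lemma fact_dist_common: "fact_dist (v + x) (v + y) \<le> max (size x) (size y)"
proof -
  have "size (v + x - (v + x) \<inter># (v + y)) \<le> size x" "size (v + y - (v + x) \<inter># (v + y)) \<le> size y"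
  proof -
    have "v + x - (v + x) \<inter># (v + y) \<subseteq># x" "v + y - (v + x) \<inter># (v + y) \<subseteq># y"
      by (auto simp: subseteq_mset_def)
    then show "size (v + x - (v + x) \<inter># (v + y)) \<le> size x"
      "size (v + y - (v + x) \<inter># (v + y)) \<le> size y" by (simp_all add: size_mset_mono)
  qed
  then show ?thesis unfolding fact_dist_def by linarith
qed

lemma fact_dist_disjoint:
  assumes "\<And>x. x \<in># z \<Longrightarrow> x \<notin># z'"
  shows "fact_dist z z' = max (size z) (size z')"
proof -
  have "z \<inter># z' = {#}" using assms by (auto simp: disjunct_not_in)
  then show ?thesis by (simp add: fact_dist_def)
qed

lemma fact_dist_image: "fact_dist (image_mset f z) (image_mset f z') \<le> fact_dist z z'"
proof -
  have "z = z \<inter># z' + (z - z \<inter># z')" "z' = z \<inter># z' + (z' - z \<inter># z')"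
    by (metis subset_mset.add_diff_inverse subset_mset.inf_le1 subset_mset.inf_le2)+
  then have "image_mset f z = image_mset f (z \<inter># z') + image_mset f (z - z \<inter># z')"
    "image_mset f z' = image_mset f (z \<inter># z') + image_mset f (z' - z \<inter># z')"
    by (metis image_mset_union)+
  then show ?thesis using fact_dist_common unfolding fact_dist_def[of z z'] by (metis size_image_mset)
qed

lemma tame_bound_mono: "tame_bound c P N \<Longrightarrow> N \<le> M \<Longrightarrow> tame_bound c P M"
  unfolding tame_bound_def by (meson order_trans)

locale class_map = elementary_2_space G r
  for G :: "'v::ab_group_add set" and r :: nat +
  fixes P :: "'p set" and c :: "'p \<Rightarrow> 'v"
  assumes surj: "c ` P = G"
begin

text \<open>
  A minimal part of \<open>z\<close> whose product is divisible by \<open>u\<close>. Its atoms are written as \<open>fst q + snd q\<close>,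
  where the first components multiply to \<open>u\<close>; these are nonempty by minimality, so that the
  second components have independent classes.
\<close>

definition covering :: "'p multiset multiset \<Rightarrow> 'p multiset \<Rightarrow> ('p multiset \<times> 'p multiset) multiset \<Rightarrow> bool"
  where "covering z u p \<longleftrightarrow>
    image_mset (\<lambda>q. fst q + snd q) p \<subseteq># z \<and> (\<Sum>q\<in>#p. fst q) = u \<and>
    (\<forall>y. y \<subset># image_mset (\<lambda>q. fst q + snd q) p \<longrightarrow> \<not> u \<subseteq># \<Sum>\<^sub># y)"

abbreviation cofactor :: "('p multiset \<times> 'p multiset) multiset \<Rightarrow> 'p multiset"
  where "cofactor p \<equiv> \<Sum>q\<in>#p. snd q"

lemma covering_exists:
  assumes "u \<subseteq># \<Sum>\<^sub># z"
  shows "\<exists>p. covering z u p"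
proof -
  obtain y where y: "y \<subseteq># z \<and> u \<subseteq># \<Sum>\<^sub># y" "\<And>y'. y' \<subseteq># z \<and> u \<subseteq># \<Sum>\<^sub># y' \<Longrightarrow> size y \<le> size y'"
    using ex_has_least_nat[of "\<lambda>y. y \<subseteq># z \<and> u \<subseteq># \<Sum>\<^sub># y" z size] assms
    by (metis subset_mset.order_refl)
  then have "\<Sum>\<^sub># y = u + (\<Sum>\<^sub># y - u)" by simp
  then obtain p where p: "image_mset (\<lambda>q. fst q + snd q) p = y" "(\<Sum>q\<in>#p. fst q) = u"
    using sum_mset_split[of y u] by blast
  have "\<not> u \<subseteq># \<Sum>\<^sub># y'" if "y' \<subset># y" for y'
  proof
    assume "u \<subseteq># \<Sum>\<^sub># y'"
    moreover have "y' \<subseteq># z"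
      using that y(1) by (meson subset_mset.less_imp_le subset_mset.order_trans)
    ultimately have "size y \<le> size y'" using y(2) by blast
    then show False using mset_subset_size[OF that] by simp
  qed
  then show ?thesis unfolding covering_def using p y(1) by (intro exI[of _ p]) simp
qed

lemma covering_nonempty:
  assumes "covering z u p" "q \<in># p"
  shows "fst q \<noteq> {#}"
proof
  assume e: "fst q = {#}"
  obtain p' where p': "p = add_mset q p'" using multi_member_split[OF assms(2)] by blast
  let ?y = "image_mset (\<lambda>q. fst q + snd q) p'"
  have "?y \<subset># image_mset (\<lambda>q. fst q + snd q) p" unfolding p' by simp
  moreover have "u = (\<Sum>q\<in>#p'. fst q)" using assms(1) e by (simp add: covering_def p')
  then have "u \<subseteq># \<Sum>\<^sub># ?y" by (simp add: sum_mset.distrib)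
  ultimately show False using assms(1) unfolding covering_def by blast
qed

lemma covering_sum:
  assumes "covering z u p"
  shows "\<Sum>\<^sub># (image_mset (\<lambda>q. fst q + snd q) p) = u + cofactor p"
  using assms by (simp add: covering_def sum_mset.distrib)

context
  fixes z b u p
  assumes bP: "set_mset b \<subseteq> P" and z: "z \<in> zs_factorizations c b"
    and u: "min_zero_sum c u" and p: "covering z u p"
begin

lemma covering_atom:
  assumes "q \<in># p"
  shows "min_zero_sum c (fst q + snd q)" "set_mset (fst q + snd q) \<subseteq> P"
proof -
  have "fst q + snd q \<in># image_mset (\<lambda>q. fst q + snd q) p" using assms by auto
  then have qz: "fst q + snd q \<in># z" using p unfolding covering_def by (meson mset_subset_eqD)
  then show "min_zero_sum c (fst q + snd q)" using z by (simp add: zs_factorizations_def)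
  show "set_mset (fst q + snd q) \<subseteq> P"
    using set_mset_mono[OF factorization_member_sub[OF z qz]] bP by (rule order_trans)
qed

lemma covering_indep:
  assumes q: "q \<in># p"
  shows "image_mset c (snd q) = mset_set (c ` set_mset (snd q))" "indep (c ` set_mset (snd q))"
    "c ` set_mset (snd q) \<subseteq> G"
proof -
  have "min_zero_sum (\<lambda>x. x) (image_mset c (fst q + snd q))"
    using covering_atom(1)[OF q] min_zero_sum_image by blast
  moreover have "image_mset c (snd q) \<subset># image_mset c (fst q + snd q)"
    using covering_nonempty[OF p q] by (auto simp: subset_mset.less_le)
  ultimately show "image_mset c (snd q) = mset_set (c ` set_mset (snd q))"
    "indep (c ` set_mset (snd q))" using proper_sub_indep by (metis set_image_mset)+
  show "c ` set_mset (snd q) \<subseteq> G" using covering_atom(2)[OF q] surj by auto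
qed

lemma covering_size: "size p \<le> size u" "size u \<le> Suc r"
proof -
  have "size p \<le> (\<Sum>q\<in>#p. size (fst q))"
    using covering_nonempty[OF p] by (intro sum_mset_ge_size) (simp add: Suc_le_eq nonempty_has_size)
  also have "\<dots> = size (\<Sum>q\<in>#p. fst q)" by (induction p) auto
  also have "(\<Sum>q\<in>#p. fst q) = u" using p by (simp add: covering_def)
  finally show "size p \<le> size u" .
  have "u \<subseteq># \<Sum>\<^sub># (image_mset (\<lambda>q. fst q + snd q) p)" using covering_sum[OF p] by simp
  then have "set_mset u \<subseteq> P" using covering_atom(2) by (force dest: mset_subset_eqD)
  then have "set_mset (image_mset c u) \<subseteq> G" using surj by auto
  then show "size u \<le> Suc r"
    using min_zero_sum_size_le u min_zero_sum_image[of c u] by (metis size_image_mset)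
qed

lemma cofactor_zero_sum: "zero_sum c (cofactor p)"
proof -
  have "zero_sum c (u + cofactor p)"
    unfolding covering_sum[OF p, symmetric] using covering_atom(1)
    by (intro zero_sum_Union) (auto simp: min_zero_sum_def)
  then show ?thesis using u zero_sum_plus by (auto simp: min_zero_sum_def)
qed

lemma cofactor_image:
  "image_mset c (cofactor p) = (\<Sum>X\<in>#image_mset (\<lambda>q. c ` set_mset (snd q)) p. mset_set X)"
proof -
  have "image_mset c (cofactor p) = (\<Sum>q\<in>#p. image_mset c (snd q))" by (induction p) auto
  also have "\<dots> = (\<Sum>q\<in>#p. mset_set (c ` set_mset (snd q)))"
    using covering_indep(1) by (intro arg_cong[of _ _ sum_mset] image_mset_cong) auto
  finally show ?thesis by (simp add: image_mset.compositionality comp_def)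
qed

text \<open>
  The cofactor consists of at most \<open>r\<close> terms for each atom of the covering, and atoms without a
  term of class zero have length at least 2.
\<close>

lemma cofactor_factorization: "\<exists>w\<in>zs_factorizations c (cofactor p). 2 * size w \<le> r * size p"
proof -
  obtain w where w: "w \<in> zs_factorizations c (cofactor p)"
    using factorization_exists[OF cofactor_zero_sum] by blast
  have "0 \<notin># image_mset c (cofactor p)"
    using covering_indep(2) indep_zero by fastforce
  then have "2 * size (image_mset (image_mset c) w) \<le> size (image_mset c (cofactor p))"
    by (intro factorization_size_le factorization_image w)
  also have "\<dots> = (\<Sum>q\<in>#p. size (image_mset c (snd q)))" by (induction p) auto
  also have "\<dots> \<le> (\<Sum>q\<in>#p. r)"
    using indep_card_le covering_indep by (intro sum_mset_mono) (metis size_mset_set)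
  finally show ?thesis using w by (auto simp: mult.commute)
qed

lemma cofactor_factorization_odd:
  assumes "odd (size p)" "r \<le> size p"
  shows "\<exists>w\<in>zs_factorizations c (cofactor p). 2 * size w \<le> r * (size p - 1)"
proof -
  have "\<exists>w\<in>zs_factorizations (\<lambda>x. x) (image_mset c (cofactor p)).
      2 * size w \<le> r * (size (image_mset (\<lambda>q. c ` set_mset (snd q)) p) - 1)"
  proof (rule odd_family_factorization[OF _ _ _ _ cofactor_image])
    fix X assume "X \<in># image_mset (\<lambda>q. c ` set_mset (snd q)) p"
    then obtain q where "q \<in># p" "X = c ` set_mset (snd q)" by auto
    then show "indep X" "X \<subseteq> G" using covering_indep by blast+
  qed (use assms cofactor_zero_sum in \<open>simp_all flip: zero_sum_image\<close>)
  then obtain w where w: "w \<in> zs_factorizations (\<lambda>x. x) (image_mset c (cofactor p))"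
    "2 * size w \<le> r * (size p - 1)" by auto
  obtain w' where "w' \<in> zs_factorizations c (cofactor p)" "image_mset (image_mset c) w' = w"
    using factorization_lift[OF w(1)] by blast
  then show ?thesis using w(2) by (metis size_image_mset)
qed

text \<open>Replacing the covering by \<open>u\<close> and a factorization of the cofactor leaves the rest of \<open>z\<close> alone.\<close>

lemma covering_distance:
  assumes w: "w \<in> zs_factorizations c (cofactor p)" and N: "size p \<le> N" "Suc (size w) \<le> N"
  shows "\<exists>z'\<in>zs_factorizations c b. u \<in># z' \<and> fact_dist z z' \<le> N"
proof -
  let ?y = "image_mset (\<lambda>q. fst q + snd q) p"
  obtain v where v: "z = v + ?y"
    using p unfolding covering_def by (metis add.commute subset_mset.add_diff_inverse)
  have "fact_dist (v + ?y) (v + add_mset u w) \<le> max (size ?y) (size (add_mset u w))"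
    by (rule fact_dist_common)
  then have "fact_dist z (v + add_mset u w) \<le> N" using N v by simp
  moreover have "v + add_mset u w \<in> zs_factorizations c b"
    using z w u covering_sum[OF p] v by (auto simp: zs_factorizations_def)
  ultimately show ?thesis by (intro bexI[of _ "v + add_mset u w"]) auto
qed

end

lemma tame_boundI:
  assumes "\<And>b u z p. set_mset b \<subseteq> P \<Longrightarrow> z \<in> zs_factorizations c b \<Longrightarrow> min_zero_sum c u \<Longrightarrow>
    covering z u p \<Longrightarrow> u \<notin># z \<Longrightarrow>
    \<exists>w\<in>zs_factorizations c (cofactor p). size p \<le> N \<and> Suc (size w) \<le> N"
  shows "tame_bound c P N"
  unfolding tame_bound_def
proof (intro allI ballI impI)
  fix b u z
  assume z: "z \<in> zs_factorizations c b" and bP: "set_mset b \<subseteq> P"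
    and ex: "\<exists>z'\<in>zs_factorizations c b. u \<in># z'"
  show "\<exists>z'\<in>zs_factorizations c b. u \<in># z' \<and> fact_dist z z' \<le> N"
  proof (cases "u \<in># z")
    case True
    then show ?thesis using z by (intro bexI[of _ z]) auto
  next
    case False
    obtain z' where z': "z' \<in> zs_factorizations c b" "u \<in># z'" using ex by blast
    have u: "min_zero_sum c u" using z' by (simp add: zs_factorizations_def)
    have "u \<subseteq># b" by (rule factorization_member_sub[OF z'])
    then have "u \<subseteq># \<Sum>\<^sub># z" using z by (simp add: zs_factorizations_def)
    then obtain p where p: "covering z u p" using covering_exists by blast
    obtain w where "w \<in> zs_factorizations c (cofactor p)" "size p \<le> N" "Suc (size w) \<le> N"
      using assms[OF bP z u p False] by blast
    then show ?thesis by (intro covering_distance[OF bP z u p])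
  qed
qed

text \<open>
  For even rank either the covering has at most \<open>r\<close> atoms or it has the odd number \<open>r + 1\<close>; both
  give a cofactor with a factorization of length at most \<open>r * r / 2\<close>.
\<close>

lemma tame_bound_even:
  assumes "even r" "2 \<le> r"
  shows "tame_bound c P (1 + r ^ 2 div 2)"
proof (rule tame_boundI)
  fix b u z p
  assume *: "set_mset b \<subseteq> P" "z \<in> zs_factorizations c b" "min_zero_sum c u" "covering z u p"
  have n: "size p \<le> Suc r" using covering_size[OF *] by simp
  have "\<exists>w\<in>zs_factorizations c (cofactor p). 2 * size w \<le> r * r"
  proof (cases "size p = Suc r")
    case True
    then show ?thesis using cofactor_factorization_odd[OF *] assms by auto
  next
    case False
    then have "r * size p \<le> r * r" using n by simp
    then show ?thesis using cofactor_factorization[OF *] le_trans by blast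
  qed
  then obtain w where w: "w \<in> zs_factorizations c (cofactor p)" "2 * size w \<le> r * r" by blast
  have "2 * r \<le> r * r" using assms by simp
  then have "r \<le> r * r div 2" by linarith
  then have "size p \<le> 1 + r ^ 2 div 2" "Suc (size w) \<le> 1 + r ^ 2 div 2"
    using n w(2) by (auto simp: power2_eq_square)
  then show "\<exists>w\<in>zs_factorizations c (cofactor p). size p \<le> 1 + r\<^sup>2 div 2 \<and> Suc (size w) \<le> 1 + r\<^sup>2 div 2"
    using w(1) by blast
qed

lemma tame_bound_1:
  assumes "r = 1"
  shows "tame_bound c P 2"
proof (rule tame_boundI)
  fix b u z p
  assume *: "set_mset b \<subseteq> P" "z \<in> zs_factorizations c b" "min_zero_sum c u" "covering z u p"
  have n: "size p \<le> 2" using covering_size[OF *] assms by simp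
  obtain w where "w \<in> zs_factorizations c (cofactor p)" "2 * size w \<le> size p"
    using cofactor_factorization[OF *] assms by auto
  then show "\<exists>w\<in>zs_factorizations c (cofactor p). size p \<le> 2 \<and> Suc (size w) \<le> 2"
    using n by (intro bexI[of _ w]) auto
qed

lemma cofactor_bound_odd:
  assumes *: "set_mset b \<subseteq> P" "z \<in> zs_factorizations c b" "min_zero_sum c u" "covering z u p"
    and r: "odd r" and n: "size p \<le> r"
  shows "\<exists>w\<in>zs_factorizations c (cofactor p). 2 * size w \<le> r * (r - 1)"
proof (cases "size p = r")
  case True
  then show ?thesis using cofactor_factorization_odd[OF *] r by simp
next
  case False
  then have "r * size p \<le> r * (r - 1)" using n by (intro mult_le_mono2) simp
  then show ?thesis using cofactor_factorization[OF *] le_trans by blast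
qed

end

section \<open>Odd rank: transfer to zero-sum sequences over the group\<close>

text \<open>
  For odd rank only coverings by \<open>r + 1\<close> atoms exceed the bound \<open>r * (r - 1) / 2\<close> for the length of
  a factorization of the cofactor. Then every atom of the covering contains exactly one term of \<open>u\<close>,
  and two cases have to be distinguished, according to whether the classes of \<open>u\<close> are already
  covered by fewer atoms.
\<close>

context class_map
begin

definition redundant :: "('p multiset \<times> 'p multiset) multiset \<Rightarrow> bool"
  where "redundant p \<longleftrightarrow> (\<exists>q q' p' x. p = add_mset q (add_mset q' p') \<and> fst q' = {#x#} \<and>
    c x \<in> c ` set_mset (snd q))"

context
  fixes z b u p
  assumes bP: "set_mset b \<subseteq> P" and z: "z \<in> zs_factorizations c b"
    and u: "min_zero_sum c u" and p: "covering z u p" and n: "size p = Suc r"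
begin

lemma full_covering_single: "q \<in># p \<Longrightarrow> \<exists>x. fst q = {#x#}"
proof -
  assume q: "q \<in># p"
  have ge: "1 \<le> size (fst q)" if "q \<in># p" for q
    using covering_nonempty[OF p that] by (simp add: Suc_le_eq nonempty_has_size)
  have fu: "(\<Sum>q\<in>#p. fst q) = u" using p by (simp add: covering_def)
  have "(\<Sum>q\<in>#p. size (fst q)) = size (\<Sum>q\<in>#p. fst q)" by (induction p) auto
  also have "\<dots> = size u" by (simp only: fu)
  finally have "(\<Sum>q\<in>#p. size (fst q)) = size p"
    using covering_size[OF bP z u p] n by simp
  then have "size (fst q) = 1" by (intro sum_mset_eq_size[OF ge _ q])
  then show ?thesis by (rule size_1_singleton_mset)
qed

lemma full_covering_distinct:
  assumes r: "2 \<le> r" and "p = add_mset q (add_mset q' p')" "fst q = {#x#}" "fst q' = {#x'#}"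
  shows "c x \<noteq> c x'"
proof
  assume eq: "c x = c x'"
  have "u = {#x, x'#} + (\<Sum>q\<in>#p'. fst q)" using p assms by (simp add: covering_def add_mset_commute)
  then have "2 \<le> count (image_mset c u) (c x)" using eq by simp
  moreover have "size u = Suc r" using covering_size[OF bP z u p] n by simp
  then have "image_mset c u = mset_set (set_mset (image_mset c u))"
    using min_zero_sum_distinct[of "image_mset c u"] u r min_zero_sum_image[of c u] by simp
  then have "count (image_mset c u) (c x) \<le> 1"
    by (metis count_mset_set' le_refl zero_le_one)
  ultimately show False by simp
qed

text \<open>
  If the class of a term \<open>x\<close> of \<open>u\<close> reappears in the cofactor of another atom, then the whole
  class sequence of the atom covering \<open>x\<close> divides the class sequence of the cofactor, and
  what remains is a product of \<open>r\<close> independent sets.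
\<close>

lemma redundant_bound:
  assumes r: "odd r" and red: "redundant p"
  shows "\<exists>w\<in>zs_factorizations c (cofactor p). 2 * size w \<le> 2 + r * (r - 1)"
proof -
  obtain q q' p' x where pq: "p = add_mset q (add_mset q' p')" and x: "fst q' = {#x#}"
    and cx: "c x \<in> c ` set_mset (snd q)" using red unfolding redundant_def by blast
  have mem: "q \<in># p" "q' \<in># p" and mem': "\<And>s. s \<in># p' \<Longrightarrow> s \<in># p" using pq by auto
  let ?C = "\<lambda>q. c ` set_mset (snd q)"
  let ?A = "add_mset (?C q - {c x}) (image_mset ?C p')"
  let ?B = "\<Sum>X\<in>#?A. mset_set X"
  let ?a = "image_mset c (fst q' + snd q')"
  note ind = covering_indep[OF bP z u p]
  have "image_mset c (snd q) = add_mset (c x) (mset_set (?C q - {c x}))"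
    using ind(1)[OF mem(1)] cx by (simp add: mset_set.remove)
  moreover have "(\<Sum>q\<in>#p'. image_mset c (snd q)) = (\<Sum>q\<in>#p'. mset_set (?C q))"
    using ind(1) mem' by (intro arg_cong[of _ _ sum_mset] image_mset_cong) auto
  moreover have "image_mset c (cofactor s) = (\<Sum>q\<in>#s. image_mset c (snd q))" for s
    by (induction s) auto
  ultimately have split: "image_mset c (cofactor p) = ?a + ?B"
    unfolding pq x by (simp add: image_mset.compositionality comp_def)
  have a: "min_zero_sum (\<lambda>x. x) ?a"
    using covering_atom(1)[OF bP z u p mem(2)] min_zero_sum_image by blast
  have "zero_sum (\<lambda>x. x) (?a + ?B)"
    using cofactor_zero_sum[OF bP z u p] unfolding split[symmetric] by (simp flip: zero_sum_image)
  then have B: "zero_sum (\<lambda>x. x) ?B" using a zero_sum_plus by (auto simp: min_zero_sum_def)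
  have size: "size ?A = r" using n pq by simp
  have "\<exists>w\<in>zs_factorizations (\<lambda>x. x) ?B. 2 * size w \<le> r * (size ?A - 1)"
  proof (rule odd_family_factorization[OF _ _ _ _ refl B])
    fix X assume "X \<in># ?A"
    then have "X = ?C q - {c x} \<or> X \<in> ?C ` set_mset p'" by simp
    then obtain s where s: "s \<in># p" "X \<subseteq> ?C s" using mem(1) mem' by blast
    show "indep X" by (rule indep_subset[OF ind(2)[OF s(1)] s(2)])
    show "X \<subseteq> G" using ind(3)[OF s(1)] s(2) by (rule order_trans[rotated])
  qed (use size r in auto)
  then obtain w where w: "w \<in> zs_factorizations (\<lambda>x. x) ?B" "2 * size w \<le> r * (r - 1)"
    unfolding size by blast
  have "{#?a#} + w \<in> zs_factorizations (\<lambda>x. x) (image_mset c (cofactor p))"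
    unfolding split by (rule factorizations_plus[OF factorizations_single[OF a] w(1)])
  then obtain w' where "w' \<in> zs_factorizations c (cofactor p)"
    "image_mset (image_mset c) w' = {#?a#} + w" using factorization_lift by blast
  moreover from this have "size w' = Suc (size w)"
    by (metis add_mset_add_single size_add_mset size_image_mset union_commute)
  ultimately show ?thesis using w(2) by (intro bexI[of _ w']) auto
qed

text \<open>
  Otherwise no atom of the covering survives, on the level of classes, in a factorization that
  contains \<open>u\<close>, so that the distance between the two is the maximum of their lengths.
\<close>

lemma nonredundant_transfer:
  assumes r: "2 \<le> r" and nonred: "\<not> redundant p" and N: "tame_bound (\<lambda>x. x) G N"
  shows "\<exists>w\<in>zs_factorizations c (cofactor p). size p \<le> N \<and> Suc (size w) \<le> N"
proof -
  let ?f = "\<lambda>q. fst q + snd q"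
  let ?z = "image_mset (image_mset c) (image_mset ?f p)"
  let ?b = "image_mset c (u + cofactor p)"
  let ?u = "image_mset c u"
  have "image_mset ?f p \<in> zs_factorizations c (u + cofactor p)"
    using covering_atom(1)[OF bP z u p] covering_sum[OF p] by (auto simp: zs_factorizations_def)
  then have zb: "?z \<in> zs_factorizations (\<lambda>x. x) ?b" by (rule factorization_image)
  have "set_mset (u + cofactor p) \<subseteq> P"
    unfolding covering_sum[OF p, symmetric] using covering_atom(2)[OF bP z u p] by fastforce
  then have bG: "set_mset ?b \<subseteq> G" using surj by auto
  obtain w1 where "w1 \<in> zs_factorizations c (cofactor p)"
    using factorization_exists[OF cofactor_zero_sum[OF bP z u p]] by blast
  then have "{#u#} + w1 \<in> zs_factorizations c (u + cofactor p)"
    by (rule factorizations_plus[OF factorizations_single[OF u]])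
  then have "image_mset (image_mset c) ({#u#} + w1) \<in> zs_factorizations (\<lambda>x. x) ?b"
    by (rule factorization_image)
  then have "\<exists>z'\<in>zs_factorizations (\<lambda>x. x) ?b. ?u \<in># z'" by (rule bexI[rotated]) simp
  then obtain z' where z': "z' \<in> zs_factorizations (\<lambda>x. x) ?b" "?u \<in># z'" "fact_dist ?z z' \<le> N"
    using N[unfolded tame_bound_def, rule_format, OF zb bG] by blast
  obtain w where w: "z' = add_mset ?u w" using multi_member_split[OF z'(2)] by blast
  have wF: "w \<in> zs_factorizations (\<lambda>x. x) (image_mset c (cofactor p))"
    using z'(1) unfolding w by (simp add: zs_factorizations_def)
  have disjoint: "v \<notin># z'" if v: "v \<in># ?z" for v
  proof
    assume vz: "v \<in># z'"
    obtain q where q: "q \<in># p" "v = image_mset c (?f q)" using v by auto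
    obtain p1 where p1: "p = add_mset q p1" using multi_member_split[OF q(1)] by blast
    obtain x where x: "fst q = {#x#}" using full_covering_single[OF q(1)] by blast
    have "v = ?u \<or> v \<in># w" using vz w by auto
    then show False
    proof
      assume vu: "v = ?u"
      obtain q' p' where p': "p1 = add_mset q' p'" using n r p1 by (cases p1) auto
      obtain x' where x': "fst q' = {#x'#}" using full_covering_single[of q'] p1 p' by auto
      have "u = {#x, x'#} + (\<Sum>q\<in>#p'. fst q)" using p p1 p' x x' by (simp add: covering_def add_mset_commute)
      then have "c x' \<in># v" using vu by simp
      moreover have "c x \<noteq> c x'" using full_covering_distinct[OF r _ x x'] p1 p' by simp
      ultimately have "c x' \<in> c ` set_mset (snd q)" using q(2) x by auto
      then show False using nonred x' p1 p' unfolding redundant_def by blast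
    next
      assume "v \<in># w"
      then obtain w' where "w = add_mset v w'" using multi_member_split by metis
      then have "?b = ?u + (v + \<Sum>\<^sub># w')" using z'(1) w by (simp add: zs_factorizations_def)
      moreover have "?b = v + \<Sum>\<^sub># (image_mset (image_mset c) (image_mset ?f p1))"
        using zb q(2) p1 by (simp add: zs_factorizations_def)
      ultimately have "?u + \<Sum>\<^sub># w' = \<Sum>\<^sub># (image_mset (image_mset c) (image_mset ?f p1))"
        by (metis add.left_commute add_left_cancel)
      moreover have "c x \<in># ?u"
        using p p1 x by (auto simp: covering_def)
      ultimately have "c x \<in># \<Sum>\<^sub># (image_mset (image_mset c) (image_mset ?f p1))"
        by (metis union_iff)
      then obtain s where s: "s \<in># image_mset (image_mset c) (image_mset ?f p1)" "c x \<in># s"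
        by (meson in_Union_mset_iff)
      then obtain q' where q': "q' \<in># p1" "c x \<in># image_mset c (?f q')" by auto
      obtain p' where p': "p1 = add_mset q' p'" using multi_member_split[OF q'(1)] by blast
      obtain x' where x': "fst q' = {#x'#}" using full_covering_single[of q'] p1 p' by auto
      have "c x \<noteq> c x'" using full_covering_distinct[OF r _ x x'] p1 p' by simp
      then have "c x \<in> c ` set_mset (snd q')" using q'(2) x' by auto
      moreover have "p = add_mset q' (add_mset q p')" using p1 p' by (simp add: add_mset_commute)
      ultimately show False using nonred x unfolding redundant_def by blast
    qed
  qed
  have "fact_dist ?z z' = max (size ?z) (size z')" by (rule fact_dist_disjoint) (rule disjoint)
  then have le: "size p \<le> N" "Suc (size w) \<le> N" using z'(3) w by auto
  obtain w' where "w' \<in> zs_factorizations c (cofactor p)" "image_mset (image_mset c) w' = w"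
    using factorization_lift[OF wF] by blast
  then show ?thesis using le by (intro bexI[of _ w']) auto
qed

end

text \<open>
  Hence for odd rank any bound on the tame degree over the class group that is not smaller than
  the bound in the redundant case also holds for the Krull monoid.
\<close>

lemma tame_bound_transfer:
  assumes r: "odd r" "3 \<le> r" and N: "2 + r * (r - 1) div 2 \<le> N" "tame_bound (\<lambda>x. x) G N"
  shows "tame_bound c P N"
proof (rule tame_boundI)
  fix b u z p
  assume *: "set_mset b \<subseteq> P" "z \<in> zs_factorizations c b" "min_zero_sum c u" "covering z u p"
  have n: "size p \<le> Suc r" using covering_size[OF *] by simp
  have "2 * (r - 1) \<le> r * (r - 1)" using r by simp
  then have "r - 1 \<le> r * (r - 1) div 2" by linarith
  then have rN: "Suc r \<le> N" using N(1) r(2) by linarith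
  have fin: "\<exists>w\<in>zs_factorizations c (cofactor p). size p \<le> N \<and> Suc (size w) \<le> N"
    if w: "\<exists>w\<in>zs_factorizations c (cofactor p). 2 * size w \<le> 2 + r * (r - 1)"
  proof -
    obtain w where "w \<in> zs_factorizations c (cofactor p)" "2 * size w \<le> 2 + r * (r - 1)"
      using w by blast
    moreover from this(2) have "Suc (size w) \<le> N" using N(1) by linarith
    ultimately show ?thesis using n rN by (intro bexI[of _ w]) auto
  qed
  show "\<exists>w\<in>zs_factorizations c (cofactor p). size p \<le> N \<and> Suc (size w) \<le> N"
  proof (cases "size p = Suc r")
    case False
    then have "size p \<le> r" using n by simp
    then obtain w where "w \<in> zs_factorizations c (cofactor p)" "2 * size w \<le> r * (r - 1)"
      using cofactor_bound_odd[OF * r(1)] by blast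
    then show ?thesis by (intro fin bexI[of _ w]) auto
  next
    case True
    then show ?thesis
      using fin redundant_bound[OF * True r(1)] nonredundant_transfer[OF * True _ _ N(2)] r(2)
      by (cases "redundant p") auto
  qed
qed

text \<open>Choosing one prime in every class embeds the sequences over the group.\<close>

lemma tame_bound_restrict:
  assumes N: "tame_bound c P N"
  shows "tame_bound (\<lambda>x. x) G N"
  unfolding tame_bound_def
proof (intro allI ballI impI)
  fix b u z
  assume z: "z \<in> zs_factorizations (\<lambda>x. x) b" and bG: "set_mset b \<subseteq> G"
    and ex: "\<exists>z'\<in>zs_factorizations (\<lambda>x. x) b. u \<in># z'"
  define s where "s = inv_into P c"
  have s: "s g \<in> P \<and> c (s g) = g" if "g \<in> G" for g
    using that unfolding s_def surj[symmetric] by (simp add: inv_into_into f_inv_into_f)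
  have cs: "image_mset c (image_mset s a) = a" if "a \<subseteq># b" for a
  proof -
    have "image_mset c (image_mset s a) = image_mset (\<lambda>g. g) a"
      unfolding image_mset.compositionality comp_def
      using s bG mset_subset_eqD[OF that] by (intro image_mset_cong) blast
    then show ?thesis by simp
  qed
  have lift: "image_mset (image_mset s) y \<in> zs_factorizations c (image_mset s b)"
    and unlift: "image_mset (image_mset c) (image_mset (image_mset s) y) = y"
    if y: "y \<in> zs_factorizations (\<lambda>x. x) b" for y
  proof -
    have sub: "v \<subseteq># b" if "v \<in># y" for v by (rule factorization_member_sub[OF y that])
    then have "min_zero_sum c (image_mset s v)" if "v \<in># y" for v
      using y that cs[OF sub[OF that]] min_zero_sum_image[of c "image_mset s v"]
      by (simp add: zs_factorizations_def)
    moreover have "\<Sum>\<^sub># (image_mset (image_mset s) y) = image_mset s (\<Sum>\<^sub># y)"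
      by (induction y) auto
    ultimately show "image_mset (image_mset s) y \<in> zs_factorizations c (image_mset s b)"
      using y by (auto simp: zs_factorizations_def)
    have "image_mset (image_mset c) (image_mset (image_mset s) y) = image_mset (\<lambda>v. v) y"
      unfolding image_mset.compositionality comp_def
      using cs sub by (intro image_mset_cong) (simp add: image_mset.compositionality comp_def)
    then show "image_mset (image_mset c) (image_mset (image_mset s) y) = y" by simp
  qed
  obtain z0 where z0: "z0 \<in> zs_factorizations (\<lambda>x. x) b" "u \<in># z0" using ex by blast
  have "\<exists>z'\<in>zs_factorizations c (image_mset s b). image_mset s u \<in># z'"
    using lift[OF z0(1)] z0(2) by (intro bexI[of _ "image_mset (image_mset s) z0"]) auto
  moreover have "set_mset (image_mset s b) \<subseteq> P" using s bG by auto
  ultimately obtain z' where z': "z' \<in> zs_factorizations c (image_mset s b)"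
    "image_mset s u \<in># z'" "fact_dist (image_mset (image_mset s) z) z' \<le> N"
    using N[unfolded tame_bound_def, rule_format, OF lift[OF z]] by blast
  have ub: "u \<subseteq># b" by (rule factorization_member_sub[OF z0])
  have "image_mset (image_mset c) z' \<in> zs_factorizations (\<lambda>x. x) b"
    using factorization_image[OF z'(1)] cs[of b] by simp
  moreover have "image_mset c (image_mset s u) \<in># image_mset (image_mset c) z'" using z'(2) by (simp only: set_image_mset imageI)
  then have "u \<in># image_mset (image_mset c) z'" by (simp only: cs[OF ub])
  moreover have "fact_dist z (image_mset (image_mset c) z') \<le> N"
    using fact_dist_image[of "image_mset c" "image_mset (image_mset s) z" z'] z'(3) unlift[OF z]
    by simp
  ultimately show "\<exists>z'\<in>zs_factorizations (\<lambda>x. x) b. u \<in># z' \<and> fact_dist z z' \<le> N" by blast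
qed

end

section \<open>Sequences over groups of rank one and three\<close>

context elementary_2_space
begin

lemma sum_constant_double: "(\<Sum>v\<in>C. x) = (if even (card C) then 0 else (x::'v))"
  by (induction C rule: infinite_finite_induct) (auto simp: double)

text \<open>
  In rank three the four terms of an atom of length four and their pairwise sums exhaust the
  nonzero elements. If \<open>C\<close> avoids the basis \<open>Y\<close> and \<open>\<Sum>Y\<close>, all its members are sums \<open>\<Sum>Y + y\<close>
  with \<open>y\<close> in \<open>Y\<close>, and a parity argument excludes that they sum to \<open>\<Sum>Y\<close>.
\<close>

lemma rank_three_singleton:
  assumes r: "r = 3" and Y: "indep Y" "Y \<subseteq> G" "card Y = 3"
    and C: "indep C" "C \<subseteq> G" "C \<inter> Y = {}" "\<Sum>C = \<Sum>Y"
  shows "C = {\<Sum>Y}"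
proof (cases "\<Sum>Y \<in> C")
  case True
  then have "\<Sum>(C - {\<Sum>Y}) = 0"
    using C(4) indep_finite[OF C(1)] by (simp add: sum.remove)
  then have "C - {\<Sum>Y} = {}" using C(1) unfolding indep_def by blast
  then show ?thesis using True by blast
next
  case False
  have GY: "subset_sums Y = G" using subset_sums_eq_G[OF Y(1,2)] Y(3) r by simp
  have finY: "finite Y" using Y(1) indep_finite by blast
  have shift: "v + \<Sum>Y \<in> Y" if v: "v \<in> C" for v
  proof -
    obtain S where S: "S \<subseteq> Y" "v = \<Sum>S" using v C(2) GY by (auto simp: subset_sums_def)
    have finS: "finite S" using S finY finite_subset by blast
    have "card S \<noteq> 0" using S finS indep_zero[OF C(1)] v by auto
    moreover have "card S \<noteq> 1" using S v C(3) by (auto simp: card_1_singleton_iff)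
    moreover have "S \<noteq> Y" using S v False by auto
    then have "card S < 3" using S(1) finY Y(3) psubset_card_mono[of Y S] by auto
    ultimately have "card S = 2" by linarith
    then have "card (Y - S) = 1" using S(1) finS Y(3) by (simp add: card_Diff_subset)
    then obtain y where y: "Y - S = {y}" by (auto simp: card_1_singleton_iff)
    have "v + \<Sum>Y = \<Sum>(Y - S)"
      using sum.subset_diff[OF S(1) finY, of "\<lambda>x. x"] S(2) by (metis add.commute add_double(1))
    then show ?thesis using y by auto
  qed
  let ?Y = "(\<lambda>v. v + \<Sum>Y) ` C"
  have inj: "inj_on (\<lambda>v. v + \<Sum>Y) C" by (simp add: inj_on_def)
  have sub: "?Y \<subseteq> Y" using shift by auto
  have "\<Sum>?Y = (\<Sum>v\<in>C. v + \<Sum>Y)" by (simp add: sum.reindex[OF inj])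
  also have "\<dots> = \<Sum>Y + (\<Sum>v\<in>C. \<Sum>Y)" by (simp add: sum.distrib C(4))
  finally have sum: "\<Sum>?Y = \<Sum>Y + (if even (card C) then 0 else \<Sum>Y)"
    by (simp only: sum_constant_double)
  have "card ?Y = card C" using card_image[OF inj] .
  show ?thesis
  proof (cases "even (card C)")
    case True
    then have "?Y = Y" using sum indep_sum_inj[OF Y(1) sub] by simp
    then show ?thesis using True Y(3) \<open>card ?Y = card C\<close> by simp
  next
    case False
    then have "?Y = {}" using sum double indep_sum_inj[OF Y(1) sub, of "{}"] by simp
    then show ?thesis using False by simp
  qed
qed

lemma class_map_self: "class_map G r G (\<lambda>x. x)"
  by unfold_locales simp

text \<open>
  Over the group itself an irredundant covering by four atoms consists of the squares of the
  terms of \<open>u\<close>, with cofactor \<open>u\<close>. This is why the group of rank three has a smaller tame degree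
  than Krull monoids with two primes in some nontrivial class.
\<close>

lemma tame_bound_group_3:
  assumes r: "r = 3"
  shows "tame_bound (\<lambda>x. x) G 4"
proof -
  interpret self: class_map G r G "\<lambda>x. x" by (rule class_map_self)
  show ?thesis
  proof (rule self.tame_boundI)
    fix b u z p
    assume *: "set_mset b \<subseteq> G" "z \<in> zs_factorizations (\<lambda>x. x) b" "min_zero_sum (\<lambda>x. x) u"
      "self.covering z u p"
    have n: "size p \<le> 4" using self.covering_size[OF *] r by simp
    show "\<exists>w\<in>zs_factorizations (\<lambda>x. x) (self.cofactor p). size p \<le> 4 \<and> Suc (size w) \<le> 4"
    proof (cases "size p = 4")
      case False
      then obtain w where "w \<in> zs_factorizations (\<lambda>x. x) (self.cofactor p)" "2 * size w \<le> r * (r - 1)"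
        using self.cofactor_bound_odd[OF *] n r by auto
      then show ?thesis using n r by (intro bexI[of _ w]) auto
    next
      case True
      then have full: "size p = Suc r" using r by simp
      have fu: "(\<Sum>q\<in>#p. fst q) = u" using *(4) by (simp add: self.covering_def)
      have su: "size u = 4" using self.covering_size[OF *] True r by simp
      then have us: "u = mset_set (set_mset u)" using min_zero_sum_distinct[OF *(3)] by simp
      \<comment> \<open>Primes and classes coincide here, so a repeated class would make an atom superfluous.\<close>
      have nonred: "x \<notin># snd q" if "p = add_mset q (add_mset q' p')" "fst q' = {#x#}" for q q' p' x
      proof
        assume xq: "x \<in># snd q"
        let ?y = "image_mset (\<lambda>q. fst q + snd q) (add_mset q p')"
        have "?y \<subset># image_mset (\<lambda>q. fst q + snd q) p" unfolding that(1) by simp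
        moreover have "u \<subseteq># \<Sum>\<^sub># ?y"
        proof -
          have "u = fst q + {#x#} + (\<Sum>q\<in>#p'. fst q)" using fu that by simp
          also have "\<dots> \<subseteq># fst q + snd q + (\<Sum>q\<in>#p'. fst q + snd q)"
            using xq by (intro subset_mset.add_mono) (simp_all add: sum_mset.distrib)
          finally show ?thesis by simp
        qed
        ultimately show False using *(4) unfolding self.covering_def by blast
      qed
      have diag: "snd q = fst q" if q: "q \<in># p" for q
      proof -
        obtain x where x: "fst q = {#x#}" using self.full_covering_single[OF * full q] by blast
        obtain p1 where p1: "p = add_mset q p1" using multi_member_split[OF q] by blast
        have ux: "u = add_mset x (\<Sum>q\<in>#p1. fst q)" using fu p1 x by simp
        then have "(\<Sum>q\<in>#p1. fst q) \<subset># u" by simp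
        note Y = proper_sub_indep[OF *(3) this]
        define Y where "Y = set_mset (\<Sum>q\<in>#p1. fst q)"
        have Ym: "(\<Sum>q\<in>#p1. fst q) = mset_set Y" using Y(1) by (simp only: Y_def)
        have "\<Sum>\<^sub># u = 0" using *(3) by (simp add: min_zero_sum_def zero_sum_id)
        then have sumY: "\<Sum>Y = x" using ux Ym by (simp add: sum_mset_mset_set add_eq_0_iff)
        have "card Y = 3" using su ux Ym by simp
        note ind = self.covering_indep[OF * q]
        have sub: "u \<subseteq># \<Sum>\<^sub># (image_mset (\<lambda>q. fst q + snd q) p)" using self.covering_sum[OF *(4)] by simp
        have "set_mset u \<subseteq> G" using self.covering_atom(2)[OF *] mset_subset_eqD[OF sub] by fastforce
        then have YG: "Y \<subseteq> G" using ux by (auto simp: Y_def)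
        have sq: "snd q = mset_set (set_mset (snd q))" using ind(1) by simp
        have "\<Sum>\<^sub># (fst q + snd q) = 0"
          using self.covering_atom(1)[OF * q] by (simp add: min_zero_sum_def zero_sum_id)
        then have "\<Sum>\<^sub># (snd q) = x" using x by (simp add: add_eq_0_iff)
        moreover have "\<Sum>\<^sub># (snd q) = \<Sum>(set_mset (snd q))"
          using sum_mset_mset_set[of "set_mset (snd q)"] by (simp only: sq[symmetric])
        ultimately have sum_q: "\<Sum>(set_mset (snd q)) = \<Sum>Y" using sumY by simp
        have "set_mset (snd q) \<inter> Y = {}"
        proof (rule ccontr)
          assume "set_mset (snd q) \<inter> Y \<noteq> {}"
          then obtain y where y: "y \<in># snd q" "y \<in># (\<Sum>q\<in>#p1. fst q)" by (auto simp: Y_def)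
          then obtain q' where q': "q' \<in># p1" "y \<in># fst q'" by auto
          obtain p' where "p1 = add_mset q' p'" using multi_member_split[OF q'(1)] by blast
          moreover have "fst q' = {#y#}" using self.full_covering_single[OF * full, of q'] q' p1 by auto
          ultimately show False using nonred p1 y(1) by blast
        qed
        then have "set_mset (snd q) = {\<Sum>Y}"
          using rank_three_singleton[OF r _ YG \<open>card Y = 3\<close> _ _ _ sum_q] ind Y(2) by (simp add: Y_def)
        then show ?thesis using sq x sumY by simp
      qed
      have "self.cofactor p = u"
        unfolding fu[symmetric] using diag by (intro arg_cong[of _ _ sum_mset] image_mset_cong) auto
      then have "{#u#} \<in> zs_factorizations (\<lambda>x. x) (self.cofactor p)"
        using factorizations_single[OF *(3)] by simp
      then show ?thesis using True by (intro bexI[of _ "{#u#}"]) auto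
    qed
  qed
qed

text \<open>Over a group of order two all factorizations are unique, so \<open>u\<close> already occurs in \<open>z\<close>.\<close>

lemma tame_bound_group_1:
  assumes r: "r = 1"
  shows "tame_bound (\<lambda>x. x) G 0"
  unfolding tame_bound_def
proof (intro allI ballI impI)
  fix b u z
  assume z: "z \<in> zs_factorizations (\<lambda>x. x) b" and bG: "set_mset b \<subseteq> G"
    and ex: "\<exists>z'\<in>zs_factorizations (\<lambda>x. x) b. u \<in># z'"
  obtain z' where z': "z' \<in> zs_factorizations (\<lambda>x. x) b" "u \<in># z'" using ex by blast
  have u: "min_zero_sum (\<lambda>x. x) u" using z' by (simp add: zs_factorizations_def)
  have ub: "u \<subseteq># b" by (rule factorization_member_sub[OF z'])
  obtain x where x: "x \<in># u" using u by (auto simp: min_zero_sum_def)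
  have "x \<in># \<Sum>\<^sub># z" using mset_subset_eqD[OF ub x] z by (simp add: zs_factorizations_def)
  then obtain V where V: "V \<in># z" "x \<in># V" by (meson in_Union_mset_iff)
  have Vat: "min_zero_sum (\<lambda>x. x) V" using V z by (simp add: zs_factorizations_def)
  have Vb: "V \<subseteq># b" by (rule factorization_member_sub[OF z V(1)])
  have shape: "W = {#x, x#}"
    if W: "min_zero_sum (\<lambda>x. x) W" "W \<subseteq># b" "x \<in># W" and x0: "x \<noteq> 0" for W
  proof -
    have WG: "set_mset W \<subseteq> G" using set_mset_mono[OF W(2)] bG by (rule order_trans)
    have "0 \<notin># W" using min_zero_sum_zero[OF W(1), of 0] W(3) x0 by auto
    moreover have "size W \<le> 2" using min_zero_sum_size_le[OF W(1) WG] r by simp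
    ultimately show ?thesis using min_zero_sum_size[OF W(1)] W(3) by auto
  qed
  have "V = u"
  proof (cases "x = 0")
    case True
    then show ?thesis
      using min_zero_sum_zero[OF u x] min_zero_sum_zero[OF Vat V(2)] by simp
  next
    case False
    then show ?thesis using shape[OF u ub x] shape[OF Vat Vb V(2)] by simp
  qed
  then show "\<exists>z'\<in>zs_factorizations (\<lambda>x. x) b. u \<in># z' \<and> fact_dist z z' \<le> 0"
    using z V(1) by (intro bexI[of _ z]) auto
qed

end

section \<open>Lower bounds for the tame degree\<close>

context elementary_2_space
begin

lemma basis_extension:
  assumes "indep X" "X \<subseteq> G"
  shows "\<exists>Y. X \<subseteq> Y \<and> Y \<subseteq> G \<and> indep Y \<and> card Y = r"
  using assms
proof (induction "r - card X" arbitrary: X)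
  case 0
  then have "card X = r" using indep_card_le[of X] by simp
  then show ?case using 0 by blast
next
  case (Suc n)
  then have lt: "card X < r" by simp
  have "card (subset_sums X) < card G"
    using card_subset_sums[OF Suc.prems(1)] lt by (simp add: card_G)
  then obtain x where x: "x \<in> G" "x \<notin> subset_sums X"
    using subset_sums_in_G[OF Suc.prems(2)] by (metis order_less_irrefl subsetI subset_antisym)
  then have "x \<notin> X" using subset_sums_superset by blast
  then have "card (insert x X) = Suc (card X)" using indep_finite[OF Suc.prems(1)] by simp
  then have "n = r - card (insert x X)" using Suc.hyps(2) by simp
  from Suc.hyps(1)[OF this indep_insert[OF Suc.prems(1) x(2)]] Suc.prems(2) x(1)
  show ?case by auto
qed

lemma basis_enumeration:
  assumes "indep X" "X \<subseteq> G"
  obtains e where "inj_on e {..<r}" "indep (e ` {..<r})" "X \<subseteq> e ` {..<r}" "e ` {..<r} \<subseteq> G"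
proof -
  obtain Y where Y: "X \<subseteq> Y" "Y \<subseteq> G" "indep Y" "card Y = r"
    using basis_extension[OF assms] by blast
  obtain e where "bij_betw e {0..<r} Y"
    using ex_bij_betw_nat_finite[OF indep_finite[OF Y(3)]] Y(4) by auto
  then show ?thesis using that[of e] Y by (auto simp: bij_betw_def atLeast0LessThan)
qed

text \<open>
  Rows \<open>J i\<close> of a 0-1-matrix are read as vectors in a basis \<open>e\<close>. Vanishing of a sum of rows
  is a parity condition on every column.
\<close>

lemma row_sum_zero_iff:
  assumes e: "inj_on e {..<r}" "indep (e ` {..<r})" and fin: "finite S"
    and J: "\<And>i. i \<in> S \<Longrightarrow> J i \<subseteq> {..<r}"
  shows "(\<Sum>i\<in>S. \<Sum>j\<in>J i. e j) = (0::'v) \<longleftrightarrow> (\<forall>j<r. even (card {i \<in> S. j \<in> J i}))"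
proof -
  let ?O = "{j \<in> {..<r}. odd (card {i \<in> S. j \<in> J i})}"
  have "(\<Sum>i\<in>S. \<Sum>j\<in>J i. e j) = (\<Sum>i\<in>S. \<Sum>j\<in>{j \<in> {..<r}. j \<in> J i}. e j)"
    using J by (intro sum.cong) auto
  also have "\<dots> = (\<Sum>j<r. \<Sum>i\<in>{i \<in> S. j \<in> J i}. e j)"
    by (rule sum.swap_restrict) (use fin in auto)
  also have "\<dots> = (\<Sum>j<r. if odd (card {i \<in> S. j \<in> J i}) then e j else 0)"
    by (intro sum.cong) (simp_all add: sum_constant_double)
  also have "\<dots> = (\<Sum>j\<in>?O. e j)" by (rule sum.inter_filter[symmetric]) simp
  also have "\<dots> = \<Sum>(e ` ?O)"
    using e(1) by (subst sum.reindex) (auto intro: inj_on_subset)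
  finally have eq: "(\<Sum>i\<in>S. \<Sum>j\<in>J i. e j) = \<Sum>(e ` ?O)" .
  have sub: "e ` ?O \<subseteq> e ` {..<r}" by auto
  have "\<Sum>(e ` ?O) = 0 \<longleftrightarrow> e ` ?O = {}"
  proof
    assume "\<Sum>(e ` ?O) = 0"
    then show "e ` ?O = {}" using indep_sum_inj[OF e(2) sub, of "{}"] by simp
  qed (simp only: sum.empty)
  then show ?thesis unfolding eq by auto
qed

lemma min_zero_sum_rows:
  fixes J :: "nat \<Rightarrow> nat set"
  assumes e: "inj_on e {..<r}" "indep (e ` {..<r})" and m: "1 \<le> m"
    and J: "\<And>i. i \<le> m \<Longrightarrow> J i \<subseteq> {..<r}"
    and columns: "\<And>j. j < r \<Longrightarrow> even (card {i \<in> {..m}. j \<in> J i})"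
    and rows: "\<And>S. S \<subseteq> {1..m} \<Longrightarrow> (\<forall>j<r. even (card {i \<in> S. j \<in> J i})) \<Longrightarrow> S = {}"
  shows "min_zero_sum (\<lambda>x. x) (image_mset (\<lambda>i. \<Sum>j\<in>J i. e j :: 'v) (mset_set {..m}))"
proof -
  let ?v = "\<lambda>i. \<Sum>j\<in>J i. e j"
  have zero: "S = {}" if S: "S \<subseteq> {1..m}" "(\<Sum>i\<in>S. ?v i) = 0" for S
  proof (rule rows[OF S(1)])
    have "finite S" by (rule finite_subset[OF S(1)]) simp
    moreover have "J i \<subseteq> {..<r}" if "i \<in> S" for i
      by (rule J) (use that S(1) in auto)
    ultimately show "\<forall>j<r. even (card {i \<in> S. j \<in> J i})"
      using row_sum_zero_iff[OF e, of S J] S(2) by blast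
  qed
  have inj: "inj_on ?v {1..m}"
  proof (rule inj_onI, rule ccontr)
    fix i k assume "i \<in> {1..m}" "k \<in> {1..m}" "?v i = ?v k" "i \<noteq> k"
    then show False using zero[of "{i, k}"] by (simp add: double)
  qed
  have ind: "indep (?v ` {1..m})"
    unfolding indep_def
  proof (intro conjI allI impI)
    fix Y assume Y: "Y \<subseteq> ?v ` {1..m}" "\<Sum>Y = 0"
    obtain S where S: "S \<subseteq> {1..m}" "Y = ?v ` S" using Y(1) by (meson subset_imageE)
    have "(\<Sum>i\<in>S. ?v i) = \<Sum>Y"
      unfolding S(2) using inj_on_subset[OF inj S(1)] by (simp add: sum.reindex)
    then show "Y = {}" using zero[OF S(1)] Y(2) S(2) by simp
  qed simp
  have all: "{..m} = insert 0 {1..m}" by auto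
  have "(\<Sum>i\<le>m. ?v i) = 0"
    using row_sum_zero_iff[OF e, of "{..m}" J] J columns by auto
  then have "?v 0 + (\<Sum>i\<in>{1..m}. ?v i) = 0" unfolding all by simp
  then have "\<Sum>(?v ` {1..m}) = ?v 0" using inj by (simp add: sum.reindex add_eq_0_iff)
  then have "min_zero_sum (\<lambda>x. x) (add_mset (?v 0) (mset_set (?v ` {1..m})))"
    using m by (intro min_zero_sum_insert[OF ind]) auto
  moreover have "image_mset ?v (mset_set {..m}) = add_mset (?v 0) (mset_set (?v ` {1..m}))"
    unfolding all using image_mset_mset_set[OF inj] by simp
  ultimately show ?thesis by simp
qed

end

lemma rows_columns:
  fixes J :: "nat \<Rightarrow> nat set"
  assumes "\<And>i. i \<le> m \<Longrightarrow> J i \<subseteq> {..<r}"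
  shows "(\<Sum>i\<le>m. card (J i)) = (\<Sum>j<r. card {i \<in> {..m}. j \<in> J i})"
proof -
  have "(\<Sum>i\<le>m. card (J i)) = (\<Sum>i\<le>m. \<Sum>j\<in>{j \<in> {..<r}. j \<in> J i}. 1)"
    using assms by (intro sum.cong) (auto intro: arg_cong[of _ _ card])
  also have "\<dots> = (\<Sum>j<r. \<Sum>i\<in>{i \<in> {..m}. j \<in> J i}. 1)"
    by (rule sum.swap_restrict) auto
  finally show ?thesis by simp
qed

context class_map
begin

text \<open>
  An atom without repeated terms would be a zero-sum subset of the independent set.
\<close>

lemma independent_support_squares:
  assumes S: "inj_on c S" "indep (c ` S)" and d: "set_mset d \<subseteq> S"
    and w: "w \<in> zs_factorizations c d" and V: "V \<in># w"
  shows "\<exists>x\<in>S. V = {#x, x#}"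
proof -
  have Vat: "min_zero_sum c V" using w V by (simp add: zs_factorizations_def)
  have VS: "set_mset V \<subseteq> S"
    using set_mset_mono[OF factorization_member_sub[OF w V]] d by (rule order_trans)
  have "\<exists>x. 2 \<le> count V x"
  proof (rule ccontr)
    assume "\<nexists>x. 2 \<le> count V x"
    then have "count V x \<le> 1" for x by (metis not_less_eq_eq one_add_one plus_1_eq_Suc)
    then have Vm: "V = mset_set (set_mset V)" by (rule mset_set_set_mset_eqI)
    have "image_mset c V = mset_set (c ` set_mset V)"
      using image_mset_mset_set[OF inj_on_subset[OF S(1) VS]] Vm by simp
    moreover have "\<Sum>\<^sub># (image_mset c V) = 0" using Vat by (simp add: min_zero_sum_def zero_sum_def)
    ultimately have "\<Sum>(c ` set_mset V) = 0" by (simp add: sum_mset_mset_set)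
    moreover have "c ` set_mset V \<subseteq> c ` S" using VS by auto
    ultimately have "c ` set_mset V = {}" using S(2) unfolding indep_def by blast
    then show False using Vat by (simp add: min_zero_sum_def)
  qed
  then obtain x where x: "2 \<le> count V x" by blast
  then have "{#x, x#} \<subseteq># V" by (simp add: subseteq_mset_def)
  moreover have "zero_sum c {#x, x#}" by (simp add: zero_sum_pair)
  ultimately have "V = {#x, x#}" using Vat unfolding min_zero_sum_def by fastforce
  moreover have "x \<in># V" using x by (metis count_greater_zero_iff less_le_trans pos2)
  ultimately show ?thesis using VS by blast
qed

text \<open>
  If the cofactor \<open>d\<close> of \<open>u\<close> is supported on independent classes, only one factorization contains
  \<open>u\<close>, and it consists of \<open>u\<close> and \<open>|d| / 2\<close> squares.
\<close>

lemma lower_bound: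
  assumes z: "z \<in> zs_factorizations c b" and bP: "set_mset b \<subseteq> P" and u: "min_zero_sum c u"
    and b: "b = u + d"
    and S: "inj_on c S" "indep (c ` S)" and d: "set_mset d \<subseteq> S"
    and uz: "u \<notin># z" and squares: "\<And>x. x \<in> S \<Longrightarrow> {#x, x#} \<notin># z"
    and N: "2 * N < 2 + size d"
  shows "\<not> tame_bound c P N"
proof
  assume tb: "tame_bound c P N"
  have "zero_sum c (u + d)"
    using z zero_sum_Union[of z c] b by (auto simp: zs_factorizations_def min_zero_sum_def)
  then have "zero_sum c d" using u zero_sum_plus by (auto simp: min_zero_sum_def)
  then obtain w0 where "w0 \<in> zs_factorizations c d" using factorization_exists by blast
  then have "{#u#} + w0 \<in> zs_factorizations c b"
    unfolding b by (rule factorizations_plus[OF factorizations_single[OF u]])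
  then have "\<exists>z'\<in>zs_factorizations c b. u \<in># z'" by (rule bexI[rotated]) simp
  then obtain z' where z': "z' \<in> zs_factorizations c b" "u \<in># z'" "fact_dist z z' \<le> N"
    using tb[unfolded tame_bound_def, rule_format, OF z bP] by blast
  obtain w where w: "z' = add_mset u w" using multi_member_split[OF z'(2)] by blast
  have wF: "w \<in> zs_factorizations c d" using z'(1) w b by (simp add: zs_factorizations_def)
  have sq: "\<exists>x\<in>S. V = {#x, x#}" if "V \<in># w" for V
    by (rule independent_support_squares[OF S d wF that])
  have "size d = (\<Sum>V\<in>#w. size V)"
    using wF by (simp add: zs_factorizations_def flip: size_sum_mset)
  also have "\<dots> = (\<Sum>V\<in>#w. 2)"
    using sq by (intro arg_cong[of _ _ sum_mset] image_mset_cong) force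
  finally have "size d = 2 * size w" by simp
  moreover have "fact_dist z z' = max (size z) (size z')"
  proof (rule fact_dist_disjoint)
    fix V assume "V \<in># z"
    then show "V \<notin># z'" using w uz squares sq by auto
  qed
  ultimately show False using N z'(3) w by simp
qed

text \<open>
  The family of examples: the atoms of \<open>z\<close> are the rows of a matrix, each augmented by a prime in
  the class of its sum, and \<open>u\<close> is the product of these additional primes.
\<close>

lemma matrix_lower_bound:
  fixes h g :: "nat \<Rightarrow> 'p" and J :: "nat \<Rightarrow> nat set"
  assumes h: "\<And>j. j < r \<Longrightarrow> h j \<in> P" "inj_on (\<lambda>j. c (h j)) {..<r}" "indep ((\<lambda>j. c (h j)) ` {..<r})"
    and g: "\<And>i. i \<le> m \<Longrightarrow> g i \<in> P" "\<And>i. i \<le> m \<Longrightarrow> g i \<notin> h ` {..<r}"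
      "\<And>i. i \<le> m \<Longrightarrow> c (g i) = (\<Sum>j\<in>J i. c (h j))"
    and m: "1 \<le> m" and J: "\<And>i. i \<le> m \<Longrightarrow> J i \<subseteq> {..<r}" "\<And>i. i \<le> m \<Longrightarrow> J i \<noteq> {}"
    and columns: "\<And>j. j < r \<Longrightarrow> even (card {i \<in> {..m}. j \<in> J i})"
    and rows: "\<And>S. S \<subseteq> {1..m} \<Longrightarrow> (\<forall>j<r. even (card {i \<in> S. j \<in> J i})) \<Longrightarrow> S = {}"
    and N: "2 * N < 2 + (\<Sum>j<r. card {i \<in> {..m}. j \<in> J i})"
  shows "\<not> tame_bound c P N"
proof -
  have injh: "inj_on h {..<r}" using h(2) by (auto simp: inj_on_def)
  have inj_c: "inj_on c (h ` {..<r})" using h(2) by (auto simp: inj_on_def)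
  have ind: "indep (c ` h ` {..<r})" using h(3) by (simp add: image_image)
  let ?a = "\<lambda>i. add_mset (g i) (mset_set (h ` J i))"
  let ?z = "image_mset ?a (mset_set {..m})"
  let ?u = "image_mset g (mset_set {..m})"
  let ?d = "\<Sum>i\<in>#mset_set {..m}. mset_set (h ` J i)"
  have finJ: "finite (J i)" if "i \<le> m" for i using J(1)[OF that] finite_subset by blast
  have hJ: "h ` J i \<subseteq> h ` {..<r}" if "i \<le> m" for i using J(1)[OF that] by blast
  have atom: "min_zero_sum c (?a i)" if i: "i \<le> m" for i
  proof -
    have im: "image_mset c (mset_set (h ` J i)) = mset_set (c ` h ` J i)"
      by (rule image_mset_mset_set[OF inj_on_subset[OF inj_c hJ[OF i]]])
    have "\<Sum>(c ` h ` J i) = (\<Sum>j\<in>J i. c (h j))"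
      unfolding image_image using inj_on_subset[OF h(2) J(1)[OF i]] by (simp add: sum.reindex)
    then have "min_zero_sum (\<lambda>x. x) (add_mset (c (g i)) (mset_set (c ` h ` J i)))"
      using g(3)[OF i] J(2)[OF i] hJ[OF i]
      by (intro min_zero_sum_insert indep_subset[OF ind]) auto
    then show ?thesis unfolding min_zero_sum_image[of c] by (simp add: im)
  qed
  have "min_zero_sum (\<lambda>x. x) (image_mset (\<lambda>i. \<Sum>j\<in>J i. c (h j)) (mset_set {..m}))"
    by (rule min_zero_sum_rows[OF h(2,3) m J(1) columns rows])
  moreover have "image_mset c ?u = image_mset (\<lambda>i. \<Sum>j\<in>J i. c (h j)) (mset_set {..m})"
    unfolding image_mset.compositionality comp_def using g(3) by (intro image_mset_cong) simp
  ultimately have u: "min_zero_sum c ?u" unfolding min_zero_sum_image[of c] by simp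
  have sum_z: "\<Sum>\<^sub># ?z = ?u + ?d"
  proof -
    have "(\<Sum>i\<in>#M. ?a i) = image_mset g M + (\<Sum>i\<in>#M. mset_set (h ` J i))" for M
      by (induction M) auto
    then show ?thesis .
  qed
  have member_d: "set_mset ?d \<subseteq> h ` {..<r}"
  proof
    fix x assume "x \<in># ?d"
    then obtain i where "i \<in># mset_set {..m}" "x \<in># mset_set (h ` J i)" by auto
    then show "x \<in> h ` {..<r}" using hJ[of i] finJ[of i] by auto
  qed
  have size_d: "size ?d = (\<Sum>j<r. card {i \<in> {..m}. j \<in> J i})"
  proof -
    have "size ?d = (\<Sum>i\<in>#mset_set {..m}. card (h ` J i))"
      unfolding size_sum_mset image_mset.compositionality comp_def by simp
    also have "\<dots> = (\<Sum>i\<le>m. card (h ` J i))" by (simp add: sum_unfold_sum_mset)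
    also have "\<dots> = (\<Sum>i\<le>m. card (J i))"
      using card_image[OF inj_on_subset[OF injh J(1)]] by (intro sum.cong) auto
    finally show ?thesis using rows_columns[of m J r] J(1) by simp
  qed
  show ?thesis
  proof (rule lower_bound[OF _ _ u sum_z inj_c ind member_d])
    show "?z \<in> zs_factorizations c (\<Sum>\<^sub># ?z)" using atom by (auto simp: zs_factorizations_def)
    have "set_mset ?u \<subseteq> P" using g(1) by auto
    moreover have "set_mset ?d \<subseteq> P" by (rule order_trans[OF member_d]) (use h(1) in auto)
    ultimately show "set_mset (\<Sum>\<^sub># ?z) \<subseteq> P"
      unfolding sum_z set_mset_union by (rule Un_least)
    show "?u \<notin># ?z"
    proof
      assume "?u \<in># ?z"
      then obtain i where i: "i \<le> m" "?u = ?a i" by auto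
      obtain j where j: "j \<in> J i" using J(2)[OF i(1)] by blast
      have "h j \<in># ?a i" using j finJ[OF i(1)] by simp
      then have "h j \<in># ?u" by (simp only: i(2))
      then obtain k where "k \<le> m" "h j = g k" by auto
      then show False using g(2)[of k] j J(1)[OF i(1)] by (metis image_eqI subsetD)
    qed
    show "{#x, x#} \<notin># ?z" if x: "x \<in> h ` {..<r}" for x
    proof
      assume "{#x, x#} \<in># ?z"
      then obtain i where i: "i \<le> m" "{#x, x#} = ?a i" by auto
      have "g i \<in># ?a i" by simp
      then have "g i \<in># {#x, x#}" by (simp only: i(2))
      then show False using g(2)[OF i(1)] x by auto
    qed
    show "2 * N < 2 + size ?d" using N size_d by simp
  qed
qed

end

context class_map
begin

definition prime_in :: "'v \<Rightarrow> 'p"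
  where "prime_in = inv_into P c"

lemma prime_in: "v \<in> G \<Longrightarrow> prime_in v \<in> P" "v \<in> G \<Longrightarrow> c (prime_in v) = v"
  unfolding prime_in_def surj[symmetric] by (simp_all add: inv_into_into f_inv_into_f)

lemma row_eq_unit:
  assumes e: "inj_on e {..<r}" "indep (e ` {..<r})" and J: "J \<subseteq> {..<r}" "j < r"
    and eq: "(\<Sum>k\<in>J. e k) = (e j :: 'v)"
  shows "J = {j}"
proof -
  have "\<Sum>(e ` J) = \<Sum>(e ` {j})" using eq inj_on_subset[OF e(1) J(1)] by (simp add: sum.reindex)
  then have "e ` J = e ` {j}" using J by (intro indep_sum_inj[OF e(2)]) auto
  then show ?thesis using inj_on_image_eq_iff[OF e(1) J(1), of "{j}"] J(2) by simp
qed

text \<open>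
  If no row is a unit vector, the class of \<open>g i\<close> differs from that of every \<open>h j\<close>, and one prime in
  each class is enough.
\<close>

lemma matrix_lower_bound_no_unit:
  fixes J :: "nat \<Rightarrow> nat set"
  assumes m: "1 \<le> m" and Jr: "\<And>i. J i \<subseteq> {..<r}" and ne: "\<And>i. J i \<noteq> {}"
    and unit: "\<And>i j. J i \<noteq> {j}"
    and columns: "\<And>j. j < r \<Longrightarrow> even (card {i \<in> {..m}. j \<in> J i})"
    and rows: "\<And>S. S \<subseteq> {1..m} \<Longrightarrow> (\<forall>j<r. even (card {i \<in> S. j \<in> J i})) \<Longrightarrow> S = {}"
    and N: "2 * N < 2 + (\<Sum>j<r. card {i \<in> {..m}. j \<in> J i})"
  shows "\<not> tame_bound c P N"
proof -
  obtain e where e: "inj_on e {..<r}" "indep (e ` {..<r})" "e ` {..<r} \<subseteq> G"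
    using basis_enumeration[of "{}"] by (auto simp: indep_def)
  have vG: "(\<Sum>j\<in>J i. e j) \<in> G" for i
    using sum_in_G[of "e ` J i"] e(3) Jr inj_on_subset[OF e(1) Jr] by (force simp: sum.reindex)
  have eG: "e j \<in> G" if "j < r" for j using e(3) that by auto
  have ce: "c (prime_in (e j)) = e j" if "j < r" for j by (rule prime_in(2)[OF eG[OF that]])
  show ?thesis
  proof (rule matrix_lower_bound[where J = J and m = m and h = "\<lambda>j. prime_in (e j)"
        and g = "\<lambda>i. prime_in (\<Sum>j\<in>J i. e j)", OF _ _ _ _ _ _ m Jr ne columns rows N])
    show "prime_in (e j) \<in> P" if "j < r" for j by (rule prime_in(1)[OF eG[OF that]])
    show "inj_on (\<lambda>j. c (prime_in (e j))) {..<r}"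
      using e(1) ce by (simp add: inj_on_def)
    have "(\<lambda>j. c (prime_in (e j))) ` {..<r} = e ` {..<r}" using ce by (auto simp: image_def)
    then show "indep ((\<lambda>j. c (prime_in (e j))) ` {..<r})" using e(2) by simp
    fix i
    show "prime_in (\<Sum>j\<in>J i. e j) \<in> P" by (rule prime_in(1)[OF vG])
    have "(\<Sum>j\<in>J i. e j) = (\<Sum>j\<in>J i. c (prime_in (e j)))"
      by (rule sum.cong[OF refl]) (use ce Jr[of i] in \<open>metis lessThan_iff subsetD\<close>)
    then show "c (prime_in (\<Sum>j\<in>J i. e j)) = (\<Sum>j\<in>J i. c (prime_in (e j)))"
      unfolding prime_in(2)[OF vG] .
    show "prime_in (\<Sum>j\<in>J i. e j) \<notin> (\<lambda>j. prime_in (e j)) ` {..<r}"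
    proof
      assume "prime_in (\<Sum>j\<in>J i. e j) \<in> (\<lambda>j. prime_in (e j)) ` {..<r}"
      then obtain j where j: "j < r" "prime_in (\<Sum>j\<in>J i. e j) = prime_in (e j)" by auto
      then have "(\<Sum>j\<in>J i. e j) = e j" using prime_in(2)[OF vG[of i]] ce by metis
      then show False using row_eq_unit[OF e(1,2) Jr j(1)] unit by blast
    qed
  qed
qed

text \<open>
  For even rank the rows are \<open>1 \<dots> 1\<close> and its modifications by one zero; every column has
  the largest even number \<open>r\<close> of ones.
\<close>

lemma tame_bound_even_lower_4:
  assumes r: "even r" "4 \<le> r"
  shows "\<not> tame_bound c P (r ^ 2 div 2)"
proof -
  define J where "J i = {j \<in> {..<r}. Suc j \<noteq> i}" for i
  have column: "card {i \<in> {..r}. j \<in> J i} = r" if "j < r" for j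
  proof -
    have "{i \<in> {..r}. j \<in> J i} = {..r} - {Suc j}" using that by (auto simp: J_def)
    then show ?thesis using that by simp
  qed
  show ?thesis
  proof (rule matrix_lower_bound_no_unit[where J = J and m = r])
    show "1 \<le> r" using r by simp
    show "J i \<subseteq> {..<r}" for i by (auto simp: J_def)
    show "J i \<noteq> {j}" for i j
    proof -
      have "card ({..<r} - {i - 1}) \<ge> 3" using r(2) by (cases "i - 1 < r") auto
      also have "card ({..<r} - {i - 1}) \<le> card (J i)"
        by (rule card_mono) (auto simp: J_def)
      finally show ?thesis by auto
    qed
    have "0 \<in> J i \<or> 1 \<in> J i" for i using r(2) by (auto simp: J_def)
    then show "J i \<noteq> {}" for i by blast
    show "even (card {i \<in> {..r}. j \<in> J i})" if "j < r" for j using column[OF that] r by simp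
    show "2 * (r\<^sup>2 div 2) < 2 + (\<Sum>j<r. card {i \<in> {..r}. j \<in> J i})"
      using column by (simp add: power2_eq_square)
    fix S assume S: "S \<subseteq> {1..r}" "\<forall>j<r. even (card {i \<in> S. j \<in> J i})"
    have fin: "finite S" by (rule finite_subset[OF S(1)]) simp
    have ev: "even (card (S - {k}))" if k: "k \<in> {1..r}" for k
    proof -
      have "k - 1 < r" "Suc (k - 1) = k" using k by auto
      then have "{i \<in> S. k - 1 \<in> J i} = S - {k}" by (auto simp: J_def)
      then show ?thesis using S(2) \<open>k - 1 < r\<close> by metis
    qed
    show "S = {}"
    proof (rule ccontr)
      assume "S \<noteq> {}"
      then obtain k where k: "k \<in> S" by blast
      have "odd (card S)"
        using ev[of k] k S(1) fin by (metis card_Suc_Diff1 even_Suc subsetD)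
      moreover have "S = {1..r}"
      proof (rule ccontr)
        assume "S \<noteq> {1..r}"
        then obtain l where "l \<in> {1..r}" "l \<notin> S" using S(1) by blast
        then show False using ev[of l] \<open>odd (card S)\<close> by simp
      qed
      ultimately show False using r by simp
    qed
  qed
qed

text \<open>
  For odd rank one column may consist of ones only, and a second such column is impossible, as the
  \<open>g i\<close> would lie in a proper subgroup. The other columns have two zeros each, which are
  placed along the edges of a path with an odd number of vertices, plus an isolated vertex.
\<close>

definition odd_row :: "nat \<Rightarrow> nat set"
  where "odd_row i = {j \<in> {..<r}. j = 0 \<or> i = 0 \<or> (j \<noteq> i \<and> Suc j \<noteq> i)}"

context
  assumes r: "odd r" "3 \<le> r"
begin

lemma odd_row_sub: "odd_row i \<subseteq> {..<r}"
  by (auto simp: odd_row_def)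

lemma odd_row_zero: "0 \<in> odd_row i"
  using r by (auto simp: odd_row_def)

lemma odd_row_column: "j < r \<Longrightarrow> card {i \<in> {..r}. j \<in> odd_row i} = (if j = 0 then Suc r else r - 1)"
proof -
  assume j: "j < r"
  have "{i \<in> {..r}. j \<in> odd_row i} = (if j = 0 then {..r} else {..r} - {j, Suc j})"
    using j r by (auto simp: odd_row_def)
  then show ?thesis using j by simp
qed

lemma odd_row_columns:
  "j < r \<Longrightarrow> even (card {i \<in> {..r}. j \<in> odd_row i})"
  "2 * (1 + r * (r - 1) div 2) < 2 + (\<Sum>j<r. card {i \<in> {..r}. j \<in> odd_row i})"
proof -
  show "even (card {i \<in> {..r}. j \<in> odd_row i})" if "j < r" using odd_row_column[OF that] r by simp
  have r0: "0 < r" using r by simp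
  have "{..<r} = insert 0 {1..<r}" using r0 by auto
  then have "(\<Sum>j<r. card {i \<in> {..r}. j \<in> odd_row i})
      = Suc r + (\<Sum>j\<in>{1..<r}. card {i \<in> {..r}. j \<in> odd_row i})" using odd_row_column[OF r0] by simp
  also have "(\<Sum>j\<in>{1..<r}. card {i \<in> {..r}. j \<in> odd_row i}) = (\<Sum>j\<in>{1..<r}. r - 1)"
    using odd_row_column by (intro sum.cong) auto
  finally have "(\<Sum>j<r. card {i \<in> {..r}. j \<in> odd_row i}) = Suc r + (r - 1) * (r - 1)" by simp
  moreover have "r * (r - 1) = (r - 1) * (r - 1) + (r - 1)"
    using r0 by (metis Suc_diff_1 add.commute mult_Suc)
  moreover have "2 * (1 + x div 2) < 2 + (Suc r + y)" if "x = y + (r - 1)" for x y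
    using r0 that times_div_less_eq_dividend[of 2 x] by simp
  ultimately show "2 * (1 + r * (r - 1) div 2) < 2 + (\<Sum>j<r. card {i \<in> {..r}. j \<in> odd_row i})"
    by metis
qed

lemma odd_row_rows:
  assumes S: "S \<subseteq> {1..r}" "\<forall>j<r. even (card {i \<in> S. j \<in> odd_row i})"
  shows "S = {}"
proof -
  have r0: "0 < r" using r by simp
  have fin: "finite S" by (rule finite_subset[OF S(1)]) simp
  have "{i \<in> S. 0 \<in> odd_row i} = S" using odd_row_zero by auto
  then have evS: "even (card S)" using S(2) r0 by metis
  have step: "j \<in> S \<longleftrightarrow> Suc j \<in> S" if j: "1 \<le> j" "j < r" for j
  proof -
    have "{i \<in> S. j \<in> odd_row i} = S - {j, Suc j}" using j S(1) by (auto simp: odd_row_def)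
    then have "even (card (S - {j, Suc j}))" using S(2) j by metis
    moreover have "card S = card (S - {j, Suc j}) + card (S \<inter> {j, Suc j})"
      using fin by (metis card_Diff_subset_Int card_mono finite_Int inf_le1 le_add_diff_inverse2)
    ultimately have "even (card (S \<inter> {j, Suc j}))" using evS by simp
    then show ?thesis by (cases "j \<in> S"; cases "Suc j \<in> S") auto
  qed
  have all: "1 \<le> k \<Longrightarrow> k \<le> r \<Longrightarrow> k \<in> S \<longleftrightarrow> 1 \<in> S" for k
  proof (induction k rule: nat_induct_at_least)
    case (Suc k)
    then show ?case using step[of k] by simp
  qed simp
  have "S = {} \<or> S = {1..r}"
  proof (cases "1 \<in> S")
    case True
    then have "{1..r} \<subseteq> S" using all by auto
    then show ?thesis using S(1) by blast
  next
    case False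
    then have "S = {}" using S(1) all by fastforce
    then show ?thesis by blast
  qed
  then show "S = {}" using evS r by auto
qed

lemma tame_bound_odd_lower_5:
  assumes "5 \<le> r"
  shows "\<not> tame_bound c P (1 + r * (r - 1) div 2)"
proof (rule matrix_lower_bound_no_unit[where J = odd_row and m = r])
  show "odd_row i \<noteq> {j}" for i j
  proof
    assume "odd_row i = {j}"
    moreover have "(if i = 1 \<or> i = 2 then 3 else 1) \<in> odd_row i"
      using assms by (auto simp: odd_row_def)
    ultimately show False using odd_row_zero[of i] by (auto split: if_splits)
  qed
  show "odd_row i \<noteq> {}" for i using odd_row_zero by blast
qed (use r odd_row_sub odd_row_columns odd_row_rows in auto)

text \<open>
  In rank three one of the rows is a unit vector, so that its class occurs twice: as \<open>h 0\<close> and as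
  \<open>g 2\<close>. The construction therefore needs two primes in that class.
\<close>

lemma tame_bound_odd_lower_two_primes:
  assumes p: "p \<in> P" "q \<in> P" "p \<noteq> q" "c p = c q" "c q \<noteq> 0"
  shows "\<not> tame_bound c P (1 + r * (r - 1) div 2)"
proof -
  have "indep {c q}" using p(5) by (auto simp: indep_def subset_singleton_iff)
  moreover have "{c q} \<subseteq> G" using p(2) surj by auto
  ultimately obtain f where f: "inj_on f {..<r}" "indep (f ` {..<r})" "{c q} \<subseteq> f ` {..<r}" "f ` {..<r} \<subseteq> G"
    using basis_enumeration by metis
  then obtain k where k: "k < r" "f k = c q" by auto
  define e where "e j = (if j = 0 then f k else if j = k then f 0 else f j)" for j
  have r0: "0 < r" using r by simp
  have e0: "e 0 = c q" by (simp add: e_def k)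
  have inj_e: "inj_on e {..<r}"
    using k(1) r0 by (auto simp: inj_on_def e_def inj_on_eq_iff[OF f(1)] split: if_splits)
  have "e ` {..<r} \<subseteq> f ` {..<r}" using k(1) r0 by (auto simp: e_def)
  then have e: "inj_on e {..<r}" "indep (e ` {..<r})" "e ` {..<r} \<subseteq> G"
    using inj_e indep_subset[OF f(2)] f(4) by auto
  note Jr = odd_row_sub
  have vG: "(\<Sum>j\<in>odd_row i. e j) \<in> G" for i
    using sum_in_G[of "e ` odd_row i"] e(3) Jr inj_on_subset[OF e(1) Jr] by (force simp: sum.reindex)
  have eG: "e j \<in> G" if "j < r" for j using e(3) that by auto
  let ?h = "\<lambda>j. if j = 0 then q else prime_in (e j)"
  let ?g = "\<lambda>i. if (\<Sum>j\<in>odd_row i. e j) = e 0 then p else prime_in (\<Sum>j\<in>odd_row i. e j)"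
  have ce: "c (?h j) = e j" if "j < r" for j using prime_in(2)[OF eG[OF that]] e0 by simp
  have cg: "c (?g i) = (\<Sum>j\<in>odd_row i. e j)" for i using prime_in(2)[OF vG] e0 p(4) by simp
  show ?thesis
  proof (rule matrix_lower_bound[where h = ?h and g = ?g and J = odd_row and m = r,
        OF _ _ _ _ _ _ _ odd_row_sub _ odd_row_columns(1) odd_row_rows odd_row_columns(2)])
    show "1 \<le> r" using r by simp
    show "odd_row i \<noteq> {}" for i using odd_row_zero by blast
    show "?h j \<in> P" if "j < r" for j using prime_in(1)[OF eG[OF that]] p(2) by simp
    show "inj_on (\<lambda>j. c (?h j)) {..<r}"
    proof (rule inj_onI)
      fix x y assume "x \<in> {..<r}" "y \<in> {..<r}" "c (?h x) = c (?h y)"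
      then show "x = y" using e(1) ce[of x] ce[of y] by (auto simp: inj_on_def)
    qed
    have "(\<lambda>j. c (?h j)) ` {..<r} = e ` {..<r}" by (rule image_cong) (use ce in auto)
    then show "indep ((\<lambda>j. c (?h j)) ` {..<r})" using e(2) by simp
    fix i
    show "?g i \<in> P" using prime_in(1)[OF vG] p(1) by simp
    have "(\<Sum>j\<in>odd_row i. e j) = (\<Sum>j\<in>odd_row i. c (?h j))"
      by (rule sum.cong[OF refl]) (use ce Jr[of i] in \<open>metis lessThan_iff subsetD\<close>)
    then show "c (?g i) = (\<Sum>j\<in>odd_row i. c (?h j))" unfolding cg .
    show "?g i \<notin> ?h ` {..<r}"
    proof
      assume "?g i \<in> ?h ` {..<r}"
      then obtain j where j: "j < r" "?g i = ?h j" by auto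
      then have eq: "(\<Sum>j\<in>odd_row i. e j) = e j" using cg[of i] ce[OF j(1)] by simp
      then have "odd_row i = {j}" using row_eq_unit[OF e(1,2) Jr j(1)] by blast
      then have "j = 0" using odd_row_zero[of i] by auto
      then show False using j(2) eq p(3) by simp
    qed
  qed
qed

end

text \<open>
  In rank two the matrix has unit rows. Instead, the square of the only atom of length three
  is the product of the three squares of its terms.
\<close>

lemma tame_bound_rank_2_lower:
  assumes r: "r = 2"
  shows "\<not> tame_bound c P 2"
proof -
  obtain e where e: "inj_on e {..<r}" "indep (e ` {..<r})" "e ` {..<r} \<subseteq> G"
    using basis_enumeration[of "{}"] by (auto simp: indep_def)
  define x y where "x = e 0" and "y = e 1"
  have range: "e ` {..<r} = {x, y}"
    unfolding x_def y_def r by (auto simp: numeral_2_eq_2 lessThan_Suc)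
  have xy: "indep {x, y}" "x \<in> G" "y \<in> G" "x \<noteq> y"
    using e range r inj_on_eq_iff[OF e(1), of 0 1] unfolding x_def y_def by auto
  have s: "x + y \<in> G" "x + y \<noteq> 0" using xy add_in by (auto simp: add_eq_0_iff)
  let ?x = "prime_in x" and ?y = "prime_in y" and ?s = "prime_in (x + y)"
  note cl = prime_in(2)[OF xy(2)] prime_in(2)[OF xy(3)] prime_in(2)[OF s(1)]
  have "x \<noteq> 0" "y \<noteq> 0" using indep_zero[OF xy(1)] by auto
  then have ne: "?x \<noteq> ?y" "?s \<noteq> ?x" "?s \<noteq> ?y"
    using cl xy(4) by (metis add_cancel_right_right, metis add_cancel_right_right, metis add_cancel_left_left)
  let ?V = "{#?s, ?x, ?y#}"
  have "min_zero_sum (\<lambda>x. x) (add_mset (x + y) (mset_set {x, y}))"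
    using xy by (intro min_zero_sum_insert) auto
  then have V: "min_zero_sum c ?V"
    unfolding min_zero_sum_image[of c] using xy(4) by (simp add: cl)
  show ?thesis
  proof (rule lower_bound[where z = "{#?V, ?V#}" and u = "{#?s, ?s#}" and d = "{#?x, ?x, ?y, ?y#}"
        and S = "{?x, ?y}" and b = "?V + ?V"])
    show "{#?V, ?V#} \<in> zs_factorizations c (?V + ?V)" using V by (simp add: zs_factorizations_def)
    show "set_mset (?V + ?V) \<subseteq> P" using prime_in(1) xy s by simp
    show "min_zero_sum c {#?s, ?s#}"
      unfolding min_zero_sum_image[of c] using min_zero_sum_two[OF s(2)] by (simp add: cl)
    show "?V + ?V = {#?s, ?s#} + {#?x, ?x, ?y, ?y#}" by (simp add: add_mset_commute)
    show "inj_on c {?x, ?y}" using cl xy(4) by (simp add: inj_on_def)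
    show "indep (c ` {?x, ?y})" using xy(1) by (simp add: cl)
    have short: "{#v, v#} \<notin># {#?V, ?V#}" for v
    proof
      assume "{#v, v#} \<in># {#?V, ?V#}"
      then have eq: "{#v, v#} = ?V" by (simp only: set_mset_add_mset_insert set_mset_empty insert_iff empty_iff simp_thms)
      show False using arg_cong[OF eq, of size] by simp
    qed
    show "{#?s, ?s#} \<notin># {#?V, ?V#}" by (rule short)
    show "{#v, v#} \<notin># {#?V, ?V#}" if "v \<in> {?x, ?y}" for v by (rule short)
  qed auto
qed

lemma tame_bound_even_lower:
  assumes r: "even r" "2 \<le> r"
  shows "\<not> tame_bound c P (r ^ 2 div 2)"
proof (cases "r = 2")
  case True
  then show ?thesis using tame_bound_rank_2_lower by simp
next
  case False
  then have "4 \<le> r" using r by presburger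
  then show ?thesis by (rule tame_bound_even_lower_4[OF r(1)])
qed

lemma tame_bound_rank_1_lower:
  assumes p: "p \<in> P" "q \<in> P" "p \<noteq> q" "c p = c q" "c q \<noteq> 0"
  shows "\<not> tame_bound c P 1"
proof (rule lower_bound[where z = "{#{#p, q#}, {#p, q#}#}" and u = "{#p, p#}" and d = "{#q, q#}"
        and S = "{q}" and b = "{#p, q, p, q#}"])
  have two: "min_zero_sum c {#x, y#}" if "c x = c q" "c y = c q" for x y
    unfolding min_zero_sum_image[of c] using min_zero_sum_two[OF p(5)] that by simp
  show "{#{#p, q#}, {#p, q#}#} \<in> zs_factorizations c {#p, q, p, q#}"
    using two p(4) by (simp add: zs_factorizations_def)
  show "min_zero_sum c {#p, p#}" using two p(4) by simp
  show "set_mset {#p, q, p, q#} \<subseteq> P" using p by simp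
  show "indep (c ` {q})" using p(5) by (auto simp: indep_def subset_singleton_iff)
  show "{#p, p#} \<notin># {#{#p, q#}, {#p, q#}#}" using p(3) by (auto simp: add_eq_conv_ex)
  show "{#x, x#} \<notin># {#{#p, q#}, {#p, q#}#}" if "x \<in> {q}" for x
    using p(3) by (auto simp: add_eq_conv_ex)
qed (auto simp: add_mset_commute)

text \<open>The square of an atom of maximal length is also a product of \<open>r + 1\<close> squares.\<close>

lemma tame_bound_square_lower:
  assumes r: "2 \<le> r"
  shows "\<not> tame_bound c P r"
proof
  assume tb: "tame_bound c P r"
  obtain X where X: "X \<subseteq> G" "indep X" "card X = r"
    using basis_extension[of "{}"] by (auto simp: indep_def)
  have finX: "finite X" using X(2) indep_finite by blast
  have vX: "\<Sum>X \<notin> X"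
  proof
    assume "\<Sum>X \<in> X"
    then have "X = {\<Sum>X}" by (intro indep_sum_inj[OF X(2)]) auto
    then have "card X = 1" by (metis card_1_singleton_iff One_nat_def)
    then show False using X(3) r by simp
  qed
  define T where "T = insert (\<Sum>X) X"
  have TG: "T \<subseteq> G" using X(1) sum_in_G[of X] by (auto simp: T_def)
  have finT: "finite T" and cardT: "card T = Suc r" using finX vX X(3) by (auto simp: T_def)
  define A where "A = prime_in ` T"
  have cp: "c (prime_in t) = t" if "t \<in> T" for t by (rule prime_in(2)[OF subsetD[OF TG that]])
  have inj: "inj_on prime_in T"
  proof (rule inj_onI)
    fix s t assume st: "s \<in> T" "t \<in> T" "prime_in s = prime_in t"
    have "s = c (prime_in s)" by (rule cp[OF st(1), symmetric])
    also have "\<dots> = t" unfolding st(3) by (rule cp[OF st(2)])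
    finally show "s = t" .
  qed
  have AP: "A \<subseteq> P" unfolding A_def
  proof (rule image_subsetI)
    show "prime_in t \<in> P" if "t \<in> T" for t by (rule prime_in(1)[OF subsetD[OF TG that]])
  qed
  have finA: "finite A" and cardA: "card A = Suc r"
    using finT cardT card_image[OF inj] by (auto simp: A_def)
  have cA: "c ` A = T" unfolding A_def image_image using cp by simp
  have injc: "inj_on c A" using cp unfolding A_def by (auto simp: inj_on_def)
  have "X \<noteq> {}" using X(3) r by auto
  then have "min_zero_sum (\<lambda>x. x) (mset_set T)"
    using min_zero_sum_insert[OF X(2) _ refl] vX finX by (simp add: T_def)
  then have u: "min_zero_sum c (mset_set A)"
    unfolding min_zero_sum_image[of c] image_mset_mset_set[OF injc] cA .
  have nz: "c x \<noteq> 0" if x: "x \<in> A" for x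
  proof
    assume "c x = 0"
    then have "mset_set A = {#x#}" using min_zero_sum_zero[OF u] x finA by simp
    then have "card A = 1" by (metis size_mset_set size_single)
    then show False using cardA r by simp
  qed
  have square: "min_zero_sum c {#x, x#}" if "x \<in> A" for x
    unfolding min_zero_sum_image[of c] using min_zero_sum_two[OF nz[OF that]] by simp
  have "\<forall>V\<in>#squares A. min_zero_sum c V" using square finA by (auto simp: squares_def)
  then have z: "squares A \<in> zs_factorizations c (mset_set A + mset_set A)"
    by (simp add: zs_factorizations_def sum_squares)
  have z0: "{#mset_set A, mset_set A#} \<in> zs_factorizations c (mset_set A + mset_set A)"
    using u by (simp add: zs_factorizations_def)
  have sub: "set_mset (mset_set A + mset_set A) \<subseteq> P" using AP finA by simp
  have "\<exists>z'\<in>zs_factorizations c (mset_set A + mset_set A). mset_set A \<in># z'"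
    using z0 by (intro bexI[OF _ z0]) simp
  then obtain z' where z': "z' \<in> zs_factorizations c (mset_set A + mset_set A)" "mset_set A \<in># z'"
    "fact_dist (squares A) z' \<le> r"
    using tb[unfolded tame_bound_def, rule_format, OF z sub] by blast
  obtain w where w: "z' = add_mset (mset_set A) w" using multi_member_split[OF z'(2)] by blast
  have wF: "w \<in> zs_factorizations c (mset_set A)" using z'(1) w by (simp add: zs_factorizations_def)
  have "V = mset_set A" if V: "V \<in># w" for V
  proof -
    have "V \<subseteq># mset_set A" by (rule factorization_member_sub[OF wF V])
    moreover have "min_zero_sum c V" using wF V by (simp add: zs_factorizations_def)
    ultimately show ?thesis using u unfolding min_zero_sum_def by blast
  qed
  then have all: "V = mset_set A" if "V \<in># z'" for V using that w by auto
  have "fact_dist (squares A) z' = max (size (squares A)) (size z')"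
  proof (rule fact_dist_disjoint)
    fix V assume "V \<in># squares A"
    then have "size V = 2" by (auto simp: squares_def)
    then show "V \<notin># z'" using all cardA r by fastforce
  qed
  then show False using z'(3) cardA by (simp add: size_squares)
qed

end

section \<open>From monoids to zero-sum sequences\<close>

lemma (in comm_monoid) mset_prod_empty: "mset_prod G {#} = \<one>"
  by (simp add: mset_prod_def)

lemma (in comm_monoid) mset_prod_add:
  assumes "set_mset S \<subseteq> carrier G" "x \<in> carrier G"
  shows "mset_prod G (add_mset x S) = x \<otimes> mset_prod G S" "mset_prod G S \<in> carrier G"
proof -
  have pow: "(\<lambda>y. y [^] count S' y) \<in> A \<rightarrow> carrier G" if "A \<subseteq> carrier G" for A and S' :: "'a multiset"
    using that by auto
  show "mset_prod G S \<in> carrier G"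
    unfolding mset_prod_def by (rule finprod_closed[OF pow[OF assms(1)]])
  let ?A = "set_mset S - {x}"
  have A: "finite ?A" "x \<notin> ?A" "?A \<subseteq> carrier G" using assms by auto
  have split: "mset_prod G S' = x [^] count S' x \<otimes> (\<Otimes>y\<in>?A. y [^] count S' y)"
    if S': "set_mset S' \<subseteq> insert x ?A" "?A \<subseteq> set_mset S'" for S'
  proof -
    have "mset_prod G S' = (\<Otimes>y\<in>insert x ?A. y [^] count S' y)"
      unfolding mset_prod_def
    proof (rule finprod_mono_neutral_cong_left)
      show "y [^] count S' y = \<one>" if "y \<in> insert x ?A - set_mset S'" for y
        using that by (simp add: not_in_iff)
    qed (use assms S' A in auto)
    also have "\<dots> = x [^] count S' x \<otimes> (\<Otimes>y\<in>?A. y [^] count S' y)"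
      by (rule finprod_insert) (use A assms in auto)
    finally show ?thesis .
  qed
  have rest: "(\<Otimes>y\<in>?A. y [^] count (add_mset x S) y) = (\<Otimes>y\<in>?A. y [^] count S y)"
    using A by (intro finprod_cong') auto
  have closed: "(\<Otimes>y\<in>?A. y [^] count S y) \<in> carrier G" by (rule finprod_closed[OF pow[OF A(3)]])
  have "mset_prod G (add_mset x S)
      = x [^] Suc (count S x) \<otimes> (\<Otimes>y\<in>?A. y [^] count S y)"
    using split[of "add_mset x S"] rest by auto
  also have "\<dots> = (x [^] count S x \<otimes> x) \<otimes> (\<Otimes>y\<in>?A. y [^] count S y)" by simp
  also have "\<dots> = x \<otimes> (x [^] count S x \<otimes> (\<Otimes>y\<in>?A. y [^] count S y))"
    using assms closed by (simp add: m_ac)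
  also have "x [^] count S x \<otimes> (\<Otimes>y\<in>?A. y [^] count S y) = mset_prod G S"
    by (rule split[symmetric]) auto
  finally show "mset_prod G (add_mset x S) = x \<otimes> mset_prod G S" .
qed

lemma fact_dist_image_inj:
  assumes "inj_on f (set_mset z \<union> set_mset z')"
  shows "fact_dist (image_mset f z) (image_mset f z') = fact_dist z z'"
proof (rule antisym)
  let ?g = "inv_into (set_mset z \<union> set_mset z') f"
  have "image_mset ?g (image_mset f y) = y" if "set_mset y \<subseteq> set_mset z \<union> set_mset z'" for y
  proof -
    have "image_mset ?g (image_mset f y) = image_mset (\<lambda>x. x) y"
      unfolding image_mset.compositionality comp_def
    proof (rule image_mset_cong)
      fix x assume "x \<in># y"
      then show "?g (f x) = x" using that inv_into_f_f[OF assms] by blast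
    qed
    then show ?thesis by simp
  qed
  then show "fact_dist z z' \<le> fact_dist (image_mset f z) (image_mset f z')"
    using fact_dist_image[of ?g "image_mset f z" "image_mset f z'"] by simp
qed (rule fact_dist_image)

lemma local_tame_le_iff:
  "local_tame H a x \<le> enat N \<longleftrightarrow> (factorizations_through H a x \<noteq> {} \<longrightarrow>
    (\<forall>z\<in>factorizations H a. \<exists>z'\<in>factorizations_through H a x. fact_dist z z' \<le> N))"
proof -
  define B where "B M \<longleftrightarrow> (factorizations_through H a x \<noteq> {} \<longrightarrow>
    (\<forall>z\<in>factorizations H a. \<exists>z'\<in>factorizations_through H a x. enat (fact_dist z z') \<le> M))" for M
  have lt: "local_tame H a x = (LEAST M. B M)" by (simp add: local_tame_def B_def)
  have "B \<infinity>" by (auto simp: B_def)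
  then have least: "B (LEAST M. B M)" by (rule LeastI)
  have mono: "B M'" if "B M" "M \<le> M'" for M M'
    using that unfolding B_def by (meson order_trans)
  have "local_tame H a x \<le> enat N \<longleftrightarrow> B (enat N)"
    unfolding lt using least mono Least_le[of B] by blast
  then show ?thesis by (simp add: B_def)
qed

text \<open>
  A divisor homomorphism onto a monoid of zero-sum sequences. It identifies the reduced monoid
  with its image, and hence the factorizations with factorizations of zero-sum sequences.
\<close>

locale zero_sum_model = comm_monoid_cancel H
  for H :: "('a, 'b) monoid_scheme" (structure) +
  fixes \<psi> :: "'a \<Rightarrow> 'p multiset" and P :: "'p set" and c :: "'p \<Rightarrow> 'v::ab_group_add"
  assumes \<psi>_mult: "\<And>a b. a \<in> carrier H \<Longrightarrow> b \<in> carrier H \<Longrightarrow> \<psi> (a \<otimes> b) = \<psi> a + \<psi> b"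
    and \<psi>_one: "\<psi> \<one> = {#}"
    and \<psi>_divides: "\<And>a b. a \<in> carrier H \<Longrightarrow> b \<in> carrier H \<Longrightarrow> \<psi> a \<subseteq># \<psi> b \<Longrightarrow> a divides b"
    and \<psi>_image: "\<psi> ` carrier H = {b. set_mset b \<subseteq> P \<and> zero_sum c b}"
begin

abbreviation coset :: "'a \<Rightarrow> 'a set" where "coset a \<equiv> a <# Units H"

abbreviation Red :: "'a set monoid" where "Red \<equiv> reduced_monoid H"

lemma \<psi>_unit:
  assumes "u \<in> Units H" shows "\<psi> u = {#}"
proof -
  have "\<psi> u + \<psi> (inv u) = \<psi> (u \<otimes> inv u)" using assms by (intro \<psi>_mult[symmetric]) auto
  also have "\<dots> = {#}" using assms \<psi>_one by simp
  finally show ?thesis by simp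
qed

lemma coset_eq_iff:
  assumes a: "a \<in> carrier H" and b: "b \<in> carrier H"
  shows "coset a = coset b \<longleftrightarrow> \<psi> a = \<psi> b"
proof
  assume "coset a = coset b"
  moreover have "a \<in> coset a"
    using a by (auto simp: l_coset_def intro!: bexI[of _ \<one>])
  ultimately obtain u where "u \<in> Units H" "a = b \<otimes> u" by (auto simp: l_coset_def)
  then show "\<psi> a = \<psi> b" using b \<psi>_unit by (simp add: \<psi>_mult Units_closed)
next
  have sub: "coset a \<subseteq> coset b"
    if ab: "\<psi> a = \<psi> b" and a: "a \<in> carrier H" and b: "b \<in> carrier H" for a b
  proof -
    have "a \<sim> b" using \<psi>_divides a b ab by (simp add: associated_def)
    then obtain u where u: "u \<in> Units H" "a = b \<otimes> u" using associatedD2 a b by blast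
    show ?thesis
    proof
      fix x assume "x \<in> coset a"
      then obtain v where v: "v \<in> Units H" "x = a \<otimes> v" by (auto simp: l_coset_def)
      then have "x = b \<otimes> (u \<otimes> v)" using u b by (simp add: m_assoc Units_closed)
      then show "x \<in> coset b" using u v by (auto simp: l_coset_def)
    qed
  qed
  assume "\<psi> a = \<psi> b"
  then show "coset a = coset b" using sub[OF _ a b] sub[OF _ b a] by auto
qed

lemma coset_mult:
  assumes a: "a \<in> carrier H" and b: "b \<in> carrier H"
  shows "coset a <#> coset b = coset (a \<otimes> b)"
proof
  show "coset a <#> coset b \<subseteq> coset (a \<otimes> b)"
  proof
    fix x assume "x \<in> coset a <#> coset b"
    then obtain u v where uv: "u \<in> Units H" "v \<in> Units H" "x = (a \<otimes> u) \<otimes> (b \<otimes> v)"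
      by (auto simp: l_coset_def set_mult_def)
    then have "x = (a \<otimes> b) \<otimes> (u \<otimes> v)" using a b by (simp add: m_ac Units_closed)
    then show "x \<in> coset (a \<otimes> b)" using uv by (auto simp: l_coset_def)
  qed
  show "coset (a \<otimes> b) \<subseteq> coset a <#> coset b"
  proof
    fix x assume "x \<in> coset (a \<otimes> b)"
    then obtain u where u: "u \<in> Units H" "x = (a \<otimes> b) \<otimes> u" by (auto simp: l_coset_def)
    then have "x = (a \<otimes> \<one>) \<otimes> (b \<otimes> u)" using a b by (simp add: m_ac Units_closed)
    then show "x \<in> coset a <#> coset b"
      using u unfolding l_coset_def set_mult_def by blast
  qed
qed

lemma carrier_Red: "carrier Red = coset ` carrier H"
  by (auto simp: reduced_monoid_def)

lemma mult_Red: "a \<in> carrier H \<Longrightarrow> b \<in> carrier H \<Longrightarrow> coset a \<otimes>\<^bsub>Red\<^esub> coset b = coset (a \<otimes> b)"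
  using coset_mult by (simp add: reduced_monoid_def)

lemma one_Red: "\<one>\<^bsub>Red\<^esub> = coset \<one>"
proof -
  have "coset \<one> = Units H" unfolding l_coset_def using Units_closed by auto
  then show ?thesis by (simp add: reduced_monoid_def)
qed

text \<open>The map induced by \<open>\<psi>\<close> on cosets; it does not depend on the representative.\<close>

definition \<chi> :: "'a set \<Rightarrow> 'p multiset"
  where "\<chi> x = \<psi> (SOME a. a \<in> carrier H \<and> x = coset a)"

lemma \<chi>_coset: "a \<in> carrier H \<Longrightarrow> \<chi> (coset a) = \<psi> a"
proof -
  assume a: "a \<in> carrier H"
  let ?b = "SOME b. b \<in> carrier H \<and> coset a = coset b"
  have "?b \<in> carrier H \<and> coset a = coset ?b" by (rule someI[of _ a]) (simp add: a)
  then show ?thesis unfolding \<chi>_def using coset_eq_iff a by metis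
qed

lemma Red_comm_monoid: "comm_monoid Red"
proof (rule comm_monoidI)
  fix x y z
  assume "x \<in> carrier Red" "y \<in> carrier Red" "z \<in> carrier Red"
  then obtain a b d where "a \<in> carrier H" "b \<in> carrier H" "d \<in> carrier H"
    "x = coset a" "y = coset b" "z = coset d" by (auto simp: carrier_Red)
  then show "x \<otimes>\<^bsub>Red\<^esub> y \<otimes>\<^bsub>Red\<^esub> z = x \<otimes>\<^bsub>Red\<^esub> (y \<otimes>\<^bsub>Red\<^esub> z)" by (simp add: mult_Red m_assoc)
next
  fix x y assume "x \<in> carrier Red" "y \<in> carrier Red"
  then obtain a b where "a \<in> carrier H" "b \<in> carrier H" "x = coset a" "y = coset b"
    by (auto simp: carrier_Red)
  then show "x \<otimes>\<^bsub>Red\<^esub> y \<in> carrier Red" "x \<otimes>\<^bsub>Red\<^esub> y = y \<otimes>\<^bsub>Red\<^esub> x"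
    by (auto simp: mult_Red carrier_Red m_comm)
next
  show "\<one>\<^bsub>Red\<^esub> \<in> carrier Red" by (auto simp: one_Red carrier_Red)
  fix x assume "x \<in> carrier Red"
  then show "\<one>\<^bsub>Red\<^esub> \<otimes>\<^bsub>Red\<^esub> x = x" by (auto simp: carrier_Red one_Red mult_Red)
qed

lemma \<chi>_inj: "inj_on \<chi> (carrier Red)"
  unfolding carrier_Red by (auto simp: inj_on_def \<chi>_coset coset_eq_iff)

lemma \<chi>_image: "\<chi> ` carrier Red = {b. set_mset b \<subseteq> P \<and> zero_sum c b}"
  unfolding carrier_Red \<psi>_image[symmetric] image_image using \<chi>_coset by simp

lemma \<chi>_mult: "x \<in> carrier Red \<Longrightarrow> y \<in> carrier Red \<Longrightarrow> \<chi> (x \<otimes>\<^bsub>Red\<^esub> y) = \<chi> x + \<chi> y"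
  unfolding carrier_Red by (auto simp: mult_Red \<chi>_coset \<psi>_mult)

lemma \<chi>_one: "\<chi> \<one>\<^bsub>Red\<^esub> = {#}"
  by (simp add: one_Red \<chi>_coset \<psi>_one)

lemma \<chi>_divides:
  assumes x: "x \<in> carrier Red" and y: "y \<in> carrier Red"
  shows "x divides\<^bsub>Red\<^esub> y \<longleftrightarrow> \<chi> x \<subseteq># \<chi> y"
proof
  assume "x divides\<^bsub>Red\<^esub> y"
  then obtain w where "w \<in> carrier Red" "y = x \<otimes>\<^bsub>Red\<^esub> w" by (rule dividesE)
  then show "\<chi> x \<subseteq># \<chi> y" using x \<chi>_mult by simp
next
  assume sub: "\<chi> x \<subseteq># \<chi> y"
  have xM: "set_mset (\<chi> x) \<subseteq> P \<and> zero_sum c (\<chi> x)" and yM: "set_mset (\<chi> y) \<subseteq> P \<and> zero_sum c (\<chi> y)"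
    using \<chi>_image x y by blast+
  have eq: "\<chi> y = \<chi> x + (\<chi> y - \<chi> x)" using sub by simp
  then have "zero_sum c (\<chi> y - \<chi> x)" using xM yM zero_sum_plus by metis
  moreover have "set_mset (\<chi> y - \<chi> x) \<subseteq> P" using yM by (meson in_diffD subset_iff)
  ultimately have "\<chi> y - \<chi> x \<in> \<chi> ` carrier Red" unfolding \<chi>_image by simp
  then obtain w where w: "w \<in> carrier Red" "\<chi> w = \<chi> y - \<chi> x" by auto
  interpret Red: comm_monoid Red by (rule Red_comm_monoid)
  have "\<chi> (x \<otimes>\<^bsub>Red\<^esub> w) = \<chi> y" using \<chi>_mult[OF x w(1)] w(2) eq by simp
  then have "x \<otimes>\<^bsub>Red\<^esub> w = y" using inj_onD[OF \<chi>_inj] x y w(1) by simp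
  then show "x divides\<^bsub>Red\<^esub> y" using w(1) by (auto intro: dividesI)
qed

lemma Units_Red: "x \<in> carrier Red \<Longrightarrow> x \<in> Units Red \<longleftrightarrow> \<chi> x = {#}"
proof -
  interpret Red: comm_monoid Red by (rule Red_comm_monoid)
  assume x: "x \<in> carrier Red"
  show ?thesis
  proof
    assume "x \<in> Units Red"
    then obtain y where y: "y \<in> carrier Red" "x \<otimes>\<^bsub>Red\<^esub> y = \<one>\<^bsub>Red\<^esub>" by (auto simp: Units_def)
    then show "\<chi> x = {#}" using \<chi>_mult[OF x y(1)] \<chi>_one by simp
  next
    assume "\<chi> x = {#}"
    then have "x = \<one>\<^bsub>Red\<^esub>" using \<chi>_inj x \<chi>_one by (metis Red.one_closed inj_onD)
    then show "x \<in> Units Red" by simp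
  qed
qed

lemma irreducible_Red:
  assumes x: "x \<in> carrier Red"
  shows "irreducible Red x \<longleftrightarrow> min_zero_sum c (\<chi> x)"
proof -
  have zx: "set_mset (\<chi> x) \<subseteq> P" "zero_sum c (\<chi> x)" using \<chi>_image x by blast+
  have "irreducible Red x \<longleftrightarrow> \<chi> x \<noteq> {#} \<and>
      (\<forall>y\<in>carrier Red. \<chi> y \<subseteq># \<chi> x \<and> \<not> \<chi> x \<subseteq># \<chi> y \<longrightarrow> \<chi> y = {#})"
    unfolding irreducible_def properfactor_def using \<chi>_divides Units_Red x by auto
  also have "\<dots> \<longleftrightarrow> \<chi> x \<noteq> {#} \<and>
      (\<forall>w\<in>\<chi> ` carrier Red. w \<subseteq># \<chi> x \<and> \<not> \<chi> x \<subseteq># w \<longrightarrow> w = {#})" by simp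
  also have "\<dots> \<longleftrightarrow> min_zero_sum c (\<chi> x)"
  proof -
    have "w \<in> \<chi> ` carrier Red \<longleftrightarrow> zero_sum c w" if "w \<subseteq># \<chi> x" for w
      unfolding \<chi>_image using set_mset_mono[OF that] zx by auto
    then show ?thesis unfolding min_zero_sum_def using zx(2)
      by (metis subset_mset.antisym subset_mset.order_refl)
  qed
  finally show ?thesis .
qed

lemma atoms_Red: "monoid_atoms Red = {x \<in> carrier Red. min_zero_sum c (\<chi> x)}"
  unfolding monoid_atoms_def using irreducible_Red by auto

lemma \<chi>_mset_prod:
  assumes "set_mset z \<subseteq> carrier Red"
  shows "mset_prod Red z \<in> carrier Red \<and> \<chi> (mset_prod Red z) = \<Sum>\<^sub># (image_mset \<chi> z)"
proof -
  interpret Red: comm_monoid Red by (rule Red_comm_monoid)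
  show ?thesis using assms
    by (induction z) (auto simp: Red.mset_prod_empty \<chi>_one Red.mset_prod_add \<chi>_mult)
qed

lemma factorizations_iff:
  assumes a: "a \<in> carrier H"
  shows "z \<in> factorizations H a \<longleftrightarrow>
    set_mset z \<subseteq> monoid_atoms Red \<and> image_mset \<chi> z \<in> zs_factorizations c (\<psi> a)"
proof -
  have "mset_prod Red z = coset a \<longleftrightarrow> \<Sum>\<^sub># (image_mset \<chi> z) = \<psi> a"
    if z: "set_mset z \<subseteq> monoid_atoms Red"
  proof -
    have "set_mset z \<subseteq> carrier Red" using z by (auto simp: atoms_Red)
    note p = \<chi>_mset_prod[OF this]
    have "coset a \<in> carrier Red" using a by (auto simp: carrier_Red)
    then have "mset_prod Red z = coset a \<longleftrightarrow> \<chi> (mset_prod Red z) = \<chi> (coset a)"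
      using inj_on_eq_iff[OF \<chi>_inj conjunct1[OF p]] by simp
    then show ?thesis using p \<chi>_coset[OF a] by simp
  qed
  then show ?thesis
    unfolding factorizations_def factorization_monoid_def free_monoid_def zs_factorizations_def
    by (auto simp: atoms_Red)
qed

lemma factorizations_through_iff:
  assumes "u \<in> monoid_atoms Red"
  shows "z \<in> factorizations_through H a {#u#} \<longleftrightarrow> z \<in> factorizations H a \<and> u \<in># z"
proof -
  have "z \<in> {#u#} <#\<^bsub>factorization_monoid H\<^esub> carrier (factorization_monoid H) \<longleftrightarrow> u \<in># z"
    if z: "z \<in> factorizations H a"
  proof -
    have zs: "set_mset z \<subseteq> monoid_atoms Red"
      using z by (simp add: factorizations_def factorization_monoid_def free_monoid_def)
    have "u \<in># z \<longleftrightarrow> (\<exists>y. set_mset y \<subseteq> monoid_atoms Red \<and> z = add_mset u y)"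
    proof
      assume "u \<in># z"
      then obtain y where "z = add_mset u y" using multi_member_split by metis
      then show "\<exists>y. set_mset y \<subseteq> monoid_atoms Red \<and> z = add_mset u y" using zs by auto
    qed auto
    then show ?thesis
      by (auto simp: l_coset_def factorization_monoid_def free_monoid_def)
  qed
  then show ?thesis unfolding factorizations_through_def by auto
qed

lemma factorization_pullback:
  assumes a: "a \<in> carrier H" and y: "y \<in> zs_factorizations c (\<psi> a)"
  shows "\<exists>z\<in>factorizations H a. image_mset \<chi> z = y"
proof -
  let ?g = "inv_into (carrier Red) \<chi>"
  have \<psi>P: "set_mset (\<psi> a) \<subseteq> P" using \<psi>_image a by blast
  have mem: "V \<in> \<chi> ` carrier Red" if V: "V \<in># y" for V
  proof -
    have "set_mset V \<subseteq> P"
      using set_mset_mono[OF factorization_member_sub[OF y V]] \<psi>P by (rule order_trans)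
    moreover have "zero_sum c V" using y V by (simp add: zs_factorizations_def min_zero_sum_def)
    ultimately show ?thesis unfolding \<chi>_image by simp
  qed
  have "image_mset \<chi> (image_mset ?g y) = image_mset (\<lambda>V. V) y"
    unfolding image_mset.compositionality comp_def
    by (rule image_mset_cong) (rule f_inv_into_f[OF mem])
  then have im: "image_mset \<chi> (image_mset ?g y) = y" by simp
  have "?g V \<in> monoid_atoms Red" if V: "V \<in># y" for V
    using inv_into_into[OF mem[OF V]] f_inv_into_f[OF mem[OF V]] y V
    by (simp add: atoms_Red zs_factorizations_def)
  then have "image_mset ?g y \<in> factorizations H a"
    unfolding factorizations_iff[OF a] im using y by auto
  then show ?thesis using im by blast
qed

text \<open>
  Factorizations correspond under \<open>\<chi>\<close>, which is injective on atoms and therefore preserves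
  distances. Since all suprema are taken in the extended naturals, the finite upper bounds
  determine the tame degree.
\<close>

theorem tame_degree_le_iff: "tame_degree H \<le> enat N \<longleftrightarrow> tame_bound c P N"
proof
  assume td: "tame_degree H \<le> enat N"
  show "tame_bound c P N"
    unfolding tame_bound_def
  proof (intro allI ballI impI)
    fix b u z
    assume z: "z \<in> zs_factorizations c b" and bP: "set_mset b \<subseteq> P"
      and ex: "\<exists>z'\<in>zs_factorizations c b. u \<in># z'"
    have "zero_sum c b"
      using z zero_sum_Union[of z c] by (auto simp: zs_factorizations_def min_zero_sum_def)
    then have "b \<in> \<psi> ` carrier H" using bP \<psi>_image by simp
    then obtain a where a: "a \<in> carrier H" "b = \<psi> a" by blast
    obtain z0 where z0: "z0 \<in> zs_factorizations c b" "u \<in># z0" using ex by blast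
    obtain y where y: "y \<in> factorizations H a" "image_mset \<chi> y = z"
      using factorization_pullback[OF a(1)] z a(2) by blast
    obtain y0 where y0: "y0 \<in> factorizations H a" "image_mset \<chi> y0 = z0"
      using factorization_pullback[OF a(1)] z0(1) a(2) by blast
    then obtain v where v: "v \<in># y0" "\<chi> v = u" using z0(2) by auto
    have vA: "v \<in> monoid_atoms Red" using y0(1) v(1) factorizations_iff[OF a(1)] by blast
    have "local_tame H a {#v#} \<le> tame_degree_at H v"
      unfolding tame_degree_at_def by (rule SUP_upper[OF a(1)])
    also have "\<dots> \<le> tame_degree H" unfolding tame_degree_def by (rule SUP_upper[OF vA])
    finally have "local_tame H a {#v#} \<le> enat N" using td by (rule order_trans)
    moreover have "y0 \<in> factorizations_through H a {#v#}"
      using factorizations_through_iff[OF vA] y0 v by blast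
    ultimately obtain y' where y': "y' \<in> factorizations_through H a {#v#}" "fact_dist y y' \<le> N"
      using y(1) unfolding local_tame_le_iff by blast
    have y'F: "y' \<in> factorizations H a" "v \<in># y'"
      using y'(1) factorizations_through_iff[OF vA] by blast+
    have "set_mset y \<union> set_mset y' \<subseteq> carrier Red"
      using y(1) y'F(1) factorizations_iff[OF a(1)] atoms_Red by blast
    then have "fact_dist (image_mset \<chi> y) (image_mset \<chi> y') = fact_dist y y'"
      by (intro fact_dist_image_inj inj_on_subset[OF \<chi>_inj])
    then have "fact_dist z (image_mset \<chi> y') \<le> N" using y(2) y'(2) by simp
    moreover have "u \<in># image_mset \<chi> y'" using y'F(2) v(2) by auto
    moreover have "image_mset \<chi> y' \<in> zs_factorizations c b"
      using y'F(1) factorizations_iff[OF a(1)] a(2) by blast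
    ultimately show "\<exists>z'\<in>zs_factorizations c b. u \<in># z' \<and> fact_dist z z' \<le> N" by blast
  qed
next
  assume tb: "tame_bound c P N"
  show "tame_degree H \<le> enat N"
    unfolding tame_degree_def tame_degree_at_def
  proof (intro SUP_least)
    fix v a assume vA: "v \<in> monoid_atoms Red" and a: "a \<in> carrier H"
    show "local_tame H a {#v#} \<le> enat N"
      unfolding local_tame_le_iff
    proof (intro impI ballI)
      fix y assume ne: "factorizations_through H a {#v#} \<noteq> {}" and y: "y \<in> factorizations H a"
      obtain y0 where y0: "y0 \<in> factorizations H a" "v \<in># y0"
        using ne factorizations_through_iff[OF vA] by blast
      have \<psi>P: "set_mset (\<psi> a) \<subseteq> P" using \<psi>_image a by blast
      have yz: "image_mset \<chi> y \<in> zs_factorizations c (\<psi> a)"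
        and y0z: "image_mset \<chi> y0 \<in> zs_factorizations c (\<psi> a)"
        using y y0(1) factorizations_iff[OF a] by blast+
      have "\<exists>z'\<in>zs_factorizations c (\<psi> a). \<chi> v \<in># z'"
        using y0(2) by (intro bexI[OF _ y0z]) auto
      then obtain z' where z': "z' \<in> zs_factorizations c (\<psi> a)" "\<chi> v \<in># z'"
        "fact_dist (image_mset \<chi> y) z' \<le> N"
        using tb[unfolded tame_bound_def, rule_format, OF yz \<psi>P] by blast
      obtain y' where y': "y' \<in> factorizations H a" "image_mset \<chi> y' = z'"
        using factorization_pullback[OF a z'(1)] by blast
      have sub: "set_mset y \<union> set_mset y' \<subseteq> carrier Red"
        using y y'(1) factorizations_iff[OF a] atoms_Red by blast
      then have "fact_dist (image_mset \<chi> y) (image_mset \<chi> y') = fact_dist y y'"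
        by (intro fact_dist_image_inj inj_on_subset[OF \<chi>_inj])
      then have "fact_dist y y' \<le> N" using z'(3) y'(2) by simp
      moreover have "v \<in># y'"
      proof -
        obtain v' where "v' \<in># y'" "\<chi> v' = \<chi> v" using z'(2) y'(2) by auto
        moreover have "v \<in> carrier Red" using vA atoms_Red by blast
        ultimately show ?thesis using sub \<chi>_inj by (metis UnCI inj_onD subsetD)
      qed
      ultimately show "\<exists>z'\<in>factorizations_through H a {#v#}. fact_dist y z' \<le> N"
        using y'(1) factorizations_through_iff[OF vA] by blast
    qed
  qed
qed

end

section \<open>The class group\<close>

text \<open>The class group receives coordinates in a vector space whose type does not depend on \<open>r\<close>.\<close>

definition bit_vectors :: "nat \<Rightarrow> (nat \<Rightarrow> bit) set"
  where "bit_vectors r = {f. \<forall>i\<ge>r. f i = 0}"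

lemma bit_double: "(x::bit) + x = 0"
  by (cases x) auto

lemma card_bit_vectors: "card (bit_vectors r) = 2 ^ r"
proof -
  have "bij_betw (\<lambda>S i. if i \<in> S then 1 else 0) (Pow {..<r}) (bit_vectors r)"
  proof (rule bij_betwI[where g = "\<lambda>f. {i. f i = 1}"])
    show "(\<lambda>S i. if i \<in> S then 1 else 0) \<in> Pow {..<r} \<rightarrow> bit_vectors r"
      by (auto simp: bit_vectors_def)
    show "(\<lambda>f. {i. f i = 1}) \<in> bit_vectors r \<rightarrow> Pow {..<r}"
    proof (intro funcsetI PowI subsetI)
      fix f :: "nat \<Rightarrow> bit" and i assume "f \<in> bit_vectors r" "i \<in> {i. f i = 1}"
      then show "i \<in> {..<r}" by (cases "i < r") (auto simp: bit_vectors_def)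
    qed
    show "{i. (if i \<in> S then 1 else (0::bit)) = 1} = S" for S by auto
    show "(\<lambda>i. if i \<in> {i. f i = 1} then 1 else 0) = f" for f :: "nat \<Rightarrow> bit"
      by (rule ext) (metis (full_types) bit.exhaust mem_Collect_eq)
  qed
  then have "card (bit_vectors r) = card (Pow {..<r})" by (simp add: bij_betw_same_card)
  then show ?thesis by (simp add: card_Pow)
qed

lemma elementary_2_space_bit_vectors: "elementary_2_space (bit_vectors r) r"
proof
  show "x + x = 0" for x :: "nat \<Rightarrow> bit" by (rule ext) (simp add: bit_double)
  show "card (bit_vectors r) = 2 ^ r" by (rule card_bit_vectors)
qed (auto simp: bit_vectors_def)

definition bits_of :: "nat \<Rightarrow> (nat \<Rightarrow> int) \<Rightarrow> nat \<Rightarrow> bit"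
  where "bits_of r f = (\<lambda>i. if i < r then of_int (f i) else 0)"

lemma carrier_elementary: "carrier (elementary_2_group r) = (\<Pi>\<^sub>E i\<in>{..<r}. {0, 1})"
proof -
  have "{0..<2} = {0, 1::int}" by auto
  then show ?thesis
    by (simp add: elementary_2_group_def carrier_sum_group carrier_integer_mod_group)
qed

lemma bits_of_mult:
  "bits_of r (x \<otimes>\<^bsub>elementary_2_group r\<^esub> y) = bits_of r x + bits_of r y"
proof
  fix i
  have "of_int ((a + b) mod 2) = (of_int a + of_int b :: bit)" for a b
  proof -
    have two: "of_int (2 * x) = (0 :: bit)" for x
      by (simp only: mult_2 of_int_add bit_double)
    have "a + b = 2 * ((a + b) div 2) + (a + b) mod 2" by simp
    from arg_cong[OF this, of of_int]
    have "of_int (a + b) = (of_int (2 * ((a + b) div 2)) + of_int ((a + b) mod 2) :: bit)"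
      unfolding of_int_add .
    then show ?thesis by (simp only: two of_int_add add_0_left)
  qed
  then show "bits_of r (x \<otimes>\<^bsub>elementary_2_group r\<^esub> y) i = (bits_of r x + bits_of r y) i"
    by (simp add: bits_of_def elementary_2_group_def)
qed

lemma bits_of_bij: "bij_betw (bits_of r) (carrier (elementary_2_group r)) (bit_vectors r)"
proof (rule bij_betwI[where g = "\<lambda>f. \<lambda>i\<in>{..<r}. if f i = 1 then 1 else 0"])
  show "bits_of r \<in> carrier (elementary_2_group r) \<rightarrow> bit_vectors r"
    by (auto simp: bits_of_def bit_vectors_def)
  show "(\<lambda>f. \<lambda>i\<in>{..<r}. if f i = 1 then 1 else 0) \<in> bit_vectors r \<rightarrow> carrier (elementary_2_group r)"
    by (auto simp: carrier_elementary)
  show "(\<lambda>i\<in>{..<r}. if bits_of r f i = 1 then 1 else 0) = f"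
    if f: "f \<in> carrier (elementary_2_group r)" for f
  proof
    fix i
    show "(\<lambda>i\<in>{..<r}. if bits_of r f i = 1 then 1 else 0) i = f i"
    proof (cases "i < r")
      case True
      then have "f i = 0 \<or> f i = 1" using f by (auto simp: carrier_elementary PiE_iff)
      then show ?thesis using True by (auto simp: bits_of_def)
    next
      case False
      then show ?thesis using f by (auto simp: carrier_elementary PiE_iff extensional_def)
    qed
  qed
  show "bits_of r (\<lambda>i\<in>{..<r}. if f i = 1 then 1 else 0) = f" if f: "f \<in> bit_vectors r" for f
  proof
    fix i
    show "bits_of r (\<lambda>i\<in>{..<r}. if f i = 1 then 1 else 0) i = f i"
    proof (cases "i < r")
      case True
      then show ?thesis by (cases "f i") (auto simp: bits_of_def)
    next
      case False
      then show ?thesis using f by (auto simp: bits_of_def bit_vectors_def)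
    qed
  qed
qed

text \<open>An injective homomorphism into a vector space turns products into sums of coordinates.\<close>

locale group_coordinates = comm_group K
  for K :: "('g, 'b) monoid_scheme" (structure) +
  fixes \<theta> :: "'g \<Rightarrow> 'v::ab_group_add"
  assumes \<theta>_mult: "\<And>x y. x \<in> carrier K \<Longrightarrow> y \<in> carrier K \<Longrightarrow> \<theta> (x \<otimes> y) = \<theta> x + \<theta> y"
    and \<theta>_inj: "inj_on \<theta> (carrier K)"
begin

lemma \<theta>_one: "\<theta> \<one> = 0"
  using \<theta>_mult[OF one_closed one_closed] by simp

lemma \<theta>_eq_0_iff: "x \<in> carrier K \<Longrightarrow> \<theta> x = 0 \<longleftrightarrow> x = \<one>"
  using inj_onD[OF \<theta>_inj _ _ one_closed] \<theta>_one by metis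

lemma \<theta>_mset_prod:
  assumes "set_mset S \<subseteq> carrier K"
  shows "mset_prod K S \<in> carrier K \<and> \<theta> (mset_prod K S) = \<Sum>\<^sub># (image_mset \<theta> S)"
  using assms by (induction S) (auto simp: mset_prod_empty \<theta>_one mset_prod_add \<theta>_mult)

lemma carrier_zero_sum_monoid:
  "carrier (zero_sum_monoid K) = {S. set_mset S \<subseteq> carrier K \<and> zero_sum \<theta> S}"
proof -
  have "mset_prod K S = \<one> \<longleftrightarrow> zero_sum \<theta> S" if "set_mset S \<subseteq> carrier K" for S
    using \<theta>_mset_prod[OF that] \<theta>_eq_0_iff[of "mset_prod K S"] by (simp add: zero_sum_def)
  then show ?thesis by (auto simp: zero_sum_monoid_def free_monoid_def)
qed

lemma mult_zero_sum_monoid: "(\<otimes>\<^bsub>zero_sum_monoid K\<^esub>) = (+)" "\<one>\<^bsub>zero_sum_monoid K\<^esub> = {#}"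
  by (simp_all add: zero_sum_monoid_def free_monoid_def)

lemma zero_sum_monoid_cancel: "comm_monoid_cancel (zero_sum_monoid K)"
proof (rule comm_monoid_cancelI)
  show "comm_monoid (zero_sum_monoid K)"
    by (rule comm_monoidI) (auto simp: mult_zero_sum_monoid carrier_zero_sum_monoid zero_sum_plus ac_simps)
qed (simp add: mult_zero_sum_monoid)

lemma zero_sum_monoid_model:
  "zero_sum_model (zero_sum_monoid K) (image_mset \<theta>) (\<theta> ` carrier K) (\<lambda>x. x)"
proof (intro zero_sum_model.intro zero_sum_model_axioms.intro zero_sum_monoid_cancel)
  show "image_mset \<theta> (a \<otimes>\<^bsub>zero_sum_monoid K\<^esub> b) = image_mset \<theta> a + image_mset \<theta> b" for a b
    by (simp add: mult_zero_sum_monoid)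
  show "image_mset \<theta> \<one>\<^bsub>zero_sum_monoid K\<^esub> = {#}" by (simp add: mult_zero_sum_monoid)
  let ?g = "inv_into (carrier K) \<theta>"
  have g: "image_mset ?g (image_mset \<theta> a) = a" if a: "set_mset a \<subseteq> carrier K" for a
  proof -
    have "image_mset ?g (image_mset \<theta> a) = image_mset (\<lambda>x. x) a"
      unfolding image_mset.compositionality comp_def
      by (rule image_mset_cong) (use a inv_into_f_f[OF \<theta>_inj] in blast)
    then show ?thesis by simp
  qed
  show "a divides\<^bsub>zero_sum_monoid K\<^esub> b"
    if a: "a \<in> carrier (zero_sum_monoid K)" and b: "b \<in> carrier (zero_sum_monoid K)"
      and sub: "image_mset \<theta> a \<subseteq># image_mset \<theta> b" for a b
  proof -
    have aK: "set_mset a \<subseteq> carrier K" "zero_sum \<theta> a" and bK: "set_mset b \<subseteq> carrier K" "zero_sum \<theta> b"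
      using a b by (auto simp: carrier_zero_sum_monoid)
    have "a \<subseteq># b" using image_mset_subseteq_mono[OF sub, of ?g] g aK bK by simp
    then have eq: "b = a + (b - a)" by simp
    have "zero_sum \<theta> (b - a)" using bK(2) zero_sum_plus[OF aK(2), of "b - a"] eq by simp
    moreover have "set_mset (b - a) \<subseteq> carrier K" using bK(1) by (meson in_diffD subset_iff)
    ultimately have "b - a \<in> carrier (zero_sum_monoid K)" by (simp add: carrier_zero_sum_monoid)
    then show ?thesis using eq by (auto simp: mult_zero_sum_monoid intro!: dividesI)
  qed
  show "image_mset \<theta> ` carrier (zero_sum_monoid K)
      = {b. set_mset b \<subseteq> \<theta> ` carrier K \<and> zero_sum (\<lambda>x. x) b}"
  proof (intro subset_antisym subsetI)
    fix b assume "b \<in> image_mset \<theta> ` carrier (zero_sum_monoid K)"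
    then obtain S where "set_mset S \<subseteq> carrier K" "zero_sum \<theta> S" "b = image_mset \<theta> S"
      unfolding carrier_zero_sum_monoid by blast
    then show "b \<in> {b. set_mset b \<subseteq> \<theta> ` carrier K \<and> zero_sum (\<lambda>x. x) b}"
      by (simp add: zero_sum_def image_mono)
  next
    fix b assume b: "b \<in> {b. set_mset b \<subseteq> \<theta> ` carrier K \<and> zero_sum (\<lambda>x. x) b}"
    have "image_mset \<theta> (image_mset ?g b) = image_mset (\<lambda>x. x) b"
      unfolding image_mset.compositionality comp_def
      by (rule image_mset_cong, rule f_inv_into_f) (use b in auto)
    then have eq: "b = image_mset \<theta> (image_mset ?g b)" by simp
    have "?g x \<in> carrier K" if "x \<in># b" for x
      using b that by (intro inv_into_into) auto
    then have "set_mset (image_mset ?g b) \<subseteq> carrier K" by auto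
    moreover have "zero_sum \<theta> (image_mset ?g b)"
      using b unfolding zero_sum_image[of \<theta>] eq[symmetric] by simp
    ultimately show "b \<in> image_mset \<theta> ` carrier (zero_sum_monoid K)"
      by (intro image_eqI[where x = "image_mset ?g b"] eq) (simp add: carrier_zero_sum_monoid)
  qed
qed

end

context
  fixes P :: "'p set"
begin

abbreviation Div :: "'p multiset monoid" where "Div \<equiv> free_monoid P"

abbreviation Quot :: "('p multiset \<times> 'p multiset) set monoid" where "Quot \<equiv> quotient_group Div"

lemma Div_simps: "carrier Div = {a. set_mset a \<subseteq> P}" "(\<otimes>\<^bsub>Div\<^esub>) = (+)" "\<one>\<^bsub>Div\<^esub> = {#}"
  by (simp_all add: free_monoid_def)

lemma Div_divides:
  assumes "set_mset b \<subseteq> P"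
  shows "a divides\<^bsub>Div\<^esub> b \<longleftrightarrow> a \<subseteq># b"
proof
  assume "a divides\<^bsub>Div\<^esub> b"
  then show "a \<subseteq># b" by (auto simp: factor_def Div_simps)
next
  assume ab: "a \<subseteq># b"
  have "set_mset (b - a) \<subseteq> P" using assms by (meson in_diffD subset_iff)
  moreover have "b = a + (b - a)" using ab by simp
  ultimately show "a divides\<^bsub>Div\<^esub> b" by (auto simp: factor_def Div_simps)
qed

lemma fraction_eq:
  assumes "set_mset a \<subseteq> P" "set_mset b \<subseteq> P"
  shows "fraction Div a b = {(x, y). set_mset x \<subseteq> P \<and> set_mset y \<subseteq> P \<and> a + y = x + b}"
  using assms by (auto simp: fraction_def frac_rel_def Div_simps)

lemma fraction_eq_iff:
  assumes "set_mset a \<subseteq> P" "set_mset b \<subseteq> P" "set_mset x \<subseteq> P" "set_mset y \<subseteq> P"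
  shows "fraction Div a b = fraction Div x y \<longleftrightarrow> a + y = x + b"
proof
  assume "fraction Div a b = fraction Div x y"
  moreover have "(x, y) \<in> fraction Div x y" using assms by (simp add: fraction_eq)
  ultimately have "(x, y) \<in> fraction Div a b" by (simp only:)
  then show "a + y = x + b" using assms by (simp add: fraction_eq)
next
  assume eq: "a + y = x + b"
  have "a + w = v + b \<longleftrightarrow> x + w = v + y" for v w
  proof
    assume "a + w = v + b"
    then have "(a + y) + w + b = (x + b) + w + b \<and> a + w + y = v + b + y" using eq by simp
    then have "x + w + b = v + y + b" using eq by (metis add.assoc add.commute)
    then show "x + w = v + y" by simp
  next
    assume "x + w = v + y"
    then have "x + w + b = v + y + b" by simp
    then have "a + w + y = v + b + y" using eq by (metis add.assoc add.commute)
    then show "a + w = v + b" by simp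
  qed
  then show "fraction Div a b = fraction Div x y" using assms by (simp add: fraction_eq)
qed

lemma fraction_mult:
  assumes "set_mset a \<subseteq> P" "set_mset b \<subseteq> P" "set_mset x \<subseteq> P" "set_mset y \<subseteq> P"
  shows "fraction Div a b \<otimes>\<^bsub>Quot\<^esub> fraction Div x y = fraction Div (a + x) (b + y)"
proof -
  have same: "fraction Div (a' + x') (b' + y') = fraction Div (a + x) (b + y)"
    if "(a', b') \<in> fraction Div a b" "(x', y') \<in> fraction Div x y" for a' b' x' y'
  proof -
    have s: "set_mset a' \<subseteq> P" "set_mset b' \<subseteq> P" "set_mset x' \<subseteq> P" "set_mset y' \<subseteq> P"
      and e: "a + b' = a' + b" "x + y' = x' + y"
      using that assms by (auto simp: fraction_eq)
    have "(a + b') + (x + y') = (a' + b) + (x' + y)" by (simp only: e)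
    then have "(a' + x') + (b + y) = (a + x) + (b' + y')" by (simp only: ac_simps)
    then show ?thesis using s assms by (subst fraction_eq_iff) auto
  qed
  have mem: "(a, b) \<in> fraction Div a b" "(x, y) \<in> fraction Div x y"
    using assms by (simp_all add: fraction_eq)
  have "(\<Union>(a', b')\<in>fraction Div a b. \<Union>(x', y')\<in>fraction Div x y. fraction Div (a' + x') (b' + y'))
      = fraction Div (a + x) (b + y)"
  proof (intro subset_antisym subsetI)
    fix t
    assume "t \<in> (\<Union>(a', b')\<in>fraction Div a b. \<Union>(x', y')\<in>fraction Div x y.
      fraction Div (a' + x') (b' + y'))"
    then obtain a' b' x' y' where "(a', b') \<in> fraction Div a b" "(x', y') \<in> fraction Div x y"
      "t \<in> fraction Div (a' + x') (b' + y')" by blast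
    then show "t \<in> fraction Div (a + x) (b + y)" using same by blast
  qed (use mem in blast)
  then show ?thesis by (simp add: quotient_group_def Div_simps)
qed

lemma carrier_Quot: "carrier Quot = {fraction Div a b | a b. set_mset a \<subseteq> P \<and> set_mset b \<subseteq> P}"
  by (simp add: quotient_group_def Div_simps)

lemma fraction_closed: "set_mset a \<subseteq> P \<Longrightarrow> set_mset b \<subseteq> P \<Longrightarrow> fraction Div a b \<in> carrier Quot"
  by (auto simp: carrier_Quot)

lemma one_Quot: "\<one>\<^bsub>Quot\<^esub> = fraction Div {#} {#}"
  by (simp add: quotient_group_def Div_simps)

lemma Quot_comm_group: "comm_group Quot"
proof (rule comm_groupI)
  fix x y z assume xyz: "x \<in> carrier Quot" "y \<in> carrier Quot" "z \<in> carrier Quot"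
  obtain a b where x: "x = fraction Div a b" "set_mset a \<subseteq> P" "set_mset b \<subseteq> P"
    using xyz(1) by (auto simp: carrier_Quot)
  obtain a' b' where y: "y = fraction Div a' b'" "set_mset a' \<subseteq> P" "set_mset b' \<subseteq> P"
    using xyz(2) by (auto simp: carrier_Quot)
  obtain a'' b'' where z: "z = fraction Div a'' b''" "set_mset a'' \<subseteq> P" "set_mset b'' \<subseteq> P"
    using xyz(3) by (auto simp: carrier_Quot)
  show "x \<otimes>\<^bsub>Quot\<^esub> y \<otimes>\<^bsub>Quot\<^esub> z = x \<otimes>\<^bsub>Quot\<^esub> (y \<otimes>\<^bsub>Quot\<^esub> z)"
    using x y z by (simp add: fraction_mult add.assoc)
next
  fix x y assume xy: "x \<in> carrier Quot" "y \<in> carrier Quot"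
  obtain a b where x: "x = fraction Div a b" "set_mset a \<subseteq> P" "set_mset b \<subseteq> P"
    using xy(1) by (auto simp: carrier_Quot)
  obtain a' b' where y: "y = fraction Div a' b'" "set_mset a' \<subseteq> P" "set_mset b' \<subseteq> P"
    using xy(2) by (auto simp: carrier_Quot)
  show "x \<otimes>\<^bsub>Quot\<^esub> y \<in> carrier Quot" using x y by (simp add: fraction_mult fraction_closed)
  show "x \<otimes>\<^bsub>Quot\<^esub> y = y \<otimes>\<^bsub>Quot\<^esub> x" using x y by (simp add: fraction_mult add.commute)
next
  show "\<one>\<^bsub>Quot\<^esub> \<in> carrier Quot" by (simp add: one_Quot fraction_closed)
  fix x assume "x \<in> carrier Quot"
  then obtain a b where x: "x = fraction Div a b" "set_mset a \<subseteq> P" "set_mset b \<subseteq> P"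
    by (auto simp: carrier_Quot)
  show "\<one>\<^bsub>Quot\<^esub> \<otimes>\<^bsub>Quot\<^esub> x = x" using x by (simp add: fraction_mult one_Quot)
  have "fraction Div b a \<otimes>\<^bsub>Quot\<^esub> x = \<one>\<^bsub>Quot\<^esub>"
    using x by (simp add: fraction_mult one_Quot fraction_eq_iff add.commute)
  then show "\<exists>y\<in>carrier Quot. y \<otimes>\<^bsub>Quot\<^esub> x = \<one>\<^bsub>Quot\<^esub>" using x fraction_closed by blast
qed

end

text \<open>
  The class of a divisor is trivial exactly if the divisor is principal. Therefore a divisor
  homomorphism identifies \<open>H\<close> up to units with the divisors of class sum zero.
\<close>

locale divisor_data = comm_monoid_cancel H
  for H :: "('a, 'b) monoid_scheme" (structure) +
  fixes P :: "'p set" and \<phi> :: "'a \<Rightarrow> 'p multiset"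
  assumes dh: "divisor_homomorphism H (free_monoid P) \<phi>"
begin

abbreviation "Quo \<equiv> quotient_group (free_monoid P)"

abbreviation "Prin \<equiv> quotient_subgroup (free_monoid P) (\<phi> ` carrier H)"

lemma \<phi>_closed: "a \<in> carrier H \<Longrightarrow> set_mset (\<phi> a) \<subseteq> P"
  using dh by (auto simp: divisor_homomorphism_def hom_def free_monoid_def)

lemma \<phi>_mult: "a \<in> carrier H \<Longrightarrow> b \<in> carrier H \<Longrightarrow> \<phi> (a \<otimes> b) = \<phi> a + \<phi> b"
  using dh by (auto simp: divisor_homomorphism_def hom_def free_monoid_def)

lemma \<phi>_one: "\<phi> \<one> = {#}"
  using dh by (auto simp: divisor_homomorphism_def free_monoid_def)

lemma \<phi>_divides:
  "a \<in> carrier H \<Longrightarrow> b \<in> carrier H \<Longrightarrow> \<phi> a \<subseteq># \<phi> b \<Longrightarrow> a divides b"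
  using dh Div_divides \<phi>_closed unfolding divisor_homomorphism_def by metis

sublocale Q: comm_group Quo by (rule Quot_comm_group)

lemma Prin_subgroup: "subgroup Prin Quo"
proof (rule Q.subgroupI)
  show "Prin \<subseteq> carrier Quo"
    using \<phi>_closed by (auto simp: quotient_subgroup_def carrier_Quot)
  have "fraction (free_monoid P) (\<phi> \<one>) (\<phi> \<one>) \<in> Prin"
    unfolding quotient_subgroup_def using one_closed by blast
  then show "Prin \<noteq> {}" by blast
  fix x assume "x \<in> Prin"
  then obtain a b where x: "x = fraction (free_monoid P) (\<phi> a) (\<phi> b)" "a \<in> carrier H" "b \<in> carrier H"
    by (auto simp: quotient_subgroup_def)
  let ?y = "fraction (free_monoid P) (\<phi> b) (\<phi> a)"
  have "?y \<otimes>\<^bsub>Quo\<^esub> x = \<one>\<^bsub>Quo\<^esub>"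
    using x \<phi>_closed by (simp add: fraction_mult one_Quot fraction_eq_iff add.commute)
  then have "inv\<^bsub>Quo\<^esub> x = ?y"
    using x \<phi>_closed by (intro Q.inv_equality) (auto intro: fraction_closed)
  then show "inv\<^bsub>Quo\<^esub> x \<in> Prin" using x by (auto simp: quotient_subgroup_def)
  fix y assume "y \<in> Prin"
  then obtain a' b' where y: "y = fraction (free_monoid P) (\<phi> a') (\<phi> b')" "a' \<in> carrier H" "b' \<in> carrier H"
    by (auto simp: quotient_subgroup_def)
  have "x \<otimes>\<^bsub>Quo\<^esub> y = fraction (free_monoid P) (\<phi> (a \<otimes> a')) (\<phi> (b \<otimes> b'))"
    using x y \<phi>_closed by (simp add: fraction_mult \<phi>_mult)
  then show "x \<otimes>\<^bsub>Quo\<^esub> y \<in> Prin"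
    using x y unfolding quotient_subgroup_def by blast
qed

sublocale N: normal Prin Quo by (rule Q.subgroup_imp_normal[OF Prin_subgroup])

abbreviation "Cl \<equiv> class_group H P \<phi>"

definition divisor_class :: "'p multiset \<Rightarrow> ('p multiset \<times> 'p multiset) set set"
  where "divisor_class b = Prin #>\<^bsub>Quo\<^esub> fraction (free_monoid P) b {#}"

lemma Cl_comm_group: "comm_group Cl"
proof -
  interpret C: group Cl unfolding class_group_def by (rule N.factorgroup_is_group)
  show ?thesis
  proof (rule C.group_comm_groupI)
    fix X Y assume "X \<in> carrier Cl" "Y \<in> carrier Cl"
    then obtain x y where "x \<in> carrier Quo" "y \<in> carrier Quo" "X = Prin #>\<^bsub>Quo\<^esub> x" "Y = Prin #>\<^bsub>Quo\<^esub> y"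
      by (auto simp: class_group_def carrier_FactGroup)
    then show "X \<otimes>\<^bsub>Cl\<^esub> Y = Y \<otimes>\<^bsub>Cl\<^esub> X"
      by (simp add: class_group_def N.rcos_sum Q.m_comm)
  qed
qed

lemma divisor_class_closed: "set_mset b \<subseteq> P \<Longrightarrow> divisor_class b \<in> carrier Cl"
  by (auto simp: divisor_class_def class_group_def carrier_FactGroup intro!: imageI fraction_closed)

lemma divisor_class_plus:
  assumes "set_mset a \<subseteq> P" "set_mset b \<subseteq> P"
  shows "divisor_class (a + b) = divisor_class a \<otimes>\<^bsub>Cl\<^esub> divisor_class b"
  using assms N.rcos_sum[of "fraction (free_monoid P) a {#}" "fraction (free_monoid P) b {#}"]
  by (simp add: divisor_class_def class_group_def fraction_closed fraction_mult)

lemma one_Cl: "\<one>\<^bsub>Cl\<^esub> = Prin"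
  by (simp add: class_group_def)

lemma divisor_class_eq_one_iff:
  assumes b: "set_mset b \<subseteq> P"
  shows "divisor_class b = \<one>\<^bsub>Cl\<^esub> \<longleftrightarrow> b \<in> \<phi> ` carrier H"
proof -
  have fb: "fraction (free_monoid P) b {#} \<in> carrier Quo" using b by (simp add: fraction_closed)
  have "divisor_class b = \<one>\<^bsub>Cl\<^esub> \<longleftrightarrow> fraction (free_monoid P) b {#} \<in> Prin"
    unfolding divisor_class_def one_Cl
    using Q.coset_join1[OF _ fb Prin_subgroup] Q.coset_join2[OF fb Prin_subgroup] by blast
  also have "\<dots> \<longleftrightarrow> (\<exists>x\<in>carrier H. \<exists>y\<in>carrier H. b + \<phi> y = \<phi> x)"
  proof
    assume "fraction (free_monoid P) b {#} \<in> Prin"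
    then obtain x y where "x \<in> carrier H" "y \<in> carrier H"
      "fraction (free_monoid P) b {#} = fraction (free_monoid P) (\<phi> x) (\<phi> y)"
      unfolding quotient_subgroup_def by blast
    moreover from this have "b + \<phi> y = \<phi> x"
      using b \<phi>_closed by (subst (asm) fraction_eq_iff) auto
    ultimately show "\<exists>x\<in>carrier H. \<exists>y\<in>carrier H. b + \<phi> y = \<phi> x" by blast
  next
    assume "\<exists>x\<in>carrier H. \<exists>y\<in>carrier H. b + \<phi> y = \<phi> x"
    then obtain x y where "x \<in> carrier H" "y \<in> carrier H" "b + \<phi> y = \<phi> x" by blast
    moreover from this have "fraction (free_monoid P) b {#} = fraction (free_monoid P) (\<phi> x) (\<phi> y)"
      using b \<phi>_closed by (subst fraction_eq_iff) auto
    ultimately show "fraction (free_monoid P) b {#} \<in> Prin"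
      unfolding quotient_subgroup_def by blast
  qed
  also have "\<dots> \<longleftrightarrow> b \<in> \<phi> ` carrier H"
  proof
    assume "\<exists>x\<in>carrier H. \<exists>y\<in>carrier H. b + \<phi> y = \<phi> x"
    then obtain x y where xy: "x \<in> carrier H" "y \<in> carrier H" "b + \<phi> y = \<phi> x" by blast
    then have "\<phi> y \<subseteq># \<phi> x" by (metis mset_subset_eq_add_right)
    then have "y divides x" using \<phi>_divides xy by blast
    then obtain d where d: "d \<in> carrier H" "x = y \<otimes> d" by (rule dividesE)
    then have "b = \<phi> d" using xy by (simp add: \<phi>_mult)
    then show "b \<in> \<phi> ` carrier H" using d by blast
  next
    assume "b \<in> \<phi> ` carrier H"
    then obtain d where "d \<in> carrier H" "b = \<phi> d" by blast
    then show "\<exists>x\<in>carrier H. \<exists>y\<in>carrier H. b + \<phi> y = \<phi> x"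
      using \<phi>_one by (intro bexI[of _ d] bexI[of _ \<one>]) auto
  qed
  finally show ?thesis .
qed

lemma divisor_class_empty: "divisor_class {#} = \<one>\<^bsub>Cl\<^esub>"
proof -
  have "{#} \<in> \<phi> ` carrier H" using \<phi>_one one_closed by (metis imageI)
  then show ?thesis using divisor_class_eq_one_iff[of "{#}"] by simp
qed

lemma prime_class_eq: "prime_class H P \<phi> p = divisor_class {#p#}"
  by (simp add: prime_class_def divisor_class_def)

end

locale krull_coordinates = divisor_data H P \<phi> + group_coordinates "class_group H P \<phi>" \<theta>
  for H :: "('a, 'b) monoid_scheme" (structure) and P :: "'p set" and \<phi> :: "'a \<Rightarrow> 'p multiset"
    and \<theta> :: "('p multiset \<times> 'p multiset) set set \<Rightarrow> 'v::ab_group_add"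
begin

definition prime_coord :: "'p \<Rightarrow> 'v"
  where "prime_coord p = \<theta> (prime_class H P \<phi> p)"

lemma \<theta>_divisor_class: "set_mset b \<subseteq> P \<Longrightarrow> \<theta> (divisor_class b) = (\<Sum>p\<in>#b. prime_coord p)"
proof (induction b)
  case empty
  then show ?case by (simp add: divisor_class_empty \<theta>_one)
next
  case (add p b)
  have "divisor_class ({#p#} + b) = divisor_class {#p#} \<otimes>\<^bsub>Cl\<^esub> divisor_class b"
    using add.prems by (intro divisor_class_plus) auto
  then show ?case
    using add divisor_class_closed[of "{#p#}"] divisor_class_closed[of b]
    by (simp add: \<theta>_mult prime_coord_def prime_class_eq)
qed

lemma krull_model: "zero_sum_model H \<phi> P prime_coord"
proof
  show "\<phi> ` carrier H = {b. set_mset b \<subseteq> P \<and> zero_sum prime_coord b}"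
  proof -
    have "b \<in> \<phi> ` carrier H \<longleftrightarrow> zero_sum prime_coord b" if b: "set_mset b \<subseteq> P" for b
      using divisor_class_eq_one_iff[OF b] \<theta>_eq_0_iff[OF divisor_class_closed[OF b]] \<theta>_divisor_class[OF b]
      by (simp add: zero_sum_def)
    then show ?thesis using \<phi>_closed by blast
  qed
qed (simp_all add: \<phi>_mult \<phi>_one \<phi>_divides)

end

text \<open>
  In rank one the nontrivial class contains two primes: if \<open>q\<close> were the only one, it would divide
  every principal divisor to an even power and could not be a greatest common divisor.
\<close>

lemma rank_one_two_primes:
  assumes dt: "divisor_theory H P \<phi>" and model: "zero_sum_model H \<phi> P c"
    and cm: "class_map G r P c" and r: "r = 1"
  shows "\<exists>p\<in>P. \<exists>q\<in>P. p \<noteq> q \<and> c p = c q \<and> c q \<noteq> 0"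
proof -
  interpret class_map G r P c by (rule cm)
  interpret M: zero_sum_model H \<phi> P c by (rule model)
  have card: "card G = 2" using card_G r by simp
  then have "G \<noteq> {0}" by auto
  then obtain v where v: "v \<in> G" "v \<noteq> 0" using zero_in by blast
  have "{0, v} = G" using v zero_in card by (intro card_subset_eq[OF finite_G]) auto
  then have G: "x = 0 \<or> x = v" if "x \<in> G" for x using that by blast
  obtain q where q: "q \<in> P" "c q = v" using v(1) surj by blast
  have "\<exists>p\<in>P. p \<noteq> q \<and> c p = v"
  proof (rule ccontr)
    assume none: "\<not> ?thesis"
    have zero: "c p = 0" if "p \<in> P" "p \<noteq> q" for p
      using G[of "c p"] none that surj by blast
    have sum: "(\<Sum>p\<in>#b. c p) = (if even (count b q) then 0 else v)" if "set_mset b \<subseteq> P" for b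
      using that by (induction b) (auto simp: zero q double)
    have even: "even (count (\<phi> a) q)" if "a \<in> carrier H" for a
    proof -
      have "set_mset (\<phi> a) \<subseteq> P" "zero_sum c (\<phi> a)" using M.\<psi>_image that by blast+
      then show ?thesis using sum[of "\<phi> a"] v(2) by (simp add: zero_sum_def split: if_splits)
    qed
    obtain A where A: "A \<subseteq> carrier H"
      "is_glb (division_rel (free_monoid P)) {#q#} (\<phi> ` A)"
      using dt q(1) unfolding divisor_theory_def by blast
    let ?L = "Lower (division_rel (free_monoid P)) (\<phi> ` A)"
    have in_L: "d \<in> ?L \<longleftrightarrow> set_mset d \<subseteq> P \<and> (\<forall>a\<in>A. d \<subseteq># \<phi> a)" for d
    proof -
      have P: "set_mset (\<phi> a) \<subseteq> P" if "a \<in> A" for a using M.\<psi>_image A(1) that by blast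
      then show ?thesis
        using Div_divides[of _ P d] by (auto simp: Lower_def Div_simps)
    qed
    have gr: "{#q#} \<in> ?L" "\<And>d. d \<in> ?L \<Longrightarrow> d divides\<^bsub>free_monoid P\<^esub> {#q#}"
      using A(2) by (auto simp: greatest_def)
    have "{#q, q#} \<subseteq># \<phi> a" if a: "a \<in> A" for a
    proof -
      have "{#q#} \<subseteq># \<phi> a" using gr(1) a in_L by blast
      then have "1 \<le> count (\<phi> a) q" by (simp add: Suc_le_eq)
      moreover have "even (count (\<phi> a) q)" using even A(1) a by blast
      ultimately have "2 \<le> count (\<phi> a) q" by presburger
      then show ?thesis by (simp add: subseteq_mset_def)
    qed
    then have "{#q, q#} \<in> ?L" using q(1) in_L by simp
    then have "{#q, q#} divides\<^bsub>free_monoid P\<^esub> {#q#}" by (rule gr(2))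
    then have "{#q, q#} \<subseteq># {#q#}" by (subst (asm) Div_divides) (simp_all add: q(1))
    then have "size {#q, q#} \<le> size {#q#}" by (rule size_mset_mono)
    then show False by simp
  qed
  then obtain p where "p \<in> P" "p \<noteq> q" "c p = v" by blast
  then show ?thesis using q v(2) by (intro bexI[of _ p] bexI[of _ q]) simp_all
qed

lemma enat_eqI: "x \<le> enat (Suc n) \<Longrightarrow> \<not> x \<le> enat n \<Longrightarrow> x = enat (Suc n)"
  by (metis antisym Suc_ile_eq not_le)

lemma enat_eq_if_same_bounds:
  assumes "\<And>n. x \<le> enat n \<longleftrightarrow> y \<le> enat n"
  shows "x = y"
  by (metis assms antisym enat_ord_code(3) not_enat_eq order_refl)

theorem theorem5p1:
  fixes H :: "('a, 'b) monoid_scheme" and P :: "'p set" and \<phi> :: "'a \<Rightarrow> 'p multiset" and r :: nat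
  assumes "comm_monoid_cancel H"
    and "divisor_theory H P \<phi>"
    and "r \<ge> 1"
    and "class_group H P \<phi> \<cong> elementary_2_group r"
    and "\<forall>g \<in> carrier (class_group H P \<phi>). \<exists>p\<in>P. prime_class H P \<phi> p = g"
  shows "(r = 1 \<longrightarrow>
            tame_degree H = 2 \<and> tame_degree (zero_sum_monoid (class_group H P \<phi>)) = 0) \<and>
         (r = 3 \<longrightarrow>
            tame_degree (zero_sum_monoid (class_group H P \<phi>)) = 4 \<and>
            ((\<exists>g \<in> carrier (class_group H P \<phi>). g \<noteq> \<one>\<^bsub>class_group H P \<phi>\<^esub> \<and>
               (\<exists>p\<in>P. \<exists>q\<in>P. p \<noteq> q \<and> prime_class H P \<phi> p = g \<and> prime_class H P \<phi> q = g)) \<longrightarrow>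
             tame_degree H = 5)) \<and>
         (r \<ge> 2 \<and> even r \<longrightarrow>
            tame_degree H = tame_degree (zero_sum_monoid (class_group H P \<phi>)) \<and>
            tame_degree (zero_sum_monoid (class_group H P \<phi>)) = enat (1 + r ^ 2 div 2)) \<and>
         (r \<ge> 5 \<and> odd r \<longrightarrow>
            tame_degree H = tame_degree (zero_sum_monoid (class_group H P \<phi>)) \<and>
            tame_degree (zero_sum_monoid (class_group H P \<phi>)) \<ge> enat (2 + r * (r - 1) div 2))"
proof -
  let ?K = "class_group H P \<phi>"
  obtain h where h: "h \<in> iso ?K (elementary_2_group r)"
    using assms(4) by (auto simp: is_iso_def)
  define \<theta> where "\<theta> = bits_of r \<circ> h"
  have div_data: "divisor_data H P \<phi>"
    using assms(1,2) by (simp add: divisor_data_def divisor_data_axioms_def divisor_theory_def)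
  then interpret D: divisor_data H P \<phi> .
  have bij_h: "bij_betw h (carrier ?K) (carrier (elementary_2_group r))"
    and hom_h: "h \<in> hom ?K (elementary_2_group r)" using h by (auto simp: iso_def)
  have bij: "bij_betw \<theta> (carrier ?K) (bit_vectors r)"
    unfolding \<theta>_def by (rule bij_betw_trans[OF bij_h bits_of_bij])
  have coords: "group_coordinates ?K \<theta>"
  proof (intro group_coordinates.intro group_coordinates_axioms.intro D.Cl_comm_group)
    show "\<theta> (x \<otimes>\<^bsub>?K\<^esub> y) = \<theta> x + \<theta> y" if "x \<in> carrier ?K" "y \<in> carrier ?K" for x y
      using hom_mult[OF hom_h that] by (simp add: \<theta>_def bits_of_mult)
    show "inj_on \<theta> (carrier ?K)" using bij by (rule bij_betw_imp_inj_on)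
  qed
  interpret C: krull_coordinates H P \<phi> \<theta>
    by (rule krull_coordinates.intro[OF div_data coords])
  let ?G = "bit_vectors r" and ?c = "C.prime_coord"
  interpret V: elementary_2_space ?G r by (rule elementary_2_space_bit_vectors)
  have primes: "prime_class H P \<phi> ` P = carrier ?K"
  proof (intro subset_antisym subsetI)
    fix g assume "g \<in> prime_class H P \<phi> ` P"
    then obtain p where p: "p \<in> P" "g = D.divisor_class {#p#}" unfolding D.prime_class_eq by blast
    show "g \<in> carrier ?K" unfolding p(2) by (rule D.divisor_class_closed) (simp add: p(1))
  next
    fix g assume "g \<in> carrier ?K"
    then obtain p where p: "p \<in> P" "prime_class H P \<phi> p = g" using assms(5) by (elim ballE bexE) auto
    show "g \<in> prime_class H P \<phi> ` P" unfolding p(2)[symmetric] by (rule imageI[OF p(1)])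
  qed
  have "?c ` P = \<theta> ` prime_class H P \<phi> ` P"
    by (simp add: image_image C.prime_coord_def)
  then have surj: "?c ` P = ?G" unfolding primes using bij by (simp add: bij_betw_imp_surj_on)
  interpret M: class_map ?G r P ?c by unfold_locales (rule surj)
  interpret S: class_map ?G r ?G "\<lambda>x. x" by (rule V.class_map_self)
  have model_H: "zero_sum_model H \<phi> P ?c" by (rule C.krull_model)
  have tH: "tame_degree H \<le> enat N \<longleftrightarrow> tame_bound ?c P N" for N
    by (rule zero_sum_model.tame_degree_le_iff[OF model_H])
  have tG: "tame_degree (zero_sum_monoid ?K) \<le> enat N \<longleftrightarrow> tame_bound (\<lambda>x. x) ?G N" for N
    using zero_sum_model.tame_degree_le_iff[OF C.zero_sum_monoid_model]
    by (simp only: bij_betw_imp_surj_on[OF bij])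
  have "tame_degree H = 2 \<and> tame_degree (zero_sum_monoid ?K) = 0" if r: "r = 1"
  proof
    obtain p q where "p \<in> P" "q \<in> P" "p \<noteq> q" "?c p = ?c q" "?c q \<noteq> 0"
      using rank_one_two_primes[OF assms(2) model_H M.class_map_axioms r] by blast
    then have "\<not> tame_bound ?c P 1" by (rule M.tame_bound_rank_1_lower)
    then have "tame_degree H = enat (Suc 1)"
      using M.tame_bound_1[OF r] by (intro enat_eqI) (simp_all add: tH numeral_2_eq_2)
    then show "tame_degree H = 2" by (simp add: numeral_eq_enat numeral_2_eq_2)
    have "tame_degree (zero_sum_monoid ?K) \<le> enat 0" unfolding tG by (rule V.tame_bound_group_1[OF r])
    then show "tame_degree (zero_sum_monoid ?K) = 0" by (simp add: zero_enat_def[symmetric])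
  qed
  moreover have "tame_degree (zero_sum_monoid ?K) = 4 \<and>
      ((\<exists>g \<in> carrier ?K. g \<noteq> \<one>\<^bsub>?K\<^esub> \<and>
          (\<exists>p\<in>P. \<exists>q\<in>P. p \<noteq> q \<and> prime_class H P \<phi> p = g \<and> prime_class H P \<phi> q = g)) \<longrightarrow>
        tame_degree H = 5)" if r: "r = 3"
  proof (intro conjI impI)
    have ub: "tame_bound (\<lambda>x. x) ?G 4" by (rule V.tame_bound_group_3[OF r])
    have "\<not> tame_bound (\<lambda>x. x) ?G 3" using S.tame_bound_square_lower r by simp
    then have "tame_degree (zero_sum_monoid ?K) = enat (Suc 3)"
      using ub by (intro enat_eqI) (simp_all add: tG)
    then show "tame_degree (zero_sum_monoid ?K) = 4" by (simp add: numeral_eq_enat)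
    assume "\<exists>g \<in> carrier ?K. g \<noteq> \<one>\<^bsub>?K\<^esub> \<and>
      (\<exists>p\<in>P. \<exists>q\<in>P. p \<noteq> q \<and> prime_class H P \<phi> p = g \<and> prime_class H P \<phi> q = g)"
    then obtain g p q where g: "g \<in> carrier ?K" "g \<noteq> \<one>\<^bsub>?K\<^esub>"
      and pq: "p \<in> P" "q \<in> P" "p \<noteq> q" "prime_class H P \<phi> p = g" "prime_class H P \<phi> q = g" by blast
    have "\<theta> g \<noteq> 0" using C.\<theta>_eq_0_iff[OF g(1)] g(2) by simp
    then have "\<not> tame_bound ?c P (1 + r * (r - 1) div 2)"
      using pq r by (intro M.tame_bound_odd_lower_two_primes[of p q]) (simp_all add: C.prime_coord_def)
    then have "\<not> tame_bound ?c P 4" using r by simp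
    moreover have "tame_bound ?c P 5"
      using r tame_bound_mono[OF ub, of 5] by (intro M.tame_bound_transfer) simp_all
    ultimately have "tame_degree H = enat (Suc 4)" by (intro enat_eqI) (simp_all add: tH)
    then show "tame_degree H = 5" by (simp add: numeral_eq_enat)
  qed
  moreover have "tame_degree H = tame_degree (zero_sum_monoid ?K) \<and>
      tame_degree (zero_sum_monoid ?K) = enat (1 + r ^ 2 div 2)" if r: "r \<ge> 2 \<and> even r"
  proof -
    have "tame_degree H = enat (Suc (r ^ 2 div 2))"
      using M.tame_bound_even_lower M.tame_bound_even r by (intro enat_eqI) (simp_all add: tH)
    moreover have "tame_degree (zero_sum_monoid ?K) = enat (Suc (r ^ 2 div 2))"
      using S.tame_bound_even_lower S.tame_bound_even r by (intro enat_eqI) (simp_all add: tG)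
    ultimately show ?thesis by simp
  qed
  moreover have "tame_degree H = tame_degree (zero_sum_monoid ?K) \<and>
      tame_degree (zero_sum_monoid ?K) \<ge> enat (2 + r * (r - 1) div 2)" if r: "r \<ge> 5 \<and> odd r"
  proof
    have low: "\<not> tame_bound (\<lambda>x. x) ?G (1 + r * (r - 1) div 2)"
      using r by (intro S.tame_bound_odd_lower_5) simp_all
    then have "\<not> tame_degree (zero_sum_monoid ?K) \<le> enat (1 + r * (r - 1) div 2)" by (simp only: tG not_False_eq_True)
    then show "tame_degree (zero_sum_monoid ?K) \<ge> enat (2 + r * (r - 1) div 2)"
      by (simp add: not_le Suc_ile_eq)
    show "tame_degree H = tame_degree (zero_sum_monoid ?K)"
    proof (rule enat_eq_if_same_bounds)
      fix N
      have "tame_bound ?c P N" if N: "tame_bound (\<lambda>x. x) ?G N"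
      proof (rule M.tame_bound_transfer[OF _ _ _ N])
        show "2 + r * (r - 1) div 2 \<le> N"
        proof (rule ccontr)
          assume "\<not> ?thesis"
          then have "N \<le> 1 + r * (r - 1) div 2" by simp
          then show False using tame_bound_mono[OF N] low by blast
        qed
      qed (use r in auto)
      then show "tame_degree H \<le> enat N \<longleftrightarrow> tame_degree (zero_sum_monoid ?K) \<le> enat N"
        unfolding tH tG using M.tame_bound_restrict by blast
    qed
  qed
  ultimately show ?thesis by blast
qed

end
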